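(* Let $D\subset\mathbb{R}^3$ be compact with $O\notin D$, such that either $D$ is contained in a plane or $D$ is countable, and let $M=\max_{P\in D}OP$. Let $\Omega\subseteq S^2$ with $|\partial\Omega|=0$, let $f\in L^1(\bar\Omega)$ with $f>0$ a.e., and let $\eta$ be a Radon measure on $D$. Let $\delta>0$, $c_\delta=-\delta+\sqrt{1+\delta^2}$, $k\ge\frac{1+c_\delta}{1-c_\delta}$, and assume $\int_{\bar\Omega}f\,dx\ge\frac1C\,\eta(D)$ with $C=\frac{(1-c_\delta)^3}{(1+c_\delta)(k\delta M)^2}$. Let $P_0$ be in the support of $\eta$. Let $\mathcal R$ be the set of all reflectors $\sigma=\{\rho(x)x\}_{x\in\bar\Omega}\in\mathcal A(\delta)$ from $\bar\Omega$ to $D$ whose reflector measure $\mu_\sigma$ satisfies $\eta(E)\le\mu_\sigma(E)$ for each Borel set $E\subseteq D$, $\eta(E)=\mu_\sigma(E)$ for each Borel set $E\subseteq D$ with $P_0\notin E$, and $\frac{\delta M}{1+c_\delta}\le\rho(x)\le\frac{k\delta M}{1-c_\delta}$ for all $x\in\bar\Omega$. Then there exists $\sigma\in\mathcal R$ such that $$\mu_\sigma(\{P_0\})=\inf_{\sigma'\in\mathcal R}\mu_{\sigma'}(\{P_0\}).$$ Moreover, for this $\sigma$: if $\mu_\sigma(\{P_0\})>0$, then $\mu_\sigma(G)>\eta(G)$ for every (relatively) open set $G\subseteq D$ with $P_0\in G$; and if $\mu_\sigma(\{P_0\})=0$, then $\mu_\sigma=\eta$.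
   Context: $S^2$ is the unit sphere of $\mathbb{R}^3$ centered at the origin $O$; $dx$ and $|\cdot|$ denote surface (Lebesgue) measure on $S^2$; $\bar\Omega$, $\partial\Omega$ are closure and boundary in $S^2$. For $P\ne O$ write $OP=|P|$ and $m_P=P/|P|$. For $d>0$, $E_d(P)$ is the ellipsoid of revolution with foci $O$ and $P$ with polar radius $\rho_d(x)=\frac{d}{1-\varepsilon\,x\cdot m_P}$, $x\in S^2$, where $\varepsilon=\sqrt{1+\frac{d^2}{OP^2}}-\frac{d}{OP}\in(0,1)$ is its eccentricity ($\rho_d$ also depends on $P$). A surface $\sigma=\{\rho(x)x\}_{x\in\bar\Omega}$, $\rho>0$, is a reflector from $\bar\Omega$ to $D$ if for each $x_0\in\bar\Omega$ there is an ellipsoid $E_d(P)$ with $P\in D$ that supports $\sigma$ at $\rho(x_0)x_0$, i.e. $\rho(x)\le\rho_d(x)$ for all $x\in\bar\Omega$ with equality at $x=x_0$. For $P\in D$, $\tau_\sigma(P)$ is the set of $x_0\in\bar\Omega$ such that some $E_d(P)$ supports $\sigma$ at $\rho(x_0)x_0$; for $E\subseteq D$, $\tau_\sigma(E)=\bigcup_{P\in E}\tau_\sigma(P)$ (Lebesgue measurable for $E$ Borel). $\mathcal A(\delta)$ is the set of reflectors $\sigma$ from $\bar\Omega$ to $D$ such that for each $x_0\in\bar\Omega$ there is a supporting ellipsoid $E_d(P)$ to $\sigma$ at $\rho(x_0)x_0$ with $P\in D$ and $d\ge\delta M$. The reflector measure of $\sigma\in\mathcal A(\delta)$ is $\mu_\sigma(E)=\int_{\tau_\sigma(E)}f(x)\,\frac{x\cdot\nu_\rho(x)}{\rho(x)^2}\,dx$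 for Borel $E\subseteq D$, where $\nu_\rho(x)$ is the outer unit normal to $\sigma$ at $\rho(x)x$ (defined for a.e. $x\in\bar\Omega$; a.e. it equals $\frac{x-\varepsilon m_P}{|x-\varepsilon m_P|}$ where $E_d(P)$ is the supporting ellipsoid at that point and $\varepsilon$ its eccentricity). *)

theory Defs
  imports "HOL-Analysis.Analysis"
begin

section \<open>Lebesgue measure on the unit sphere of \<open>\<real>\<^sup>3\<close>\<close>

abbreviation S2 :: "(real^3) set" where
  "S2 \<equiv> sphere 0 1"

text \<open>
  Surface measure as in polar coordinates: the area of a Borel set \<open>A\<close> is three times the
  volume of the cone \<open>{t *\<^sub>R x | 0 < t \<le> 1, x \<in> A}\<close>. The completion adds the Lebesgue measurable sets.
\<close>
definition sphere_measure :: "(real^3) measure" where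
  "sphere_measure =
     completion (scale_measure 3
       (distr (restrict_space lborel (cball 0 1 - {0})) (restrict_space borel S2)
          (\<lambda>y. y /\<^sub>R norm y)))"

definition S2_closure :: "(real^3) set \<Rightarrow> (real^3) set" where
  "S2_closure \<Omega> = top_of_set S2 closure_of \<Omega>"

definition S2_frontier :: "(real^3) set \<Rightarrow> (real^3) set" where
  "S2_frontier \<Omega> = top_of_set S2 frontier_of \<Omega>"

lemma sphere_measure_total: "emeasure sphere_measure S2 = ennreal (4 * pi)"
proof -
  let ?f = "\<lambda>y::real^3. y /\<^sub>R norm y"
  let ?A = "cball 0 1 - {0::real^3}"
  have A: "?A \<in> sets lborel" by simp
  have f: "?f \<in> restrict_space lborel ?A \<rightarrow>\<^sub>M restrict_space borel S2"
    by (intro measurable_restrict_space2 measurable_restrict_space1) (auto simp: space_restrict_space)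
  have vim: "?f -` S2 \<inter> space (restrict_space lborel ?A) = ?A"
    by (auto simp: space_restrict_space)
  have S: "S2 \<in> sets (restrict_space borel S2)"
    using sets.top[of "restrict_space borel S2"] by (simp add: space_restrict_space)
  have "emeasure lborel ?A = emeasure lborel (cball (0::real^3) 1)"
    by (subst emeasure_Diff) auto
  also have "\<dots> = ennreal (4 / 3 * pi)"
    by (simp add: emeasure_cball unit_ball_vol_3)
  finally have "emeasure lborel ?A = ennreal (4 / 3 * pi)" .
  then have "emeasure sphere_measure S2 = 3 * ennreal (4 / 3 * pi)"
    unfolding sphere_measure_def
    using S f vim A
    by (simp add: emeasure_distr emeasure_restrict_space)
  also have "\<dots> = ennreal 3 * ennreal (4 / 3 * pi)" by simp
  also have "\<dots> = ennreal (4 * pi)"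
    by (subst ennreal_mult'[symmetric]) auto
  finally show ?thesis .
qed

section \<open>Radon measures\<close>

definition radon_measure_on :: "(real^3) set \<Rightarrow> (real^3) measure \<Rightarrow> bool" where
  "radon_measure_on D \<eta> \<longleftrightarrow>
     sets \<eta> = sets (restrict_space borel D) \<and>
     (\<forall>K. compact K \<and> K \<subseteq> D \<longrightarrow> emeasure \<eta> K < \<infinity>) \<and>
     (\<forall>B\<in>sets \<eta>. emeasure \<eta> B =
        (INF U\<in>{U. openin (top_of_set D) U \<and> B \<subseteq> U}. emeasure \<eta> U)) \<and>
     (\<forall>U. openin (top_of_set D) U \<longrightarrow> emeasure \<eta> U =
        (SUP K\<in>{K. compact K \<and> K \<subseteq> U}. emeasure \<eta> K))"

definition measure_support :: "(real^3) set \<Rightarrow> (real^3) measure \<Rightarrow> (real^3) set" where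
  "measure_support D \<eta> =
     {P \<in> D. \<forall>G. openin (top_of_set D) G \<and> P \<in> G \<longrightarrow> emeasure \<eta> G > 0}"

section \<open>Ellipsoids with one focus at the origin\<close>

definition ecc :: "real \<Rightarrow> real^3 \<Rightarrow> real" where
  "ecc d P = sqrt (1 + d\<^sup>2 / (norm P)\<^sup>2) - d / norm P"

definition ellipsoid_radius :: "real \<Rightarrow> real^3 \<Rightarrow> real^3 \<Rightarrow> real" where
  "ellipsoid_radius d P x = d / (1 - ecc d P * (x \<bullet> (P /\<^sub>R norm P)))"

section \<open>Reflectors\<close>

text \<open>
  A surface \<open>{\<rho>(x) x | x \<in> X}\<close>, where \<open>X\<close> is a closed subset of the sphere, is represented by its
  polar radius \<open>\<rho>\<close>; the values of \<open>\<rho>\<close> outside \<open>X\<close> play no role.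
\<close>

definition radial_surface :: "(real^3) set \<Rightarrow> (real^3 \<Rightarrow> real) \<Rightarrow> (real^3) set" where
  "radial_surface X \<rho> = (\<lambda>x. \<rho> x *\<^sub>R x) ` X"

definition supports ::
  "(real^3) set \<Rightarrow> (real^3 \<Rightarrow> real) \<Rightarrow> real \<Rightarrow> real^3 \<Rightarrow> real^3 \<Rightarrow> bool" where
  "supports X \<rho> d P x0 \<longleftrightarrow>
     d > 0 \<and> (\<forall>x\<in>X. \<rho> x \<le> ellipsoid_radius d P x) \<and> \<rho> x0 = ellipsoid_radius d P x0"

definition reflector :: "(real^3) set \<Rightarrow> (real^3) set \<Rightarrow> (real^3 \<Rightarrow> real) \<Rightarrow> bool" where
  "reflector X D \<rho> \<longleftrightarrow>
     (\<forall>x\<in>X. \<rho> x > 0) \<and> (\<forall>x0\<in>X. \<exists>P\<in>D. \<exists>d. supports X \<rho> d P x0)"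

definition trace_at :: "(real^3) set \<Rightarrow> (real^3 \<Rightarrow> real) \<Rightarrow> real^3 \<Rightarrow> (real^3) set" where
  "trace_at X \<rho> P = {x0\<in>X. \<exists>d. supports X \<rho> d P x0}"

definition trace_set :: "(real^3) set \<Rightarrow> (real^3 \<Rightarrow> real) \<Rightarrow> (real^3) set \<Rightarrow> (real^3) set" where
  "trace_set X \<rho> E = (\<Union>P\<in>E. trace_at X \<rho> P)"

definition max_dist :: "(real^3) set \<Rightarrow> real" where
  "max_dist D = (SUP P\<in>D. norm P)"

definition admissible_reflectors ::
  "(real^3) set \<Rightarrow> (real^3) set \<Rightarrow> real \<Rightarrow> (real^3 \<Rightarrow> real) set" where
  "admissible_reflectors X D \<delta> =
     {\<rho>. reflector X D \<rho> \<and>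
         (\<forall>x0\<in>X. \<exists>P\<in>D. \<exists>d. d \<ge> \<delta> * max_dist D \<and> supports X \<rho> d P x0)}"

text \<open>
  The outer unit normal at \<open>p = \<rho>(x) x\<close>: the unit vector orthogonal to the tangent plane of the
  surface at \<open>p\<close> (secants through \<open>p\<close> become orthogonal to it) that points away from the side of
  the origin. It exists and is unique at almost every \<open>x \<in> X\<close> if \<open>\<rho>\<close> is the radius of a reflector
  and the boundary of \<open>X\<close> in the sphere is a null set; elsewhere the value is irrelevant.
\<close>
definition is_outer_unit_normal ::
  "(real^3) set \<Rightarrow> (real^3 \<Rightarrow> real) \<Rightarrow> real^3 \<Rightarrow> real^3 \<Rightarrow> bool" where
  "is_outer_unit_normal X \<rho> x n \<longleftrightarrow>
     norm n = 1 \<and> x \<bullet> n > 0 \<and>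
     ((\<lambda>q. ((q - \<rho> x *\<^sub>R x) \<bullet> n) / norm (q - \<rho> x *\<^sub>R x)) \<longlongrightarrow> 0)
       (at (\<rho> x *\<^sub>R x) within radial_surface X \<rho>)"

definition outer_normal :: "(real^3) set \<Rightarrow> (real^3 \<Rightarrow> real) \<Rightarrow> real^3 \<Rightarrow> real^3" where
  "outer_normal X \<rho> x = (THE n. is_outer_unit_normal X \<rho> x n)"

definition reflector_measure ::
  "(real^3) set \<Rightarrow> (real^3 \<Rightarrow> real) \<Rightarrow> (real^3 \<Rightarrow> real) \<Rightarrow> (real^3) set \<Rightarrow> ennreal" where
  "reflector_measure X f \<rho> E =
     (\<integral>\<^sup>+ x \<in> trace_set X \<rho> E.
        ennreal (f x * (x \<bullet> outer_normal X \<rho> x) / (\<rho> x)\<^sup>2) \<partial>sphere_measure)"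

definition c_of :: "real \<Rightarrow> real" where
  "c_of \<delta> = - \<delta> + sqrt (1 + \<delta>\<^sup>2)"

definition reflector_solutions ::
  "(real^3) set \<Rightarrow> (real^3) set \<Rightarrow> (real^3 \<Rightarrow> real) \<Rightarrow> (real^3) measure \<Rightarrow> real \<Rightarrow> real \<Rightarrow> real^3
     \<Rightarrow> (real^3 \<Rightarrow> real) set" where
  "reflector_solutions X D f \<eta> \<delta> k P0 =
     {\<rho> \<in> admissible_reflectors X D \<delta>.
        (\<forall>E\<in>sets borel. E \<subseteq> D \<longrightarrow> emeasure \<eta> E \<le> reflector_measure X f \<rho> E) \<and>
        (\<forall>E\<in>sets borel. E \<subseteq> D \<and> P0 \<notin> E \<longrightarrow> emeasure \<eta> E = reflector_measure X f \<rho> E) \<and>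
        (\<forall>x\<in>X. \<delta> * max_dist D / (1 + c_of \<delta>) \<le> \<rho> x \<and>
               \<rho> x \<le> k * \<delta> * max_dist D / (1 - c_of \<delta>))}"

end

(*
The reciprocal of an ellipsoid's radius is the affine function 1/d - w \<bullet> x, with w = (\<epsilon>/d) m_P, and
the focus can be recovered from it: P = 2 w / (1/d^2 - |w|^2). So 1/\<rho> is a supremum of such
functions, and p = x/d - w is a subgradient of the homogeneous extension of this supremum and a
normal to the surface. A convex function has a unique subgradient almost everywhere (lines meet the
exceptional set in few points, then Fubini), and p determines the reflected ray; together with the
shape of D this makes the supporting pair (P, d) unique for almost every x. Uniqueness makes the pair
stable under pointwise convergence of reflectors, so the reflector measures of a convergent sequence
converge weakly, and Arzela-Ascoli makes the class of admissible reflectors with the prescribed bounds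
sequentially compact.

For a finite set of foci, fix the ellipsoid at P0 to d = k \<delta> M and take the smallest parameters for
which no other focus receives too much light. None of them reaches \<delta> M, since otherwise P0 would
receive nothing although the energy condition forces the total light to exceed \<eta>(D) strictly. Hence
all other foci receive the exact amount. Approximating \<eta> by discrete measures gives a solution, and
compactness gives a solution with the least light at P0. As the total strictly exceeds \<eta>(D), P0
always receives strictly more than \<eta>({P0}); the case \<mu>({P0}) = 0 of the theorem is void.
*)
theory Submission
  imports Defs "HOL-Complex_Analysis.Great_Picard"
begin

section \<open>Null sets of the sphere and unique subgradients\<close>

text \<open>Origin of the constants: the light density is (x . nu)/rho^2. For d >= delta M the
  eccentricity is at most c, which gives x . nu > (1 - c)/(1 + c); with rho <= k delta M/(1 - c) the
  product of the two bounds is C. The bound on k makes the ellipsoid with parameter delta M at any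
  focus, of radius at most delta M/(1 - c), lie inside the one at P0 with parameter k delta M, of
  radius at least k delta M/(1 + c). The obstacle to uniqueness is that a conormal fixes only the
  reflected ray, and several points of D may lie on it. If D is countable, two such foci put x on
  one of countably many great circles. If D lies in a plane, so do the whole ray and the surface
  point; the plane then acts as one more function touching 1/rho with a different gradient, and the
  argument about kinks applies again. Being a solution means that the reflector measure is eta plus
  a point mass at P0. Tested against continuous functions, this identity passes to weak limits,
  which the conditions on single Borel sets do not do directly.\<close>

lemma null_sets_scale_measure:
  assumes "N \<in> null_sets M" shows "N \<in> null_sets (scale_measure r M)"
  using assms by (auto simp: null_sets_def)

text \<open>Moves null set questions from the sphere into space, where Fubini along straight lines
  is available. Since \<open>N\<close> is invariant under positive dilations, the radial projection
  pulls \<open>N \<inter> S2\<close> back into \<open>N\<close>.\<close>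

lemma sphere_null_cone:
  fixes N :: "(real^3) set"
  assumes N: "N \<in> null_sets lborel"
    and cone: "\<And>y t. y \<in> N \<Longrightarrow> t > 0 \<Longrightarrow> t *\<^sub>R y \<in> N"
  shows "N \<inter> S2 \<in> null_sets sphere_measure"
proof -
  let ?f = "\<lambda>y::real^3. y /\<^sub>R norm y"
  let ?A = "cball 0 1 - {0::real^3}"
  have A: "?A \<in> sets lborel" by simp
  have f: "?f \<in> restrict_space lborel ?A \<rightarrow>\<^sub>M restrict_space borel S2"
    by (intro measurable_restrict_space2 measurable_restrict_space1) (auto simp: space_restrict_space)
  have NS: "N \<inter> S2 \<in> sets (restrict_space borel S2)"
    using N by (auto simp: sets_restrict_space null_sets_def)
  have sub: "?f -` (N \<inter> S2) \<inter> ?A \<subseteq> N"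
  proof
    fix y assume y: "y \<in> ?f -` (N \<inter> S2) \<inter> ?A"
    then have "norm y *\<^sub>R (y /\<^sub>R norm y) \<in> N" using cone[of "y /\<^sub>R norm y" "norm y"] by (auto simp del: scaleR_scaleR)
    moreover have "norm y *\<^sub>R (y /\<^sub>R norm y) = y" using y by auto
    ultimately show "y \<in> N" by (simp only:)
  qed
  have "emeasure (distr (restrict_space lborel ?A) (restrict_space borel S2) ?f) (N \<inter> S2)
      = emeasure lborel (?f -` (N \<inter> S2) \<inter> ?A)"
    using f NS A by (subst emeasure_distr) (auto simp: emeasure_restrict_space space_restrict_space)
  also have "\<dots> \<le> emeasure lborel N"
    using N sub by (intro emeasure_mono) auto
  also have "\<dots> = 0" using N by auto
  finally have "N \<inter> S2 \<in> null_sets (distr (restrict_space lborel ?A) (restrict_space borel S2) ?f)"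
    using NS by (auto simp: null_sets_def)
  then show ?thesis
    unfolding sphere_measure_def by (intro null_sets_completionI null_sets_scale_measure)
qed

lemma space_sphere_measure [simp]: "space sphere_measure = S2"
  by (simp add: sphere_measure_def space_scale_measure space_restrict_space)

lemma sets_sphere_measureI: "B \<in> sets borel \<Longrightarrow> B \<inter> S2 \<in> sets sphere_measure"
  unfolding sphere_measure_def
  by (intro sets_completionI_sets) (auto simp: sets_restrict_space)

lemma complete_sphere_measure: "A \<subseteq> N \<Longrightarrow> N \<in> null_sets sphere_measure \<Longrightarrow> A \<in> null_sets sphere_measure"
  unfolding sphere_measure_def by (rule completion.complete2)

lemma finite_sphere_measure: "finite_measure sphere_measure"
  by (rule finite_measureI) (simp add: sphere_measure_total)

lemma null_sphere_plane:
  fixes a :: "real^3"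
  assumes "a \<noteq> 0" shows "{x\<in>S2. a \<bullet> x = 0} \<in> null_sets sphere_measure"
proof -
  have "{y. a \<bullet> y = 0} \<in> null_sets lborel"
    using negligible_hyperplane[of a 0] assms closed_hyperplane[of a 0]
    by (simp add: negligible_iff_null_sets null_sets_completion_iff)
  then have "{y. a \<bullet> y = 0} \<inter> S2 \<in> null_sets sphere_measure"
    by (rule sphere_null_cone) auto
  moreover have "{y. a \<bullet> y = 0} \<inter> S2 = {x\<in>S2. a \<bullet> x = 0}" by auto
  ultimately show ?thesis by (simp only:)
qed

text \<open>The set in the conclusion meets every line parallel to \<open>e\<close> in at most one point.\<close>

lemma null_kink_set:
  fixes G :: "'a::euclidean_space \<Rightarrow> real"
  assumes G: "continuous_on UNIV G" and ab: "a < b"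
  shows "{y. \<forall>s>0. G (y + s *\<^sub>R e) - G y \<ge> b * s \<and> G y - G (y - s *\<^sub>R e) \<le> a * s} \<in> null_sets lborel"
    (is "?K \<in> _")
proof -
  have "?K = (\<Inter>s\<in>{0<..}. {y. b * s \<le> G (y + s *\<^sub>R e) - G y} \<inter> {y. G y - G (y - s *\<^sub>R e) \<le> a * s})"
    by auto
  also have "closed \<dots>"
    by (intro closed_INT ballI closed_Int closed_Collect_le continuous_intros
          continuous_on_compose2[OF G]) auto
  finally have K: "closed ?K" .
  then have Kb [measurable]: "?K \<in> sets borel" by auto
  \<comment> \<open>Over the segment between two such points the slope would be at least b seen from
    the first point and at most a seen from the second.\<close>
  have one: "t = t'" if "y + t *\<^sub>R e \<in> ?K" "y + t' *\<^sub>R e \<in> ?K" for y t t'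
  proof -
    have *: False if tt: "t < t'" and 1: "y + t *\<^sub>R e \<in> ?K" and 2: "y + t' *\<^sub>R e \<in> ?K" for t t'
    proof -
      have "b * (t' - t) \<le> G ((y + t *\<^sub>R e) + (t' - t) *\<^sub>R e) - G (y + t *\<^sub>R e)"
        using 1 tt by auto
      moreover have "G (y + t' *\<^sub>R e) - G ((y + t' *\<^sub>R e) - (t' - t) *\<^sub>R e) \<le> a * (t' - t)"
        using 2 tt by auto
      moreover have "(y + t *\<^sub>R e) + (t' - t) *\<^sub>R e = y + t' *\<^sub>R e"
        "(y + t' *\<^sub>R e) - (t' - t) *\<^sub>R e = y + t *\<^sub>R e"
        by (auto simp: algebra_simps)
      ultimately have "b * (t' - t) \<le> a * (t' - t)" by simp
      then show False using ab tt by (simp add: mult_le_cancel_right)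
    qed
    then show ?thesis using that by (meson linorder_neqE_linordered_idom)
  qed
  \<comment> \<open>Averaging over the translates by t in [0,1] keeps the measure of the set;
    integrating in t first then meets at most one point on each line.\<close>
  let ?g = "\<lambda>(y,t). indicator ?K (y + t *\<^sub>R e) * indicator {0..1} t :: ennreal"
  have g [measurable]: "?g \<in> borel_measurable (lborel \<Otimes>\<^sub>M lborel)"
    by measurable
  have "emeasure lborel ?K = (\<integral>\<^sup>+t. emeasure lborel ?K * indicator {0..1} t \<partial>(lborel::real measure))"
    by (simp add: nn_integral_cmult)
  also have "\<dots> = (\<integral>\<^sup>+t. (\<integral>\<^sup>+y. ?g (y, t) \<partial>lborel) \<partial>lborel)"
  proof (rule nn_integral_cong)
    fix t :: real
    have "emeasure lborel ?K = (\<integral>\<^sup>+y. indicator ?K y \<partial>(distr lborel borel ((+) (t *\<^sub>R e))))"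
      by (simp add: lborel_distr_plus)
    also have "\<dots> = (\<integral>\<^sup>+y. indicator ?K (t *\<^sub>R e + y) \<partial>lborel)"
      by (rule nn_integral_distr) auto
    finally have "emeasure lborel ?K = (\<integral>\<^sup>+y. indicator ?K (y + t *\<^sub>R e) \<partial>lborel)"
      by (simp add: add.commute)
    then show "emeasure lborel ?K * indicator {0..1} t = (\<integral>\<^sup>+y. ?g (y, t) \<partial>lborel)"
      by (auto simp: indicator_def)
  qed
  also have "\<dots> = (\<integral>\<^sup>+y. (\<integral>\<^sup>+t. ?g (y, t) \<partial>lborel) \<partial>lborel)"
    using g by (rule lborel_pair.Fubini)
  also have "\<dots> = (\<integral>\<^sup>+y. 0 \<partial>(lborel::'a measure))"
  proof (rule nn_integral_cong)
    fix y :: 'a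
    obtain t0 where "{t. y + t *\<^sub>R e \<in> ?K} \<subseteq> {t0}" using one by blast
    then have "(\<integral>\<^sup>+t. ?g (y, t) \<partial>lborel) \<le> (\<integral>\<^sup>+t. indicator {t0} t \<partial>(lborel::real measure))"
      by (intro nn_integral_mono) (auto simp: indicator_def)
    then show "(\<integral>\<^sup>+t. ?g (y, t) \<partial>lborel) = 0" by simp
  qed
  finally show ?thesis using Kb by (auto simp: null_sets_def)
qed

text \<open>
  The supremum \<open>G\<close> of the functions \<open>y \<mapsto> \<alpha> |y| - w \<bullet> y\<close> is homogeneous, and \<open>\<alpha> x - w\<close> is a
  subgradient of \<open>G\<close> at \<open>x\<close> for every member of the family that attains the supremum at \<open>x\<close>.
\<close>

lemma null_two_subgradients:
  fixes F :: "(real \<times> (real^3)) set"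
  assumes F: "\<And>\<alpha> w. (\<alpha>, w) \<in> F \<Longrightarrow> 0 \<le> \<alpha> \<and> \<alpha> \<le> B \<and> norm w \<le> B"
  shows "{x\<in>S2. \<exists>\<alpha> w \<alpha>' w'. (\<alpha>, w) \<in> F \<and> (\<alpha>', w') \<in> F \<and> \<alpha> *\<^sub>R x - w \<noteq> \<alpha>' *\<^sub>R x - w' \<and>
     (\<forall>(\<beta>, v)\<in>F. \<beta> - v \<bullet> x \<le> \<alpha> - w \<bullet> x \<and> \<beta> - v \<bullet> x \<le> \<alpha>' - w' \<bullet> x)} \<in> null_sets sphere_measure"
    (is "?T \<in> _")
proof (cases "F = {}")
  case True then show ?thesis by simp
next
  case False
  let ?l = "\<lambda>(\<alpha>::real, w) (y::real^3). \<alpha> * norm y - w \<bullet> y"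
  define G where "G y = (SUP l\<in>F. ?l l y)" for y
  have bd: "?l l y \<le> 2 * B * norm y" if "l \<in> F" for l y
  proof -
    obtain \<alpha> w where l: "l = (\<alpha>, w)" by force
    have "\<alpha> * norm y \<le> B * norm y" using F that l by (intro mult_right_mono) auto
    moreover have "- (w \<bullet> y) \<le> B * norm y"
      using Cauchy_Schwarz_ineq2[of w y] mult_right_mono[of "norm w" B "norm y"] F that l by fastforce
    ultimately show ?thesis using l by simp
  qed
  have bdd: "bdd_above ((\<lambda>l. ?l l y) ` F)" for y
    using bd by (intro bdd_aboveI2[where M="2 * B * norm y"]) blast
  have up: "?l l y \<le> G y" if "l \<in> F" for l y
    unfolding G_def using that bdd by (intro cSUP_upper)
  have least: "G y \<le> c" if "\<And>l. l \<in> F \<Longrightarrow> ?l l y \<le> c" for y c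
    unfolding G_def using that False by (intro cSUP_least)
  have hom: "G (t *\<^sub>R y) = t * G y" if "t > 0" for t y
  proof -
    have le: "G (t *\<^sub>R y) \<le> t * G y" if "t > 0" for t y
    proof (rule least)
      fix l assume "l \<in> F"
      then have "t * ?l l y \<le> t * G y" using up that by (intro mult_left_mono) auto
      moreover have "?l l (t *\<^sub>R y) = t * ?l l y" using that by (auto simp: algebra_simps split: prod.splits)
      ultimately show "?l l (t *\<^sub>R y) \<le> t * G y" by simp
    qed
    have "G (inverse t *\<^sub>R (t *\<^sub>R y)) \<le> inverse t * G (t *\<^sub>R y)" using that by (intro le) auto
    then have "t * G y \<le> G (t *\<^sub>R y)" using that by (simp add: field_simps)
    then show ?thesis using le[OF that, of y] by auto
  qed
  have Lip: "G y \<le> G z + 2 * B * norm (y - z)" for y z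
  proof (rule least)
    fix l assume l: "l \<in> F"
    obtain \<alpha> w where lw: "l = (\<alpha>, w)" by force
    have "\<alpha> * (norm y - norm z) \<le> \<alpha> * norm (y - z)"
      using F l lw norm_triangle_ineq2[of y z] by (intro mult_left_mono) auto
    also have "\<dots> \<le> B * norm (y - z)" using F l lw by (intro mult_right_mono) auto
    finally have 1: "\<alpha> * norm y \<le> \<alpha> * norm z + B * norm (y - z)" by (simp add: algebra_simps)
    have "- (w \<bullet> (y - z)) \<le> B * norm (y - z)"
      using Cauchy_Schwarz_ineq2[of w "y - z"] mult_right_mono[of "norm w" B "norm (y - z)"] F l lw by fastforce
    then have "?l l y \<le> ?l l z + 2 * B * norm (y - z)" using 1 lw by (simp add: inner_diff_right)
    then show "?l l y \<le> G z + 2 * B * norm (y - z)" using up[OF l, of z] by linarith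
  qed
  have B0: "0 \<le> B" using False F by force
  have "(2 * B)-lipschitz_on UNIV G"
  proof (rule lipschitz_onI)
    fix y z show "dist (G y) (G z) \<le> 2 * B * dist y z"
      using Lip[of y z] Lip[of z y] by (auto simp: dist_real_def dist_norm norm_minus_commute)
  qed (use B0 in auto)
  then have cont: "continuous_on UNIV G" by (rule lipschitz_on_continuous_on)
  \<comment> \<open>Homogeneity of \<open>G\<close> makes these kink sets cones, so that their
    traces on the sphere are null.\<close>
  define K where "K a b e = {y. \<forall>s>0. G (y + s *\<^sub>R e) - G y \<ge> b * s \<and> G y - G (y - s *\<^sub>R e) \<le> a * s}" for a b e
  have Knull: "K a b e \<inter> S2 \<in> null_sets sphere_measure" if "a < b" for a b e
  proof (rule sphere_null_cone)
    show "K a b e \<in> null_sets lborel" unfolding K_def using cont that by (rule null_kink_set)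
    fix y and t :: real assume y: "y \<in> K a b e" and t: "t > 0"
    have "b * s \<le> G (t *\<^sub>R y + s *\<^sub>R e) - G (t *\<^sub>R y) \<and> G (t *\<^sub>R y) - G (t *\<^sub>R y - s *\<^sub>R e) \<le> a * s" if "s > 0" for s
    proof -
      have "G (t *\<^sub>R y + s *\<^sub>R e) = t * G (y + (s/t) *\<^sub>R e)" "G (t *\<^sub>R y - s *\<^sub>R e) = t * G (y - (s/t) *\<^sub>R e)"
        using t hom[OF t, of "y + (s/t) *\<^sub>R e"] hom[OF t, of "y - (s/t) *\<^sub>R e"] by (simp_all add: algebra_simps)
      moreover have "b * (s/t) \<le> G (y + (s/t) *\<^sub>R e) - G y \<and> G y - G (y - (s/t) *\<^sub>R e) \<le> a * (s/t)"
        using y divide_pos_pos[OF that t] unfolding K_def by blast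
      ultimately show ?thesis using t by (simp add: hom[OF t]) (simp add: field_simps)
    qed
    then show "t *\<^sub>R y \<in> K a b e" unfolding K_def by auto
  qed
  \<comment> \<open>The term \<alpha> |y| lies above its linearization at a unit vector by
    Cauchy-Schwarz, which is why \<alpha> y - w is a subgradient.\<close>
  have sub: "G y + s * ((\<alpha> *\<^sub>R y - w) \<bullet> e) \<le> G (y + s *\<^sub>R e)"
    if "(\<alpha>, w) \<in> F" "norm y = 1" "G y = \<alpha> - w \<bullet> y" for \<alpha> w y e s
  proof -
    have "y \<bullet> (y + s *\<^sub>R e) \<le> norm (y + s *\<^sub>R e)"
      using norm_cauchy_schwarz[of y "y + s *\<^sub>R e"] that by simp
    then have "\<alpha> * (y \<bullet> (y + s *\<^sub>R e)) \<le> \<alpha> * norm (y + s *\<^sub>R e)"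
      using F that by (intro mult_left_mono) auto
    moreover have "y \<bullet> y = 1" using that by (simp add: dot_square_norm)
    ultimately have "\<alpha> + \<alpha> * (s * (y \<bullet> e)) \<le> \<alpha> * norm (y + s *\<^sub>R e)"
      by (simp add: inner_add_right algebra_simps)
    then show ?thesis using up[OF that(1), of "y + s *\<^sub>R e"] that(3)
      by (simp add: inner_add_right inner_diff_left algebra_simps)
  qed
  \<comment> \<open>Two distinct subgradients differ in some coordinate i. Rationals a < b between
    the two entries show a kink in direction i: the larger subgradient bounds the forward slopes
    below, the smaller one the backward slopes above. There are only countably many triples (i, a,
    b).\<close>
  have "?T \<subseteq> (\<Union>i. \<Union>a\<in>\<rat>. \<Union>b\<in>\<rat>\<inter>{a<..}. K a b (axis i 1) \<inter> S2)"
  proof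
    fix x assume "x \<in> ?T"
    then obtain \<alpha> w \<alpha>' w' where x: "x \<in> S2" and F2: "(\<alpha>, w) \<in> F" "(\<alpha>', w') \<in> F"
      and ne: "\<alpha> *\<^sub>R x - w \<noteq> \<alpha>' *\<^sub>R x - w'"
      and top: "\<And>\<beta> v. (\<beta>, v) \<in> F \<Longrightarrow> \<beta> - v \<bullet> x \<le> \<alpha> - w \<bullet> x \<and> \<beta> - v \<bullet> x \<le> \<alpha>' - w' \<bullet> x"
      by blast
    have G1: "G x = \<alpha> - w \<bullet> x"
      using up[OF F2(1), of x] x top by (intro antisym least) (auto split: prod.splits)
    have G2: "G x = \<alpha>' - w' \<bullet> x"
      using up[OF F2(2), of x] x top by (intro antisym least) (auto split: prod.splits)
    have *: "\<exists>i a b. a \<in> \<rat> \<and> b \<in> \<rat> \<and> a < b \<and> x \<in> K a b (axis i 1)"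
      if F2: "(\<alpha>, w) \<in> F" "(\<alpha>', w') \<in> F" and G1: "G x = \<alpha> - w \<bullet> x" and G2: "G x = \<alpha>' - w' \<bullet> x"
       and lt: "(\<alpha> *\<^sub>R x - w) $ i < (\<alpha>' *\<^sub>R x - w') $ i" for \<alpha> w \<alpha>' w' i
    proof -
      obtain b where b: "b \<in> \<rat>" "(\<alpha> *\<^sub>R x - w) $ i < b" "b < (\<alpha>' *\<^sub>R x - w') $ i"
        using Rats_dense_in_real[OF lt] by auto
      obtain a where a: "a \<in> \<rat>" "(\<alpha> *\<^sub>R x - w) $ i < a" "a < b"
        using Rats_dense_in_real[OF b(2)] by auto
      have nx: "norm x = 1" using x by simp
      have "b * s \<le> G (x + s *\<^sub>R axis i 1) - G x \<and> G x - G (x - s *\<^sub>R axis i 1) \<le> a * s" if s: "s > 0" for s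
      proof -
        have "b * s \<le> s * (\<alpha>' *\<^sub>R x - w') $ i" using b s by (simp add: mult.commute)
        moreover have "s * (\<alpha> *\<^sub>R x - w) $ i \<le> a * s" using a s by (simp add: mult.commute)
        ultimately show ?thesis
          using sub[OF F2(2) nx G2, of s "axis i 1"] sub[OF F2(1) nx G1, of "-s" "axis i 1"]
          by (simp add: inner_axis)
      qed
      then show ?thesis using a b unfolding K_def by blast
    qed
    obtain i where "(\<alpha> *\<^sub>R x - w) $ i \<noteq> (\<alpha>' *\<^sub>R x - w') $ i" using ne by (auto simp: vec_eq_iff)
    then have "\<exists>i a b. a \<in> \<rat> \<and> b \<in> \<rat> \<and> a < b \<and> x \<in> K a b (axis i 1)"
      using *[OF F2 G1 G2] *[OF F2(2,1) G2 G1] by (meson linorder_neqE_linordered_idom)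
    then show "x \<in> (\<Union>i. \<Union>a\<in>\<rat>. \<Union>b\<in>\<rat>\<inter>{a<..}. K a b (axis i 1) \<inter> S2)" using x by blast
  qed
  moreover have "(\<Union>i::3. \<Union>a\<in>\<rat>. \<Union>b\<in>\<rat>\<inter>{a<..}. K a b (axis i 1) \<inter> S2) \<in> null_sets sphere_measure"
    by (intro null_sets_UN' Knull countable_Int1 countable_rat) (auto simp: countable_finite)
  ultimately show ?thesis by (rule complete_sphere_measure)
qed

section \<open>Geometry of the ellipsoids\<close>

definition focal_vec :: "real \<Rightarrow> real^3 \<Rightarrow> real^3" where
  "focal_vec d P = (ecc d P / d) *\<^sub>R (P /\<^sub>R norm P)"

text \<open>Equal to (x - eps m_P)/d, the outer normal of the ellipsoid before normalization. The
  factor 1/d is chosen so that its inner product with the ellipsoid point in direction x is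
  1.\<close>

definition conormal :: "real \<Rightarrow> real^3 \<Rightarrow> real^3 \<Rightarrow> real^3" where
  "conormal d P x = (1 / d) *\<^sub>R x - focal_vec d P"

lemma ecc_alt: "ecc d P = sqrt (1 + (d / norm P)\<^sup>2) - d / norm P"
  by (simp add: ecc_def power_divide)

lemma eccentricity_bounds:
  fixes s :: real assumes "s > 0"
  shows "0 < sqrt (1 + s\<^sup>2) - s" "sqrt (1 + s\<^sup>2) - s < 1"
proof -
  have "s < sqrt (1 + s\<^sup>2)" by (rule real_less_rsqrt) simp
  then show "0 < sqrt (1 + s\<^sup>2) - s" by simp
  have "sqrt (1 + s\<^sup>2) < 1 + s" using assms by (intro real_less_lsqrt) (auto simp: power2_eq_square algebra_simps)
  then show "sqrt (1 + s\<^sup>2) - s < 1" by simp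
qed

lemma eccentricity_antimono:
  fixes s :: real assumes "s > 0" "s \<le> s'"
  shows "sqrt (1 + s'\<^sup>2) - s' \<le> sqrt (1 + s\<^sup>2) - s"
proof -
  have *: "sqrt (1 + s\<^sup>2) - s = 1 / (sqrt (1 + s\<^sup>2) + s)" if "s > 0" for s :: real
    using that by (simp add: field_simps add_pos_pos add_pos_nonneg add_nonneg_eq_0_iff power2_eq_square[symmetric])
  have "1 / (sqrt (1 + s'\<^sup>2) + s') \<le> 1 / (sqrt (1 + s\<^sup>2) + s)"
    using assms by (intro divide_left_mono add_mono mult_pos_pos add_nonneg_pos) auto
  then show ?thesis using *[of s] *[of s'] assms by simp
qed

lemma ecc_pos: "d > 0 \<Longrightarrow> P \<noteq> 0 \<Longrightarrow> 0 < ecc d P"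
  unfolding ecc_alt by (rule eccentricity_bounds) simp

lemma ecc_less_1: "d > 0 \<Longrightarrow> P \<noteq> 0 \<Longrightarrow> ecc d P < 1"
  unfolding ecc_alt by (rule eccentricity_bounds) simp

text \<open>The parameter d is the semi-latus rectum, so the major axis has length 2d/(1 - eps^2),
  and the foci are eps times that far apart.\<close>

lemma ecc_quadratic:
  assumes "P \<noteq> 0"
  shows "norm P * (1 - (ecc d P)\<^sup>2) = 2 * d * ecc d P"
proof -
  define s where "s = d / norm P"
  define r where "r = sqrt (1 + s\<^sup>2)"
  have d: "d = norm P * s" using assms by (simp add: s_def)
  have "r\<^sup>2 = 1 + s\<^sup>2" by (simp add: r_def)
  then have "1 - (r - s)\<^sup>2 = 2 * s * (r - s)" by (simp add: power2_eq_square algebra_simps)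
  moreover have "ecc d P = r - s" by (simp add: ecc_alt r_def s_def)
  ultimately show ?thesis using d by simp
qed

lemma c_of_bounds: "\<delta> > 0 \<Longrightarrow> 0 < c_of \<delta> \<and> c_of \<delta> < 1"
  using eccentricity_bounds[of \<delta>] by (simp add: c_of_def)

text \<open>The eccentricity is a decreasing function of d/OP alone, and
  \<open>c_of \<delta>\<close> is its value at the ratio \<delta>.\<close>

lemma ecc_le_c_of:
  assumes "\<delta> > 0" "d \<ge> \<delta> * M" "norm P \<le> M" "P \<noteq> 0"
  shows "ecc d P \<le> c_of \<delta>"
proof -
  have "\<delta> * norm P \<le> \<delta> * M" using assms by (intro mult_left_mono) auto
  then have "\<delta> * norm P \<le> d" using assms(2) by linarith
  then have "\<delta> \<le> d / norm P" using assms(4) by (simp add: field_simps)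
  then show ?thesis using eccentricity_antimono[OF assms(1)] by (simp add: ecc_alt c_of_def)
qed

lemma norm_focal_vec: "d > 0 \<Longrightarrow> P \<noteq> 0 \<Longrightarrow> norm (focal_vec d P) = ecc d P / d"
  using ecc_pos[of d P] by (simp add: focal_vec_def)

lemma norm_focal_vec_less: "d > 0 \<Longrightarrow> P \<noteq> 0 \<Longrightarrow> norm (focal_vec d P) < 1 / d"
  using ecc_less_1[of d P] by (simp add: norm_focal_vec divide_strict_right_mono)

lemma inner_unit_bounds:
  fixes x m :: "'a::real_inner"
  assumes "norm x = 1" "norm m = 1"
  shows "- 1 \<le> x \<bullet> m" "x \<bullet> m \<le> 1"
  using Cauchy_Schwarz_ineq2[of x m] assms by auto

lemma ellipsoid_denominator_bounds:
  assumes "d > 0" "P \<noteq> 0" "norm x = 1"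
  shows "1 - ecc d P \<le> 1 - ecc d P * (x \<bullet> (P /\<^sub>R norm P))"
    "1 - ecc d P * (x \<bullet> (P /\<^sub>R norm P)) \<le> 1 + ecc d P"
proof -
  have m: "norm (P /\<^sub>R norm P) = 1" using assms by simp
  note b = inner_unit_bounds[OF assms(3) m]
  have "ecc d P * (x \<bullet> (P /\<^sub>R norm P)) \<le> ecc d P * 1"
    using b ecc_pos[OF assms(1,2)] by (intro mult_left_mono) auto
  then show "1 - ecc d P \<le> 1 - ecc d P * (x \<bullet> (P /\<^sub>R norm P))" by simp
  have "ecc d P * (-1) \<le> ecc d P * (x \<bullet> (P /\<^sub>R norm P))"
    using b ecc_pos[OF assms(1,2)] by (intro mult_left_mono) auto
  then show "1 - ecc d P * (x \<bullet> (P /\<^sub>R norm P)) \<le> 1 + ecc d P" by simp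
qed

lemma ellipsoid_radius_bounds:
  assumes "d > 0" "P \<noteq> 0" "norm x = 1"
  shows "d / (1 + ecc d P) \<le> ellipsoid_radius d P x" "ellipsoid_radius d P x \<le> d / (1 - ecc d P)"
    "0 < ellipsoid_radius d P x"
proof -
  note b = ellipsoid_denominator_bounds[OF assms] and e = ecc_pos[OF assms(1,2)] ecc_less_1[OF assms(1,2)]
  show "d / (1 + ecc d P) \<le> ellipsoid_radius d P x" "ellipsoid_radius d P x \<le> d / (1 - ecc d P)"
    unfolding ellipsoid_radius_def using b e assms(1)
    by (intro divide_left_mono mult_pos_pos; linarith)+
  show "0 < ellipsoid_radius d P x"
    unfolding ellipsoid_radius_def using b e assms(1) by (intro divide_pos_pos) linarith+
qed

text \<open>From eps < 1. Read backwards, it bounds the parameter of a supporting ellipsoid by twice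
  the radius of the surface.\<close>

lemma ellipsoid_radius_bounds_simple:
  assumes "d > 0" "P \<noteq> 0" "norm x = 1"
  shows "d / 2 \<le> ellipsoid_radius d P x"
proof -
  have "d / 2 \<le> d / (1 + ecc d P)"
    using ecc_pos[OF assms(1,2)] ecc_less_1[OF assms(1,2)] assms by (intro divide_left_mono) auto
  then show ?thesis using ellipsoid_radius_bounds(1)[OF assms] by linarith
qed

lemma inverse_ellipsoid_radius:
  "1 / ellipsoid_radius d P x = 1 / d - focal_vec d P \<bullet> x"
  by (simp add: ellipsoid_radius_def focal_vec_def diff_divide_distrib inner_commute)

lemma inner_conormal:
  assumes "norm x = 1"
  shows "x \<bullet> conormal d P x = 1 / ellipsoid_radius d P x"
proof -
  have "x \<bullet> x = 1" using assms by (simp add: dot_square_norm)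
  then show ?thesis
    by (simp add: conormal_def inverse_ellipsoid_radius inner_diff_right inner_commute)
qed

lemma inner_conormal_pos:
  assumes "d > 0" "P \<noteq> 0" "norm x = 1"
  shows "0 < x \<bullet> conormal d P x"
  using ellipsoid_radius_bounds(3)[OF assms] inner_conormal[OF assms(3)] by simp

lemma focal_gap_pos: "d > 0 \<Longrightarrow> P \<noteq> 0 \<Longrightarrow> 0 < (1 / d)\<^sup>2 - (norm (focal_vec d P))\<^sup>2"
  using norm_focal_vec_less[of d P] by (simp add: power_strict_mono del: power_divide)

text \<open>The denominator is (1 - eps^2)/d^2, so the length of the right side is the one given by
  \<open>ecc_quadratic\<close>. Hence d and the focal vector together determine the focus.\<close>

lemma focus_eq:
  assumes "d > 0" "P \<noteq> 0"
  shows "P = (2 / ((1 / d)\<^sup>2 - (norm (focal_vec d P))\<^sup>2)) *\<^sub>R focal_vec d P"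
proof -
  let ?e = "ecc d P"
  have e: "1 - ?e\<^sup>2 > 0" using ecc_pos[OF assms] ecc_less_1[OF assms] by (simp add: power_less_one_iff abs_square_less_1)
  have "(1 / d)\<^sup>2 - (norm (focal_vec d P))\<^sup>2 = (1 - ?e\<^sup>2) / d\<^sup>2"
    using assms by (simp add: norm_focal_vec power_divide diff_divide_distrib)
  then have "2 / ((1 / d)\<^sup>2 - (norm (focal_vec d P))\<^sup>2) * (?e / d) = 2 * d * ?e / (1 - ?e\<^sup>2)"
    using assms e by (simp add: power2_eq_square)
  also have "\<dots> = norm P" using ecc_quadratic[OF assms(2), of d] e by (simp add: field_simps)
  finally have len: "2 / ((1 / d)\<^sup>2 - (norm (focal_vec d P))\<^sup>2) * (?e / d) = norm P" .
  define l where "l = 2 / ((1 / d)\<^sup>2 - (norm (focal_vec d P))\<^sup>2)"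
  have "l *\<^sub>R focal_vec d P = (l * (?e / d)) *\<^sub>R (P /\<^sub>R norm P)"
    unfolding focal_vec_def by (rule scaleR_scaleR)
  also have "l * (?e / d) = norm P" using len unfolding l_def .
  also have "norm P *\<^sub>R (P /\<^sub>R norm P) = P" using assms(2) by simp
  finally show ?thesis unfolding l_def by (rule sym)
qed

text \<open>With u = 1/d and b = 1/OP, the reciprocal radius is u - (sqrt(u^2 + b^2) - b) t, where t
  <= 1 is the cosine of the angle to P. It is nondecreasing in u because the square root grows at
  most as fast as u.\<close>

lemma ellipsoid_radius_mono:
  assumes "0 < d" "d \<le> d'" "P \<noteq> 0" "norm x = 1"
  shows "ellipsoid_radius d P x \<le> ellipsoid_radius d' P x"
proof -
  define m where "m = P /\<^sub>R norm P"
  define b where "b = 1 / norm P"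
  have b: "b > 0" using assms by (simp add: b_def)
  have w: "1 / ellipsoid_radius d P x = 1 / d - (sqrt ((1/d)\<^sup>2 + b\<^sup>2) - b) * (x \<bullet> m)" if "d > 0" for d
  proof -
    have "sqrt ((1/d)\<^sup>2 + b\<^sup>2) = sqrt ((1 / d)\<^sup>2 * (1 + (d / norm P)\<^sup>2))"
      using that by (simp add: b_def field_simps)
    also have "\<dots> = (1 / d) * sqrt (1 + (d / norm P)\<^sup>2)"
      using that by (simp only: real_sqrt_mult real_sqrt_abs) simp
    finally have "ecc d P / d = sqrt ((1/d)\<^sup>2 + b\<^sup>2) - b"
      using that assms by (simp add: ecc_alt b_def diff_divide_distrib)
    then show ?thesis by (simp add: inverse_ellipsoid_radius focal_vec_def m_def inner_commute)
  qed
  have le: "1 / d' \<le> 1 / d" using assms by (simp add: frac_le)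
  have s: "sqrt ((1/d')\<^sup>2 + b\<^sup>2) \<le> sqrt ((1/d)\<^sup>2 + b\<^sup>2)"
    using le assms by (intro real_sqrt_le_mono add_right_mono power_mono) auto
  \<comment> \<open>The triangle inequality in the plane shows that u \<mapsto> sqrt(u^2 + b^2) has
    Lipschitz constant 1.\<close>
  have "norm ((1/d, b) :: real \<times> real) \<le> norm ((1/d', b) :: real \<times> real) + norm ((1/d, b) - (1/d', b) :: real \<times> real)"
    using norm_triangle_ineq[of "(1/d', b)" "(1/d, b) - (1/d', b)"] by simp
  then have 1: "sqrt ((1/d)\<^sup>2 + b\<^sup>2) - sqrt ((1/d')\<^sup>2 + b\<^sup>2) \<le> 1/d - 1/d'"
    using le assms(1,2) by (simp add: norm_Pair)
  have m: "norm m = 1" using assms by (simp add: m_def)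
  have "(sqrt ((1/d)\<^sup>2 + b\<^sup>2) - sqrt ((1/d')\<^sup>2 + b\<^sup>2)) * (x \<bullet> m) \<le> (sqrt ((1/d)\<^sup>2 + b\<^sup>2) - sqrt ((1/d')\<^sup>2 + b\<^sup>2)) * 1"
    using s inner_unit_bounds[OF assms(4) m] by (intro mult_left_mono) auto
  with 1 have "1 / ellipsoid_radius d' P x \<le> 1 / ellipsoid_radius d P x"
    using w[of d] w[of d'] assms by (simp add: algebra_simps)
  then show ?thesis
    using ellipsoid_radius_bounds(3)[of d P x] ellipsoid_radius_bounds(3)[of d' P x] assms
    by (simp add: field_simps)
qed

text \<open>Up to the factor |p|^2, the vector on the right is the mirror image of x in the plane
  orthogonal to p, and x/(x . p) is the surface point. So x and p fix the ray, and d only enters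
  through the position of P on it.\<close>

lemma focus_on_reflected_ray:
  assumes "d > 0" "P \<noteq> 0" "norm x = 1"
  defines "p \<equiv> conormal d P x"
  shows "P - (1 / (x \<bullet> p)) *\<^sub>R x =
    (1 / ((x \<bullet> p) * (2 / d * (x \<bullet> p) - (norm p)\<^sup>2))) *\<^sub>R ((norm p)\<^sup>2 *\<^sub>R x - (2 * (x \<bullet> p)) *\<^sub>R p)"
    "0 < 2 / d * (x \<bullet> p) - (norm p)\<^sup>2"
proof -
  define s where "s = x \<bullet> p"
  have s: "s > 0" unfolding s_def p_def using assms by (intro inner_conormal_pos)
  have w: "focal_vec d P = (1 / d) *\<^sub>R x - p" by (simp add: p_def conormal_def)
  have "(norm (focal_vec d P))\<^sup>2 = (1/d)\<^sup>2 - 2 / d * s + (norm p)\<^sup>2"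
  proof -
    have "x \<bullet> x = 1" using assms(3) by (simp add: dot_square_norm)
    then show ?thesis unfolding w s_def power2_norm_eq_inner
      by (simp add: inner_diff_left inner_diff_right inner_commute[of p x] power2_eq_square diff_divide_distrib)
  qed
  then have gap: "(1 / d)\<^sup>2 - (norm (focal_vec d P))\<^sup>2 = 2 / d * s - (norm p)\<^sup>2" by simp
  define g where "g = 2 / d * s - (norm p)\<^sup>2"
  have g: "g > 0" using focal_gap_pos[OF assms(1,2)] gap g_def by simp
  then show "0 < 2 / d * (x \<bullet> p) - (norm p)\<^sup>2" by (simp add: g_def s_def)
  have "P = (2 / g) *\<^sub>R ((1 / d) *\<^sub>R x - p)"
    using focus_eq[OF assms(1,2)] gap w g_def by simp
  then have "P - (1 / s) *\<^sub>R x = (2 / g / d - 1 / s) *\<^sub>R x - (2 / g) *\<^sub>R p"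
    by (simp add: algebra_simps)
  also have "2 / g / d - 1 / s = 1 / (s * g) * (norm p)\<^sup>2"
  proof -
    have e: "2 * s - d * g = d * (norm p)\<^sup>2"
      using assms(1) unfolding g_def by (simp add: right_diff_distrib)
    have "2 / g / d - 1 / s = (2 * s - d * g) / (s * g * d)"
      using s g assms(1) by (simp add: diff_divide_distrib)
    also have "\<dots> = 1 / (s * g) * (norm p)\<^sup>2"
      unfolding e using assms(1) by simp
    finally show ?thesis .
  qed
  also have "(2 / g) = 1 / (s * g) * (2 * s)" using s g by simp
  finally show "P - (1 / (x \<bullet> p)) *\<^sub>R x =
    (1 / ((x \<bullet> p) * (2 / d * (x \<bullet> p) - (norm p)\<^sup>2))) *\<^sub>R ((norm p)\<^sup>2 *\<^sub>R x - (2 * (x \<bullet> p)) *\<^sub>R p)"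
    by (simp add: s_def g_def scaleR_diff_right)
qed

text \<open>A lower bound for the cosine of the angle between x and the normal. It is strict because
  |q| comes close to 1 + eps only in directions away from P and x . q comes close to 1 - eps only
  towards P; the case split on the sign of t separates the two. This strictness later produces the
  surplus of light.\<close>

lemma conormal_aperture:
  assumes "d > 0" "P \<noteq> 0" "norm x = 1" "ecc d P \<le> c" "0 < c" "c < 1"
  shows "(1 - c) * norm (conormal d P x) < (1 + c) * (x \<bullet> conormal d P x)"
proof -
  define m where "m = P /\<^sub>R norm P"
  define e where "e = ecc d P"
  define t where "t = x \<bullet> m"
  define q where "q = x - e *\<^sub>R m"
  have m: "norm m = 1" using assms by (simp add: m_def)
  have e: "0 < e" "e < 1" "e \<le> c" using assms ecc_pos ecc_less_1 by (auto simp: e_def)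
  have t: "-1 \<le> t" "t \<le> 1" using inner_unit_bounds[OF assms(3) m] by (auto simp: t_def)
  have p: "conormal d P x = (1 / d) *\<^sub>R q"
    by (simp add: conormal_def focal_vec_def q_def e_def m_def scaleR_diff_right)
  have xq: "x \<bullet> q = 1 - e * t"
    using assms(3) by (simp add: q_def inner_diff_right t_def dot_square_norm)
  have qq: "(norm q)\<^sup>2 = 1 - 2 * e * t + e\<^sup>2"
  proof -
    have "x \<bullet> x = 1" "m \<bullet> m = 1" using assms(3) m by (simp_all add: dot_square_norm)
    then show ?thesis unfolding q_def power2_norm_eq_inner t_def
      by (simp add: inner_diff_left inner_diff_right inner_commute[of m x] power2_eq_square right_diff_distrib)
  qed
  have nq: "norm q \<le> 1 + c"
    using norm_triangle_ineq4[of x "e *\<^sub>R m"] assms(3) m e by (simp add: q_def)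
  have et: "e * t \<le> e" using e t by (simp add: mult_left_le)
  have "(1 - c) * norm q < (1 + c) * (1 - e * t)"
  proof (cases "t \<le> 0")
    case True
    then have "e * t \<le> 0" using e by (simp add: mult_nonneg_nonpos)
    then have "(1 + c) * 1 \<le> (1 + c) * (1 - e * t)" using assms by (intro mult_left_mono) auto
    moreover have "(1 - c) * norm q \<le> (1 - c) * (1 + c)" using nq assms by (intro mult_left_mono) auto
    moreover have "(1 - c) * (1 + c) < 1 * (1 + c)" using assms by (intro mult_strict_right_mono) auto
    ultimately show ?thesis by simp
  next
    case False
    then have "0 < e * t" using e by simp
    moreover have "e\<^sup>2 \<le> c\<^sup>2" using e by (intro power_mono) auto
    moreover have "(1 + c)\<^sup>2 = 1 + 2 * c + c\<^sup>2" by (simp add: power2_eq_square algebra_simps)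
    ultimately have "(norm q)\<^sup>2 < (1 + c)\<^sup>2" using qq assms(5) by linarith
    then have "norm q < 1 + c" using assms(5) by (simp add: power2_less_imp_less)
    then have "(1 - c) * norm q < (1 - c) * (1 + c)" using assms by (intro mult_strict_left_mono) auto
    also have "\<dots> = (1 + c) * (1 - c)" by simp
    also have "\<dots> \<le> (1 + c) * (1 - e * t)" using e(3) et assms(5) by (intro mult_left_mono) linarith+
    finally show ?thesis .
  qed
  then show ?thesis using assms(1) xq unfolding p by (simp add: divide_strict_right_mono)
qed

section \<open>Continuity in the parameter, the focus and the direction\<close>

lemma tendsto_ecc:
  assumes "(d \<longlongrightarrow> d0) F" "(P \<longlongrightarrow> P0) F" "P0 \<noteq> 0"
  shows "((\<lambda>n. ecc (d n) (P n)) \<longlongrightarrow> ecc d0 P0) F"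
  unfolding ecc_def using assms by (intro tendsto_intros) auto

lemma tendsto_focal_vec:
  assumes "(d \<longlongrightarrow> d0) F" "(P \<longlongrightarrow> P0) F" "P0 \<noteq> 0" "d0 \<noteq> 0"
  shows "((\<lambda>n. focal_vec (d n) (P n)) \<longlongrightarrow> focal_vec d0 P0) F"
  unfolding focal_vec_def using assms by (intro tendsto_intros tendsto_ecc) auto

lemma tendsto_conormal:
  assumes "(d \<longlongrightarrow> d0) F" "(P \<longlongrightarrow> P0) F" "(x \<longlongrightarrow> x0) F" "P0 \<noteq> 0" "d0 \<noteq> 0"
  shows "((\<lambda>n. conormal (d n) (P n) (x n)) \<longlongrightarrow> conormal d0 P0 x0) F"
  unfolding conormal_def using assms by (intro tendsto_intros tendsto_focal_vec) auto

lemma tendsto_ellipsoid_radius: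
  assumes "(d \<longlongrightarrow> d0) F" "(P \<longlongrightarrow> P0) F" "(x \<longlongrightarrow> x0) F" "P0 \<noteq> 0" "d0 > 0" "norm x0 = 1"
  shows "((\<lambda>n. ellipsoid_radius (d n) (P n) (x n)) \<longlongrightarrow> ellipsoid_radius d0 P0 x0) F"
proof -
  have "1 - ecc d0 P0 * (x0 \<bullet> (P0 /\<^sub>R norm P0)) \<noteq> 0"
    using ellipsoid_denominator_bounds(1)[OF assms(5,4,6)] ecc_less_1[OF assms(5,4)] by linarith
  then show ?thesis
    unfolding ellipsoid_radius_def using assms by (intro tendsto_intros tendsto_ecc) auto
qed

section \<open>Uniqueness of the supporting ellipsoid\<close>

lemma supports_iff_inverse:
  assumes "X \<subseteq> S2" "\<And>x. x \<in> X \<Longrightarrow> \<rho> x > 0" "P \<noteq> 0" "x0 \<in> X"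
  shows "supports X \<rho> d P x0 \<longleftrightarrow>
    d > 0 \<and> (\<forall>x\<in>X. 1 / d - focal_vec d P \<bullet> x \<le> 1 / \<rho> x) \<and> 1 / \<rho> x0 = 1 / d - focal_vec d P \<bullet> x0"
proof (cases "d > 0")
  case True
  have r: "0 < ellipsoid_radius d P x" if "x \<in> X" for x
    using ellipsoid_radius_bounds(3)[OF True assms(3)] assms(1) that by auto
  have 1: "\<rho> x \<le> ellipsoid_radius d P x \<longleftrightarrow> 1 / ellipsoid_radius d P x \<le> 1 / \<rho> x"
    and 2: "\<rho> x = ellipsoid_radius d P x \<longleftrightarrow> 1 / \<rho> x = 1 / ellipsoid_radius d P x" if "x \<in> X" for x
    using r[OF that] assms(2)[OF that] by (auto simp: field_simps)
  have "supports X \<rho> d P x0 \<longleftrightarrow>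
      (\<forall>x\<in>X. \<rho> x \<le> ellipsoid_radius d P x) \<and> \<rho> x0 = ellipsoid_radius d P x0"
    using True by (simp add: supports_def)
  also have "\<dots> \<longleftrightarrow> (\<forall>x\<in>X. 1 / ellipsoid_radius d P x \<le> 1 / \<rho> x) \<and> 1 / \<rho> x0 = 1 / ellipsoid_radius d P x0"
    using 1 2[OF assms(4)] by simp
  finally show ?thesis using True unfolding inverse_ellipsoid_radius by simp
qed (simp add: supports_def)

text \<open>The set \<open>V\<close> admits further functions that compete with the ellipsoids. They
  only have to stay below 1/\<rho> at the point x in question, not on all of \<open>X\<close>: at
  such x the enlarged family still has supremum 1/\<rho>. It serves to add the plane that contains
  D.\<close>

lemma null_distinct_conormals:
  fixes V :: "(real \<times> (real^3)) set"
  assumes X: "X \<subseteq> S2" and \<rho>: "\<And>x. x \<in> X \<Longrightarrow> \<rho> x > 0" and D: "0 \<notin> D"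
    and V: "\<And>\<alpha> w. (\<alpha>, w) \<in> V \<Longrightarrow> 0 \<le> \<alpha> \<and> \<alpha> \<le> B \<and> norm w \<le> B"
  defines "F \<equiv> \<lambda>x. {(1 / d, focal_vec d P) |P d. P \<in> D \<and> supports X \<rho> d P x} \<union> V"
  shows "{x\<in>X. (\<forall>(\<beta>, v)\<in>V. \<beta> - v \<bullet> x \<le> 1 / \<rho> x) \<and>
      (\<exists>(\<alpha>, w)\<in>F x. \<exists>(\<alpha>', w')\<in>F x. 1 / \<rho> x = \<alpha> - w \<bullet> x \<and> 1 / \<rho> x = \<alpha>' - w' \<bullet> x \<and>
         \<alpha> *\<^sub>R x - w \<noteq> \<alpha>' *\<^sub>R x - w')} \<in> null_sets sphere_measure" (is "?N \<in> _")
proof -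
  \<comment> \<open>Supporting parameters may be arbitrarily small, but the result on subgradients
    needs a bounded family. The cut-off 1/d <= n restores this, and two given members belong to
    \<open>H n\<close> for all large n.\<close>
  define H where "H n = {(1 / d, focal_vec d P) |P d. P \<in> D \<and> d > 0 \<and> 1 / d \<le> real n \<and>
      (\<forall>x\<in>X. 1 / d - focal_vec d P \<bullet> x \<le> 1 / \<rho> x)} \<union> V" for n
  define T where "T n = {x\<in>S2. \<exists>\<alpha> w \<alpha>' w'. (\<alpha>, w) \<in> H n \<and> (\<alpha>', w') \<in> H n \<and> \<alpha> *\<^sub>R x - w \<noteq> \<alpha>' *\<^sub>R x - w' \<and>
     (\<forall>(\<beta>, v)\<in>H n. \<beta> - v \<bullet> x \<le> \<alpha> - w \<bullet> x \<and> \<beta> - v \<bullet> x \<le> \<alpha>' - w' \<bullet> x)}" for n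
  have T: "T n \<in> null_sets sphere_measure" for n
    unfolding T_def
  proof (rule null_two_subgradients[where B="max (real n) B"])
    fix \<alpha> w assume "(\<alpha>, w) \<in> H n"
    then consider "(\<alpha>, w) \<in> V" | P d where "\<alpha> = 1 / d" "w = focal_vec d P" "P \<in> D" "d > 0" "1 / d \<le> real n"
      unfolding H_def by auto
    then show "0 \<le> \<alpha> \<and> \<alpha> \<le> max (real n) B \<and> norm w \<le> max (real n) B"
    proof cases
      case 2
      then have "norm w < 1 / d" using norm_focal_vec_less[of d P] D by auto
      then show ?thesis using 2 by auto
    qed (use V in fastforce)
  qed
  have "?N \<subseteq> (\<Union>n. T n)"
  proof
    fix x assume "x \<in> ?N"
    then obtain \<alpha> w \<alpha>' w' where x: "x \<in> X" and Vx: "\<And>\<beta> v. (\<beta>, v) \<in> V \<Longrightarrow> \<beta> - v \<bullet> x \<le> 1 / \<rho> x"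
      and F: "(\<alpha>, w) \<in> F x" "(\<alpha>', w') \<in> F x" and eq: "1 / \<rho> x = \<alpha> - w \<bullet> x" "1 / \<rho> x = \<alpha>' - w' \<bullet> x"
      and ne: "\<alpha> *\<^sub>R x - w \<noteq> \<alpha>' *\<^sub>R x - w'"
      by blast
    have top: "\<beta> - v \<bullet> x \<le> 1 / \<rho> x" if "(\<beta>, v) \<in> H n" for \<beta> v n
      using that x Vx unfolding H_def by auto
    have in_H: "\<exists>n0. \<forall>n\<ge>n0. (\<alpha>, w) \<in> H n" if in_F: "(\<alpha>, w) \<in> F x" for \<alpha> w
    proof (cases "(\<alpha>, w) \<in> V")
      case False
      then obtain P d where Pd: "\<alpha> = 1 / d" "w = focal_vec d P" "P \<in> D" "supports X \<rho> d P x"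
        using in_F unfolding F_def by auto
      then have "d > 0 \<and> (\<forall>x\<in>X. 1 / d - focal_vec d P \<bullet> x \<le> 1 / \<rho> x)"
        using supports_iff_inverse[where \<rho>=\<rho>, OF X \<rho> _ x, of P d] D by auto
      moreover obtain n0 where "1 / d \<le> real n0" using real_arch_simple by blast
      ultimately have "(\<alpha>, w) \<in> H n" if "n \<ge> n0" for n
        unfolding H_def using that Pd by fastforce
      then show ?thesis by blast
    qed (auto simp: H_def)
    obtain n1 n2 where "\<forall>n\<ge>n1. (\<alpha>, w) \<in> H n" "\<forall>n\<ge>n2. (\<alpha>', w') \<in> H n"
      using in_H F by meson
    then have "(\<alpha>, w) \<in> H (max n1 n2)" "(\<alpha>', w') \<in> H (max n1 n2)" by auto
    moreover have "\<forall>(\<beta>, v)\<in>H (max n1 n2). \<beta> - v \<bullet> x \<le> \<alpha> - w \<bullet> x \<and> \<beta> - v \<bullet> x \<le> \<alpha>' - w' \<bullet> x"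
      using top by (auto simp: eq[symmetric])
    moreover have "x \<in> S2" using x X by blast
    ultimately have "x \<in> T (max n1 n2)" unfolding T_def using ne by blast
    then show "x \<in> (\<Union>n. T n)" by blast
  qed
  moreover have "(\<Union>n. T n) \<in> null_sets sphere_measure" using T by (intro null_sets_UN)
  ultimately show ?thesis by (rule complete_sphere_measure)
qed

text \<open>Uniqueness among all d > 0, not only d >= \<delta> M, since \<open>trace_at\<close>
  admits every parameter.\<close>

definition unique_support :: "(real^3) set \<Rightarrow> (real^3) set \<Rightarrow> (real^3 \<Rightarrow> real) \<Rightarrow> real^3 \<Rightarrow> bool" where
  "unique_support X D \<rho> x \<longleftrightarrow> (\<forall>P d P' d'. P \<in> D \<longrightarrow> P' \<in> D \<longrightarrow>
     supports X \<rho> d P x \<longrightarrow> supports X \<rho> d' P' x \<longrightarrow> P = P' \<and> d = d')"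

lemma supports_inverse_at:
  assumes "supports X \<rho> d P x" "x \<in> S2" "P \<noteq> 0"
  shows "d > 0" "x \<bullet> conormal d P x = 1 / \<rho> x" "1 / \<rho> x = 1 / d - focal_vec d P \<bullet> x"
  using assms inner_conormal[of x d P] inverse_ellipsoid_radius[of d P x] by (auto simp: supports_def)

text \<open>Outside the null set with two conormals, equal d gives equal focal vectors and hence
  equal foci. With different d the direction x lies in a plane through the origin that contains both
  foci, and countable D gives countably many of these planes.\<close>

lemma null_nonunique_countable:
  assumes X: "X \<subseteq> S2" and \<rho>: "\<And>x. x \<in> X \<Longrightarrow> \<rho> x > 0" and D: "0 \<notin> D" "countable D"
  shows "{x\<in>X. \<not> unique_support X D \<rho> x} \<in> null_sets sphere_measure" (is "?N \<in> _")
proof -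
  define F where "F x = {(1 / d, focal_vec d P) |P d. P \<in> D \<and> supports X \<rho> d P x} \<union> {}" for x
  define N1 where "N1 = {x\<in>X. (\<forall>(\<beta>, v)\<in>{}. \<beta> - v \<bullet> x \<le> 1 / \<rho> x) \<and>
      (\<exists>(\<alpha>, w)\<in>F x. \<exists>(\<alpha>', w')\<in>F x. 1 / \<rho> x = \<alpha> - w \<bullet> x \<and> 1 / \<rho> x = \<alpha>' - w' \<bullet> x \<and>
         \<alpha> *\<^sub>R x - w \<noteq> \<alpha>' *\<^sub>R x - w')}"
  have N1: "N1 \<in> null_sets sphere_measure"
    unfolding N1_def F_def by (rule null_distinct_conormals[OF X \<rho> D(1)]) auto
  have "\<exists>a::real^3. a \<noteq> 0 \<and> a \<bullet> P = 0 \<and> a \<bullet> P' = 0" for P P' :: "real^3"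
  proof -
    have "dim {P, P'} \<le> card {P, P'}" by (rule dim_le_card) (auto simp: span_base)
    also have "\<dots> < DIM(real^3)" using card_insert_le_m1[of 2 "{P'}" P] by (simp add: card_insert_if)
    finally obtain a where "a \<noteq> 0" "\<And>x. x \<in> span {P, P'} \<Longrightarrow> orthogonal a x"
      using orthogonal_to_subspace_exists by blast
    then show ?thesis by (auto simp: orthogonal_def span_base)
  qed
  then obtain A where A: "\<And>P P'. A P P' \<noteq> (0::real^3)" "\<And>P P'. A P P' \<bullet> P = 0" "\<And>P P'. A P P' \<bullet> P' = 0"
    by metis
  define N2 where "N2 = (\<Union>P\<in>D. \<Union>P'\<in>D. {x\<in>S2. A P P' \<bullet> x = 0})"
  have N2: "N2 \<in> null_sets sphere_measure"
    unfolding N2_def using D(2) A(1) by (intro null_sets_UN' null_sphere_plane) auto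
  have "?N \<subseteq> N1 \<union> N2"
  proof
    fix x assume "x \<in> ?N"
    then obtain P d P' d' where x: "x \<in> X" and P: "P \<in> D" "P' \<in> D" and s: "supports X \<rho> d P x" "supports X \<rho> d' P' x"
      and ne: "P \<noteq> P' \<or> d \<noteq> d'" by (auto simp: unique_support_def)
    have x1: "x \<in> S2" using x X by auto
    have P0: "P \<noteq> 0" "P' \<noteq> 0" using P D by auto
    note q = supports_inverse_at[OF s(1) x1 P0(1)] and q' = supports_inverse_at[OF s(2) x1 P0(2)]
    show "x \<in> N1 \<union> N2"
    proof (cases "conormal d P x = conormal d' P' x")
      case False
      have "(1 / d, focal_vec d P) \<in> F x" "(1 / d', focal_vec d' P') \<in> F x"
        using P s unfolding F_def by blast+
      then have "x \<in> N1" using False x q q' unfolding N1_def conormal_def by blast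
      then show ?thesis by simp
    next
      case True
      show ?thesis
      proof (cases "d = d'")
        case True
        then have "focal_vec d P = focal_vec d' P'" using \<open>conormal d P x = conormal d' P' x\<close> by (simp add: conormal_def)
        then have "P = P'" using focus_eq[OF q(1) P0(1)] focus_eq[OF q'(1) P0(2)] True by metis
        then show ?thesis using ne True by simp
      next
        case False
        have a: "A P P' \<bullet> focal_vec d P = 0" "A P P' \<bullet> focal_vec d' P' = 0"
          using A by (auto simp: focal_vec_def)
        \<comment> \<open>Pairing with a vector orthogonal to both foci removes the focal vectors
          from the common conormal, leaving (a . x)/d = (a . x)/d'.\<close>
        have "(1 / d) * (A P P' \<bullet> x) = (1 / d') * (A P P' \<bullet> x)"
          using arg_cong[OF True, of "\<lambda>v. A P P' \<bullet> v"] a by (simp add: conormal_def inner_diff_right)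
        then have "A P P' \<bullet> x = 0" using False q(1) q'(1) by simp
        then have "x \<in> N2" using P x1 unfolding N2_def by blast
        then show ?thesis by simp
      qed
    qed
  qed
  then show ?thesis using N1 N2 by (meson complete_sphere_measure null_sets.Un)
qed

text \<open>Two foci on one reflected ray put the whole ray, and with it the surface point \<rho>(x)
  x, into the plane a . y = b. If b = 0, then x lies on a great circle. Otherwise a . x / b is the
  reciprocal radius of the plane, it equals 1/\<rho> at x, and its gradient a/b differs from the
  conormal.\<close>

lemma null_nonunique_planar:
  assumes X: "X \<subseteq> S2" and \<rho>: "\<And>x. x \<in> X \<Longrightarrow> \<rho> x > 0" and D: "0 \<notin> D" "a \<noteq> 0" "D \<subseteq> {y. a \<bullet> y = b}"
  shows "{x\<in>X. \<not> unique_support X D \<rho> x} \<in> null_sets sphere_measure" (is "?N \<in> _")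
proof -
  define F where "F V x = {(1 / d, focal_vec d P) |P d. P \<in> D \<and> supports X \<rho> d P x} \<union> V" for V x
  define N where "N V = {x\<in>X. (\<forall>(\<beta>, v)\<in>V. \<beta> - v \<bullet> x \<le> 1 / \<rho> x) \<and>
      (\<exists>(\<alpha>, w)\<in>F V x. \<exists>(\<alpha>', w')\<in>F V x. 1 / \<rho> x = \<alpha> - w \<bullet> x \<and> 1 / \<rho> x = \<alpha>' - w' \<bullet> x \<and>
         \<alpha> *\<^sub>R x - w \<noteq> \<alpha>' *\<^sub>R x - w')}" for V
  define N0 where "N0 = {x\<in>S2. a \<bullet> x = 0}"
  \<comment> \<open>The plane in the format \<alpha> - w . x, with \<alpha> = 0.\<close>
  define V where "V = {(0::real, - ((1 / b) *\<^sub>R a))}"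
  have N1: "N {} \<in> null_sets sphere_measure"
    unfolding N_def F_def by (rule null_distinct_conormals[OF X \<rho> D(1)]) auto
  have N2: "N V \<in> null_sets sphere_measure"
    unfolding N_def F_def by (rule null_distinct_conormals[OF X \<rho> D(1), where B="norm ((1 / b) *\<^sub>R a)"]) (auto simp: V_def)
  have N0: "N0 \<in> null_sets sphere_measure"
    unfolding N0_def using D(2) by (rule null_sphere_plane)
  have "?N \<subseteq> N {} \<union> N V \<union> N0"
  proof
    fix x assume "x \<in> ?N"
    then obtain P d P' d' where x: "x \<in> X" and P: "P \<in> D" "P' \<in> D" and s: "supports X \<rho> d P x" "supports X \<rho> d' P' x"
      and ne: "P \<noteq> P' \<or> d \<noteq> d'" by (auto simp: unique_support_def)
    have x1: "x \<in> S2" and nx: "norm x = 1" using x X by auto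
    have P0: "P \<noteq> 0" "P' \<noteq> 0" using P D by auto
    note q = supports_inverse_at[OF s(1) x1 P0(1)] and q' = supports_inverse_at[OF s(2) x1 P0(2)]
    have F1: "(1 / d, focal_vec d P) \<in> F V x" "(1 / d', focal_vec d' P') \<in> F V x" for V
      using P s unfolding F_def by blast+
    show "x \<in> N {} \<union> N V \<union> N0"
    proof (cases "conormal d P x = conormal d' P' x")
      case False
      then have "x \<in> N {}" using F1 x q q' unfolding N_def conormal_def by blast
      then show ?thesis by simp
    next
      case True
      define p where "p = conormal d P x"
      define v where "v = (norm p)\<^sup>2 *\<^sub>R x - (2 * (x \<bullet> p)) *\<^sub>R p"
      define g where "g d = 2 / d * (x \<bullet> p) - (norm p)\<^sup>2" for d
      have r: "P - (1 / (x \<bullet> p)) *\<^sub>R x = (1 / ((x \<bullet> p) * g d)) *\<^sub>R v" "0 < g d"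
        using focus_on_reflected_ray[OF q(1) P0(1) nx] by (auto simp: p_def v_def g_def)
      have r': "P' - (1 / (x \<bullet> p)) *\<^sub>R x = (1 / ((x \<bullet> p) * g d')) *\<^sub>R v" "0 < g d'"
        using focus_on_reflected_ray[OF q'(1) P0(2) nx] by (auto simp: p_def True v_def g_def)
      have xp: "x \<bullet> p = 1 / \<rho> x" "x \<bullet> p > 0" using q(2) \<rho>[OF x] by (auto simp: p_def)
      \<comment> \<open>The number \<open>g d\<close> locates the focus on the ray, so equal values
        would force both P = P' and d = d'.\<close>
      have gne: "g d \<noteq> g d'"
      proof
        assume eq: "g d = g d'"
        then have "P = P'" using r(1) r'(1) by (metis diff_add_cancel)
        moreover have "d = d'" using eq xp q(1) q'(1) by (simp add: g_def)
        ultimately show False using ne by simp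
      qed
      have "a \<bullet> (P - (1 / (x \<bullet> p)) *\<^sub>R x) = a \<bullet> (P' - (1 / (x \<bullet> p)) *\<^sub>R x)"
        using P D by (auto simp: inner_diff_right)
      then have "(1 / ((x \<bullet> p) * g d)) * (a \<bullet> v) = (1 / ((x \<bullet> p) * g d')) * (a \<bullet> v)"
        unfolding r r' by simp
      then have av: "a \<bullet> v = 0" using gne xp r(2) r'(2) by (auto simp: field_simps)
      have "a \<bullet> (P - (1 / (x \<bullet> p)) *\<^sub>R x) = 0" unfolding r using av by simp
      then have ax: "a \<bullet> x = b * (x \<bullet> p)" using P D xp by (auto simp: inner_diff_right field_simps)
      show ?thesis
      proof (cases "b = 0")
        case True
        then show ?thesis using ax x1 by (simp add: N0_def)
      next
        case False
        have "(0, - ((1 / b) *\<^sub>R a)) \<in> F V x" by (simp add: F_def V_def)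
        moreover have eq: "1 / \<rho> x = 0 - (- ((1 / b) *\<^sub>R a)) \<bullet> x"
          using ax xp False by simp
        moreover have "\<forall>(\<beta>, v)\<in>V. \<beta> - v \<bullet> x \<le> 1 / \<rho> x" using eq by (simp add: V_def)
        \<comment> \<open>A conormal a/b would be orthogonal to the reflected direction v, which is
          parallel to the plane; but p . v = -|p|^2 (x . p) is not zero.\<close>
        moreover have "(1 / d) *\<^sub>R x - focal_vec d P \<noteq> 0 *\<^sub>R x - (- ((1 / b) *\<^sub>R a))"
        proof
          assume "(1 / d) *\<^sub>R x - focal_vec d P = 0 *\<^sub>R x - (- ((1 / b) *\<^sub>R a))"
          then have pa: "p = (1 / b) *\<^sub>R a" by (simp add: p_def conormal_def)
          then have "p \<bullet> v = 0" using av by simp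
          then have "(norm p)\<^sup>2 * (x \<bullet> p) = 0"
            by (simp add: v_def inner_diff_right power2_norm_eq_inner inner_commute)
          then show False using xp by simp
        qed
        ultimately have "x \<in> N V" using F1(1)[of V] q(3) x unfolding N_def by blast
        then show ?thesis by simp
      qed
    qed
  qed
  then show ?thesis using N1 N2 N0 by (meson complete_sphere_measure null_sets.Un)
qed

section \<open>Stability of supporting ellipsoids\<close>

lemma borel_measurable_sphere_continuous_on:
  fixes g :: "real^3 \<Rightarrow> 'a::metric_space"
  assumes U: "U \<in> sets sphere_measure" and g: "continuous_on U g" and const: "\<And>x. x \<notin> U \<Longrightarrow> g x = a"
  shows "g \<in> borel_measurable sphere_measure"
proof (rule borel_measurableI)
  fix B :: "'a set" assume "open B"
  then obtain V where V: "open V" "V \<inter> U = g -` B \<inter> U"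
    using g unfolding continuous_on_open_invariant by blast
  have "V \<inter> S2 \<in> sets sphere_measure" using V by (intro sets_sphere_measureI) auto
  then have 1: "V \<inter> S2 \<inter> U \<in> sets sphere_measure" using U by auto
  have sU: "U \<subseteq> S2" using sets.sets_into_space[OF U] by simp
  have "g -` B \<inter> space sphere_measure = (if a \<in> B then (V \<inter> S2 \<inter> U) \<union> (space sphere_measure - U) else V \<inter> S2 \<inter> U)"
    using V sU const by auto
  also have "\<dots> \<in> sets sphere_measure" using 1 sets.compl_sets[OF U] by auto
  finally show "g -` B \<inter> space sphere_measure \<in> sets sphere_measure" .
qed

lemma supports_limit:
  assumes lim: "\<And>z. z \<in> X \<Longrightarrow> (\<lambda>n. \<rho> n z) \<longlonglongrightarrow> \<rho>0 z" and limx: "(\<lambda>n. \<rho> n (x n)) \<longlonglongrightarrow> \<rho>0 x0"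
    and x: "x \<longlonglongrightarrow> x0" "norm x0 = 1" and X: "X \<subseteq> S2"
    and P: "P \<longlonglongrightarrow> P0" "P0 \<noteq> 0" and d: "d \<longlonglongrightarrow> d0" "d0 > 0"
    and s: "\<And>n. supports X (\<rho> n) (d n) (P n) (x n)"
  shows "supports X \<rho>0 d0 P0 x0"
  unfolding supports_def
proof (intro conjI ballI)
  fix z assume z: "z \<in> X"
  have "(\<lambda>n. ellipsoid_radius (d n) (P n) z) \<longlonglongrightarrow> ellipsoid_radius d0 P0 z"
    using z X by (intro tendsto_ellipsoid_radius P d tendsto_const) auto
  then show "\<rho>0 z \<le> ellipsoid_radius d0 P0 z"
    using s z by (intro LIMSEQ_le[OF lim[OF z]]) (auto simp: supports_def)
next
  have "(\<lambda>n. ellipsoid_radius (d n) (P n) (x n)) \<longlonglongrightarrow> ellipsoid_radius d0 P0 x0"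
    by (intro tendsto_ellipsoid_radius P d x)
  moreover have "(\<lambda>n. ellipsoid_radius (d n) (P n) (x n)) = (\<lambda>n. \<rho> n (x n))"
    using s by (auto simp: supports_def)
  ultimately show "\<rho>0 x0 = ellipsoid_radius d0 P0 x0" using limx LIMSEQ_unique by metis
qed (use d in auto)

lemma compact_tendsto_unique_cluster:
  fixes q :: "nat \<Rightarrow> 'a::metric_space"
  assumes K: "compact K" and q: "\<And>n. q n \<in> K"
    and cl: "\<And>r l. strict_mono r \<Longrightarrow> l \<in> K \<Longrightarrow> (q \<circ> r) \<longlonglongrightarrow> l \<Longrightarrow> l = l0"
  shows "q \<longlonglongrightarrow> l0"
proof (rule ccontr)
  assume "\<not> q \<longlonglongrightarrow> l0"
  then obtain e where e: "e > 0" "\<exists>\<^sub>F n in sequentially. \<not> dist (q n) l0 < e"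
    by (auto simp: tendsto_iff frequently_def)
  then have inf: "infinite {n. \<not> dist (q n) l0 < e}"
    by (simp add: frequently_cofinite[symmetric] cofinite_eq_sequentially)
  define r where "r = enumerate {n. \<not> dist (q n) l0 < e}"
  have r: "strict_mono r" "\<And>n. \<not> dist (q (r n)) l0 < e"
    using inf enumerate_in_set[OF inf] by (auto simp: r_def strict_mono_enumerate)
  obtain l r' where l: "l \<in> K" "strict_mono r'" "((q \<circ> r) \<circ> r') \<longlonglongrightarrow> l"
    using seq_compactE[OF compact_imp_seq_compact[OF K], of "q \<circ> r"] q by auto
  have "l = l0" using cl[of "r \<circ> r'" l] l r by (simp add: strict_mono_o comp_assoc)
  then have "eventually (\<lambda>n. dist (q (r (r' n))) l0 < e) sequentially"
    using l(3) e(1) by (auto simp: tendsto_iff)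
  then show False using r(2) by (auto simp: eventually_sequentially)
qed

text \<open>This is (x . nu)/\<rho>^2, since x . p = 1/\<rho> and nu = p/|p|. Written through the
  supporting pair alone, it is continuous in that pair.\<close>

definition kernel :: "real^3 \<Rightarrow> (real^3) \<times> real \<Rightarrow> real" where
  "kernel x q = (x \<bullet> conormal (snd q) (fst q) x)^3 / norm (conormal (snd q) (fst q) x)"

section \<open>The class of admissible reflectors with the prescribed bounds\<close>

locale reflector_problem =
  fixes D \<Omega> X :: "(real^3) set" and f :: "real^3 \<Rightarrow> real" and \<eta> :: "(real^3) measure"
    and \<delta> k M c C :: real and P0 :: "real^3"
  assumes D: "compact D" "0 \<notin> D"
    and D_shape: "(\<exists>a b. a \<noteq> 0 \<and> D \<subseteq> {y. a \<bullet> y = b}) \<or> countable D"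
    and M: "M = max_dist D"
    and \<Omega>: "\<Omega> \<subseteq> S2" "emeasure sphere_measure (S2_frontier \<Omega>) = 0"
    and X: "X = S2_closure \<Omega>"
    and f: "set_integrable sphere_measure X f" "AE x in sphere_measure. x \<in> X \<longrightarrow> f x > 0"
    and \<eta>: "radon_measure_on D \<eta>"
    and \<delta>: "\<delta> > 0"
    and c: "c = c_of \<delta>"
    and k: "k \<ge> (1 + c) / (1 - c)"
    and C: "C = (1 - c)^3 / ((1 + c) * (k * \<delta> * M)\<^sup>2)"
    and energy: "(LINT x:X|sphere_measure. f x) \<ge> 1 / C * measure \<eta> D"
    and P0: "P0 \<in> measure_support D \<eta>"
begin

definition lo :: real where "lo = \<delta> * M / (1 + c)"
definition hi :: real where "hi = k * \<delta> * M / (1 - c)"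

definition adm :: "(real^3 \<Rightarrow> real) set" where
  "adm = {\<rho> \<in> admissible_reflectors X D \<delta>. \<forall>x\<in>X. lo \<le> \<rho> x \<and> \<rho> x \<le> hi}"

lemma P0_D: "P0 \<in> D" using P0 by (simp add: measure_support_def)

lemma D_nonzero: "P \<in> D \<Longrightarrow> P \<noteq> 0" using D by auto

lemma norm_le_M: assumes "P \<in> D" shows "norm P \<le> M"
proof -
  have "bounded (norm ` D)" using compact_imp_bounded[OF D(1)] by (simp add: bounded_norm_comp)
  then have "bdd_above (norm ` D)" by (rule bounded_imp_bdd_above)
  then show ?thesis unfolding M max_dist_def using assms by (intro cSUP_upper)
qed

lemma M_pos: "M > 0"
  using norm_le_M[OF P0_D] D_nonzero[OF P0_D] by (metis less_le_trans zero_less_norm_iff)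

lemma c_bounds: "0 < c" "c < 1" using c_of_bounds[OF \<delta>] c by auto

lemma k_ge_1: "k \<ge> 1"
proof -
  have "1 \<le> (1 + c) / (1 - c)" using c_bounds by simp
  then show ?thesis using k by simp
qed

lemma \<delta>M_pos: "\<delta> * M > 0" using \<delta> M_pos by simp

lemma lo_pos: "lo > 0" unfolding lo_def using \<delta>M_pos c_bounds by (intro divide_pos_pos) auto

lemma hi_pos: "hi > 0" unfolding hi_def using \<delta> M_pos c_bounds k_ge_1 by (intro divide_pos_pos mult_pos_pos) auto

lemma C_pos: "C > 0" unfolding C using \<delta> M_pos c_bounds k_ge_1 by (intro divide_pos_pos mult_pos_pos zero_less_power) auto

lemma ecc_le_c: "P \<in> D \<Longrightarrow> d \<ge> \<delta> * M \<Longrightarrow> ecc d P \<le> c"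
  unfolding c using ecc_le_c_of[OF \<delta>] norm_le_M D_nonzero by auto

lemma X_subset: "X \<subseteq> S2" unfolding X S2_closure_def using closure_of_subset_topspace[of "top_of_set S2"] by simp

lemma X_unit: "x \<in> X \<Longrightarrow> norm x = 1" using X_subset by auto

lemma X_closed: "closed X"
proof -
  have "closedin (top_of_set S2) X" unfolding X S2_closure_def by (rule closedin_closure_of)
  then show ?thesis by (rule closedin_closed_trans) simp
qed

lemma X_compact: "compact X"
  using X_closed X_subset bounded_subset[OF bounded_sphere] by (auto simp: compact_eq_bounded_closed)

lemma X_sets: "X \<in> sets sphere_measure"
proof -
  have "X \<inter> S2 \<in> sets sphere_measure" using X_closed by (intro sets_sphere_measureI) auto
  then show ?thesis using X_subset by (simp add: Int_absorb2)
qed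

lemma frontier_null: "S2_frontier \<Omega> \<in> null_sets sphere_measure"
proof -
  have "closedin (top_of_set S2) (S2_frontier \<Omega>)" unfolding S2_frontier_def by (rule closedin_frontier_of)
  then have cl: "closed (S2_frontier \<Omega>)" by (rule closedin_closed_trans) simp
  have "S2_frontier \<Omega> \<inter> S2 \<in> sets sphere_measure" using cl by (intro sets_sphere_measureI) auto
  moreover have "S2_frontier \<Omega> \<subseteq> S2"
    unfolding S2_frontier_def using frontier_of_subset_topspace[of "top_of_set S2"] by simp
  ultimately show ?thesis using \<Omega> by (simp add: null_sets_def Int_absorb2)
qed

text \<open>Off the null frontier, \<open>X\<close> contains a full spherical neighbourhood, so
  secants exist in every tangential direction. This determines the normal.\<close>

lemma interior_point:
  assumes "x \<in> X" "x \<notin> S2_frontier \<Omega>"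
  obtains e where "e > 0" "\<And>y. norm y = 1 \<Longrightarrow> dist y x < e \<Longrightarrow> y \<in> X"
proof -
  let ?I = "top_of_set S2 interior_of \<Omega>"
  have x: "x \<in> ?I" using assms unfolding X S2_closure_def S2_frontier_def frontier_of_def by auto
  have "openin (top_of_set S2) ?I" by (rule openin_interior_of)
  then obtain e where e: "e > 0" "\<And>y. y \<in> S2 \<Longrightarrow> dist y x < e \<Longrightarrow> y \<in> ?I"
    using x unfolding openin_euclidean_subtopology_iff by blast
  have "?I \<subseteq> X" unfolding X S2_closure_def
    using interior_of_subset_closure_of[of "top_of_set S2" \<Omega>] .
  then show ?thesis using e by (intro that[of e]) auto
qed

lemma adm_pos: "\<rho> \<in> adm \<Longrightarrow> x \<in> X \<Longrightarrow> \<rho> x > 0"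
  using lo_pos by (force simp: adm_def)

lemma adm_support:
  assumes "\<rho> \<in> adm" "x \<in> X"
  obtains P d where "P \<in> D" "d \<ge> \<delta> * M" "supports X \<rho> d P x"
  using assms unfolding adm_def admissible_reflectors_def M[symmetric] by blast

text \<open>The lower bound on \<rho> is automatic: d >= \<delta> M and eps <= c give d/(1 + eps) >=
  \<open>lo\<close>.\<close>

lemma admI:
  assumes ge: "\<And>x. x \<in> X \<Longrightarrow> \<exists>P\<in>D. \<exists>d\<ge>\<delta> * M. supports X \<rho> d P x"
    and le: "\<And>x. x \<in> X \<Longrightarrow> \<rho> x \<le> hi"
  shows "\<rho> \<in> adm"
proof -
  have lo: "lo \<le> \<rho> x" if x: "x \<in> X" for x
  proof -
    obtain P d where P: "P \<in> D" "d \<ge> \<delta> * M" "supports X \<rho> d P x" using ge[OF x] by auto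
    have d: "d > 0" using P \<delta>M_pos by simp
    have "lo \<le> d / (1 + ecc d P)" unfolding lo_def
      using P ecc_le_c[OF P(1,2)] ecc_pos[OF d D_nonzero[OF P(1)]] c_bounds d by (intro frac_le) auto
    also have "\<dots> \<le> \<rho> x"
      using ellipsoid_radius_bounds(1)[OF d D_nonzero[OF P(1)] X_unit[OF x]] P by (simp add: supports_def)
    finally show ?thesis .
  qed
  then show ?thesis unfolding adm_def admissible_reflectors_def reflector_def M[symmetric]
    using ge le lo_pos by (fastforce simp: less_le_trans)
qed

text \<open>Together with compactness of D, this confines supporting pairs with d >= \<delta> M to
  one compact set, the same for all admissible reflectors.\<close>

lemma support_d_le:
  assumes "\<rho> \<in> adm" "x \<in> X" "P \<in> D" "supports X \<rho> d P x"
  shows "d \<le> 2 * hi"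
proof -
  have "d > 0" using assms by (simp add: supports_def)
  then have "d / 2 \<le> \<rho> x"
    using ellipsoid_radius_bounds_simple[OF _ D_nonzero X_unit] assms by (simp add: supports_def)
  then show ?thesis using assms by (force simp: adm_def)
qed

text \<open>The affine functions that touch 1/\<rho> from below have gradients of length less than
  1/d <= 1/(\<delta> M). The constant is common to the whole class, which is the equicontinuity for
  Arzela-Ascoli.\<close>

lemma adm_lipschitz:
  assumes "\<rho> \<in> adm" "x \<in> X" "y \<in> X"
  shows "\<bar>1 / \<rho> x - 1 / \<rho> y\<bar> \<le> norm (x - y) / (\<delta> * M)"
proof -
  have *: "1 / \<rho> x - 1 / \<rho> y \<le> norm (x - y) / (\<delta> * M)" if x: "x \<in> X" and y: "y \<in> X" for x y
  proof -
    obtain P d where P: "P \<in> D" "d \<ge> \<delta> * M" "supports X \<rho> d P x" using adm_support[OF assms(1) x] .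
    have d: "d > 0" using P \<delta>M_pos by simp
    have "1 / \<rho> x = 1 / d - focal_vec d P \<bullet> x" "1 / \<rho> y \<ge> 1 / d - focal_vec d P \<bullet> y"
      using supports_iff_inverse[where \<rho>=\<rho>, OF X_subset adm_pos[OF assms(1)] D_nonzero[OF P(1)] x, of d] P y by auto
    then have "1 / \<rho> x - 1 / \<rho> y \<le> focal_vec d P \<bullet> (y - x)" by (simp add: inner_diff_right)
    also have "\<dots> \<le> norm (focal_vec d P) * norm (y - x)" by (rule norm_cauchy_schwarz)
    also have "\<dots> \<le> (1 / (\<delta> * M)) * norm (y - x)"
    proof (intro mult_right_mono)
      have "1 / d \<le> 1 / (\<delta> * M)" using P \<delta>M_pos by (intro divide_left_mono) auto
      then show "norm (focal_vec d P) \<le> 1 / (\<delta> * M)"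
        using norm_focal_vec_less[OF d D_nonzero[OF P(1)]] by simp
    qed simp
    finally show ?thesis by (simp add: norm_minus_commute)
  qed
  show ?thesis using *[OF assms(2,3)] *[OF assms(3,2)] by (simp add: abs_le_iff norm_minus_commute)
qed

text \<open>The common Lipschitz constant upgrades pointwise convergence to convergence along moving
  points.\<close>

lemma adm_joint_tendsto:
  assumes \<rho>: "\<And>n. \<rho> n \<in> adm" and lim: "\<And>z. z \<in> X \<Longrightarrow> (\<lambda>n. \<rho> n z) \<longlonglongrightarrow> \<rho>0 z"
    and x: "\<And>n. x n \<in> X" "x \<longlonglongrightarrow> x0" "x0 \<in> X"
  shows "(\<lambda>n. \<rho> n (x n)) \<longlonglongrightarrow> \<rho>0 x0"
proof -
  have lo0: "lo \<le> \<rho>0 x0" using \<rho> x(3) by (intro LIMSEQ_le_const[OF lim[OF x(3)]]) (auto simp: adm_def)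
  have "(\<lambda>n. norm (x n - x0) / (\<delta> * M)) \<longlonglongrightarrow> norm (x0 - x0) / (\<delta> * M)"
    using x \<delta>M_pos by (intro tendsto_intros) auto
  then have "(\<lambda>n. norm (x n - x0) / (\<delta> * M)) \<longlonglongrightarrow> 0" by simp
  then have "(\<lambda>n. 1 / \<rho> n (x n) - 1 / \<rho> n x0) \<longlonglongrightarrow> 0"
    by (rule Lim_null_comparison[rotated]) (use adm_lipschitz[OF \<rho> x(1) x(3)] in auto)
  moreover have "(\<lambda>n. 1 / \<rho> n x0) \<longlonglongrightarrow> 1 / \<rho>0 x0"
    using lim[OF x(3)] lo0 lo_pos by (intro tendsto_intros) auto
  ultimately have "(\<lambda>n. (1 / \<rho> n (x n) - 1 / \<rho> n x0) + 1 / \<rho> n x0) \<longlonglongrightarrow> 0 + 1 / \<rho>0 x0"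
    by (rule tendsto_add)
  then have "(\<lambda>n. inverse (1 / \<rho> n (x n))) \<longlonglongrightarrow> inverse (1 / \<rho>0 x0)"
    using lo0 lo_pos by (intro tendsto_inverse) auto
  then show ?thesis by simp
qed

lemma supports_subsequence:
  assumes \<rho>: "\<And>n. \<rho> n \<in> adm" and lim: "\<And>z. z \<in> X \<Longrightarrow> (\<lambda>n. \<rho> n z) \<longlonglongrightarrow> \<rho>0 z"
    and x: "\<And>n. x n \<in> X" "x \<longlonglongrightarrow> x0" "x0 \<in> X" and r: "strict_mono r"
    and P: "\<And>n. P n \<in> D" and d: "\<And>n. d n \<ge> \<delta> * M" and s: "\<And>n. supports X (\<rho> n) (d n) (P n) (x n)"
    and l: "(\<lambda>n. (P (r n), d (r n))) \<longlonglongrightarrow> (Q, e)" "Q \<in> D" "e \<ge> \<delta> * M"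
  shows "supports X \<rho>0 e Q x0"
proof (rule supports_limit[where \<rho>="\<lambda>n. \<rho> (r n)" and x="\<lambda>n. x (r n)" and P="\<lambda>n. P (r n)" and d="\<lambda>n. d (r n)"])
  have sub: "(\<lambda>n. g (r n)) \<longlonglongrightarrow> a" if "g \<longlonglongrightarrow> a" for g :: "nat \<Rightarrow> 'b::topological_space" and a
    using LIMSEQ_subseq_LIMSEQ[OF that r] by (simp add: comp_def)
  show "(\<lambda>n. \<rho> (r n) z) \<longlonglongrightarrow> \<rho>0 z" if "z \<in> X" for z using sub[OF lim[OF that]] .
  show "(\<lambda>n. \<rho> (r n) (x (r n))) \<longlonglongrightarrow> \<rho>0 x0" using sub[OF adm_joint_tendsto[OF \<rho> lim x]] .
  show "(\<lambda>n. x (r n)) \<longlonglongrightarrow> x0" using sub[OF x(2)] .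
  show "norm x0 = 1" using X_unit[OF x(3)] .
  show "(\<lambda>n. P (r n)) \<longlonglongrightarrow> Q" using tendsto_fst[OF l(1)] by simp
  show "(\<lambda>n. d (r n)) \<longlonglongrightarrow> e" using tendsto_snd[OF l(1)] by simp
qed (use X_subset D_nonzero l \<delta>M_pos s in auto)

text \<open>The pairs stay in a compact set, and every cluster point is a supporting pair of the
  limit at x0. Only the limit has to be uniquely supported; the pairs along the sequence may be
  arbitrary choices.\<close>

lemma supports_tendsto:
  assumes \<rho>: "\<And>n. \<rho> n \<in> adm" and lim: "\<And>z. z \<in> X \<Longrightarrow> (\<lambda>n. \<rho> n z) \<longlonglongrightarrow> \<rho>0 z"
    and x: "\<And>n. x n \<in> X" "x \<longlonglongrightarrow> x0" "x0 \<in> X"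
    and P: "\<And>n. P n \<in> D" and d: "\<And>n. d n \<ge> \<delta> * M" and s: "\<And>n. supports X (\<rho> n) (d n) (P n) (x n)"
    and u: "unique_support X D \<rho>0 x0" "Q \<in> D" "supports X \<rho>0 e Q x0"
  shows "(\<lambda>n. (P n, d n)) \<longlonglongrightarrow> (Q, e)"
proof (rule compact_tendsto_unique_cluster)
  show "compact (D \<times> {\<delta> * M..2 * hi})" using D by (intro compact_Times) auto
  show "(P n, d n) \<in> D \<times> {\<delta> * M..2 * hi}" for n
    using P d support_d_le[OF \<rho> x(1) P s] by auto
  fix r l assume r: "strict_mono r" and l: "l \<in> D \<times> {\<delta> * M..2 * hi}" "((\<lambda>n. (P n, d n)) \<circ> r) \<longlonglongrightarrow> l"
  have "supports X \<rho>0 (snd l) (fst l) x0"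
    using l by (intro supports_subsequence[OF \<rho> lim x r P d s]) (auto simp: comp_def)
  then show "l = (Q, e)" using u l unfolding unique_support_def by (metis mem_Times_iff prod.collapse)
qed

lemma adm_closed:
  assumes \<rho>: "\<And>n. \<rho> n \<in> adm" and lim: "\<And>z. z \<in> X \<Longrightarrow> (\<lambda>n. \<rho> n z) \<longlonglongrightarrow> \<rho>0 z"
  shows "\<rho>0 \<in> adm"
proof (rule admI)
  fix x assume x: "x \<in> X"
  show "\<rho>0 x \<le> hi" using \<rho> x by (intro LIMSEQ_le_const2[OF lim[OF x]]) (auto simp: adm_def)
  have "\<exists>P d. P \<in> D \<and> d \<ge> \<delta> * M \<and> supports X (\<rho> n) d P x" for n
    using adm_support[OF \<rho> x] by metis
  then obtain P d where Pd: "\<And>n. P n \<in> D" "\<And>n. d n \<ge> \<delta> * M" "\<And>n. supports X (\<rho> n) (d n) (P n) x"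
    by metis
  have K: "compact (D \<times> {\<delta> * M..2 * hi})" using D by (intro compact_Times) auto
  have "\<forall>n. (P n, d n) \<in> D \<times> {\<delta> * M..2 * hi}"
    using Pd support_d_le[OF \<rho> x Pd(1) Pd(3)] by auto
  from seq_compactE[OF compact_imp_seq_compact[OF K] this]
  obtain l r where l: "l \<in> D \<times> {\<delta> * M..2 * hi}" "strict_mono r" "((\<lambda>n. (P n, d n)) \<circ> r) \<longlonglongrightarrow> l" .
  have "supports X \<rho>0 (snd l) (fst l) x"
    using l x by (intro supports_subsequence[OF \<rho> lim _ _ x l(2) Pd]) (auto simp: comp_def)
  then show "\<exists>P\<in>D. \<exists>d\<ge>\<delta> * M. supports X \<rho>0 d P x" using l by (auto simp: mem_Times_iff)
qed

section \<open>Uniquely supported directions and their supporting pairs\<close>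

definition regular :: "(real^3 \<Rightarrow> real) \<Rightarrow> (real^3) set" where
  "regular \<rho> = {x\<in>X. unique_support X D \<rho> x}"

text \<open>The default value is constant, which keeps the map measurable, and lies in D with
  parameter \<delta> M, so that range statements hold at every x.\<close>

definition sel :: "(real^3 \<Rightarrow> real) \<Rightarrow> real^3 \<Rightarrow> (real^3) \<times> real" where
  "sel \<rho> x = (if x \<in> regular \<rho>
     then SOME q. fst q \<in> D \<and> snd q \<ge> \<delta> * M \<and> supports X \<rho> (snd q) (fst q) x
     else (P0, \<delta> * M))"

lemma sel_supports:
  assumes "\<rho> \<in> adm" "x \<in> regular \<rho>"
  shows "fst (sel \<rho> x) \<in> D \<and> snd (sel \<rho> x) \<ge> \<delta> * M \<and> supports X \<rho> (snd (sel \<rho> x)) (fst (sel \<rho> x)) x"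
proof -
  have "x \<in> X" using assms by (simp add: regular_def)
  then obtain P d where "P \<in> D" "d \<ge> \<delta> * M" "supports X \<rho> d P x" using adm_support[OF assms(1)] by metis
  then have "\<exists>q. fst q \<in> D \<and> snd q \<ge> \<delta> * M \<and> supports X \<rho> (snd q) (fst q) x" by auto
  from someI_ex[OF this] show ?thesis using assms(2) by (simp only: sel_def if_True)
qed

lemma sel_range: "\<rho> \<in> adm \<Longrightarrow> fst (sel \<rho> x) \<in> D \<and> snd (sel \<rho> x) \<ge> \<delta> * M"
  using sel_supports[of \<rho> x] P0_D by (cases "x \<in> regular \<rho>") (auto simp: sel_def)

lemma sel_eq:
  assumes "\<rho> \<in> adm" "x \<in> regular \<rho>" "P \<in> D" "supports X \<rho> d P x"
  shows "sel \<rho> x = (P, d)"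
proof -
  have "unique_support X D \<rho> x" using assms(2) by (simp add: regular_def)
  then have "fst (sel \<rho> x) = P \<and> snd (sel \<rho> x) = d"
    using sel_supports[OF assms(1,2)] assms(3,4) unfolding unique_support_def by blast
  then show ?thesis by (simp add: prod_eq_iff)
qed

lemma sel_tendsto:
  assumes \<rho>: "\<And>n. \<rho> n \<in> adm" and lim: "\<And>z. z \<in> X \<Longrightarrow> (\<lambda>n. \<rho> n z) \<longlonglongrightarrow> \<rho>0 z"
    and x: "\<And>n. x n \<in> regular (\<rho> n)" "x \<longlonglongrightarrow> x0" "x0 \<in> regular \<rho>0"
  shows "(\<lambda>n. sel (\<rho> n) (x n)) \<longlonglongrightarrow> sel \<rho>0 x0"
proof -
  have xX: "\<And>n. x n \<in> X" "x0 \<in> X" "unique_support X D \<rho>0 x0" using x by (auto simp: regular_def)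
  have "(\<lambda>n. (fst (sel (\<rho> n) (x n)), snd (sel (\<rho> n) (x n)))) \<longlonglongrightarrow> (fst (sel \<rho>0 x0), snd (sel \<rho>0 x0))"
    using sel_supports[OF \<rho> x(1)] sel_supports[OF adm_closed[OF \<rho> lim] x(3)]
    by (intro supports_tendsto[OF \<rho> lim xX(1) x(2) xX(2) _ _ _ xX(3)]) auto
  then show ?thesis by simp
qed

lemma sel_continuous: "\<rho> \<in> adm \<Longrightarrow> continuous_on (regular \<rho>) (sel \<rho>)"
  unfolding continuous_on_sequentially by (auto simp: comp_def intro!: sel_tendsto)

text \<open>The place where the shape of D enters.\<close>

lemma nonregular_null:
  assumes "\<rho> \<in> adm" shows "X - regular \<rho> \<in> null_sets sphere_measure"
proof -
  have "X - regular \<rho> = {x\<in>X. \<not> unique_support X D \<rho> x}" by (auto simp: regular_def)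
  then show ?thesis
    using D_shape null_nonunique_countable[where \<rho>=\<rho>, OF X_subset adm_pos[OF assms] D(2)]
      null_nonunique_planar[where \<rho>=\<rho>, OF X_subset adm_pos[OF assms] D(2)] by auto
qed

lemma regular_subset: "regular \<rho> \<subseteq> X" by (auto simp: regular_def)

lemma regular_sets: "\<rho> \<in> adm \<Longrightarrow> regular \<rho> \<in> sets sphere_measure"
proof -
  assume "\<rho> \<in> adm"
  from nonregular_null[OF this] have "X - regular \<rho> \<in> sets sphere_measure" by (rule null_setsD2)
  then have "X - (X - regular \<rho>) \<in> sets sphere_measure"
    using X_sets by (rule sets.Diff[rotated])
  then show ?thesis using regular_subset[of \<rho>] by (simp add: double_diff)
qed

lemma AE_regular: "\<rho> \<in> adm \<Longrightarrow> AE x in sphere_measure. x \<in> X \<longrightarrow> x \<in> regular \<rho>"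
  by (rule AE_I'[OF nonregular_null]) auto

lemma sel_measurable: "\<rho> \<in> adm \<Longrightarrow> sel \<rho> \<in> borel_measurable sphere_measure"
  by (rule borel_measurable_sphere_continuous_on[OF regular_sets sel_continuous]) (auto simp: sel_def)

end

section \<open>Normals and weak convergence of reflector measures\<close>

lemma tendsto_kernel:
  assumes "(x \<longlongrightarrow> x0) F" "(q \<longlongrightarrow> q0) F" "norm x0 = 1" "snd q0 > 0" "fst q0 \<noteq> 0"
  shows "((\<lambda>n. kernel (x n) (q n)) \<longlongrightarrow> kernel x0 q0) F"
proof -
  have "conormal (snd q0) (fst q0) x0 \<noteq> 0"
    using inner_conormal_pos[OF assms(4,5,3)] by auto
  then show ?thesis
    unfolding kernel_def using assms by (intro tendsto_intros tendsto_conormal) auto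
qed

text \<open>Scaled to have inner product 1 with x, the two candidates differ by a vector z
  orthogonal to x. Unit vectors in the plane of x and z that become orthogonal to both candidates
  also become orthogonal to z, so their z-component tends to 0, and then so does their x-component,
  which contradicts length 1. Hence z = 0. The unit vectors will be normalized secants.\<close>

lemma inner_ratio_tendsto_unique:
  fixes n n' x :: "'a::real_inner"
  assumes n: "norm n = 1" "norm n' = 1" "0 < x \<bullet> n" "0 < x \<bullet> n'" and x: "norm x = 1"
    and normal: "\<And>z. z \<noteq> 0 \<Longrightarrow> x \<bullet> z = 0 \<Longrightarrow> \<exists>\<alpha> \<beta>. (\<forall>i::nat. norm (\<alpha> i *\<^sub>R x + \<beta> i *\<^sub>R z) = 1) \<and>
      (\<lambda>i. (\<alpha> i *\<^sub>R x + \<beta> i *\<^sub>R z) \<bullet> n) \<longlonglongrightarrow> 0 \<and> (\<lambda>i. (\<alpha> i *\<^sub>R x + \<beta> i *\<^sub>R z) \<bullet> n') \<longlonglongrightarrow> 0"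
  shows "n = n'"
proof -
  define z where "z = (1 / (x \<bullet> n)) *\<^sub>R n - (1 / (x \<bullet> n')) *\<^sub>R n'"
  have xz: "x \<bullet> z = 0" using n by (simp add: z_def inner_diff_right)
  have "z = 0"
  proof (rule ccontr)
    assume z: "z \<noteq> 0"
    obtain \<alpha> \<beta> where ab: "(\<forall>i::nat. norm (\<alpha> i *\<^sub>R x + \<beta> i *\<^sub>R z) = 1) \<and>
      (\<lambda>i. (\<alpha> i *\<^sub>R x + \<beta> i *\<^sub>R z) \<bullet> n) \<longlonglongrightarrow> 0 \<and> (\<lambda>i. (\<alpha> i *\<^sub>R x + \<beta> i *\<^sub>R z) \<bullet> n') \<longlonglongrightarrow> 0"
      using normal[OF z xz] by (elim exE) (rule that)
    then have 1: "\<And>i. norm (\<alpha> i *\<^sub>R x + \<beta> i *\<^sub>R z) = 1"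
      and 2: "(\<lambda>i. (\<alpha> i *\<^sub>R x + \<beta> i *\<^sub>R z) \<bullet> n) \<longlonglongrightarrow> 0" "(\<lambda>i. (\<alpha> i *\<^sub>R x + \<beta> i *\<^sub>R z) \<bullet> n') \<longlonglongrightarrow> 0"
      by blast+
    have "(\<lambda>i. (1 / (x \<bullet> n)) * ((\<alpha> i *\<^sub>R x + \<beta> i *\<^sub>R z) \<bullet> n) - (1 / (x \<bullet> n')) * ((\<alpha> i *\<^sub>R x + \<beta> i *\<^sub>R z) \<bullet> n'))
       \<longlonglongrightarrow> (1 / (x \<bullet> n)) * 0 - (1 / (x \<bullet> n')) * 0"
      using 2 by (intro tendsto_intros)
    moreover have "(1 / (x \<bullet> n)) * (v \<bullet> n) - (1 / (x \<bullet> n')) * (v \<bullet> n') = v \<bullet> z" for v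
      by (simp add: z_def inner_diff_right)
    moreover have "(\<alpha> i *\<^sub>R x + \<beta> i *\<^sub>R z) \<bullet> z = \<beta> i * (z \<bullet> z)" for i
      using xz by (simp add: inner_add_left)
    ultimately have "(\<lambda>i. \<beta> i * (z \<bullet> z)) \<longlonglongrightarrow> 0" by simp
    then have "(\<lambda>i. \<beta> i * (z \<bullet> z) * (1 / (z \<bullet> z))) \<longlonglongrightarrow> 0 * (1 / (z \<bullet> z))" by (intro tendsto_intros)
    then have \<beta>: "\<beta> \<longlonglongrightarrow> 0" using z by simp
    have "(\<lambda>i. ((\<alpha> i *\<^sub>R x + \<beta> i *\<^sub>R z) \<bullet> n - \<beta> i * (z \<bullet> n)) * (1 / (x \<bullet> n))) \<longlonglongrightarrow> (0 - 0 * (z \<bullet> n)) * (1 / (x \<bullet> n))"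
      using 2 \<beta> by (intro tendsto_intros)
    moreover have "((\<alpha> i *\<^sub>R x + \<beta> i *\<^sub>R z) \<bullet> n - \<beta> i * (z \<bullet> n)) * (1 / (x \<bullet> n)) = \<alpha> i" for i
      using n by (simp add: inner_add_left)
    ultimately have \<alpha>: "\<alpha> \<longlonglongrightarrow> 0" by simp
    have "(\<lambda>i. norm (\<alpha> i *\<^sub>R x + \<beta> i *\<^sub>R z)) \<longlonglongrightarrow> norm (0 *\<^sub>R x + 0 *\<^sub>R z)"
      using \<alpha> \<beta> by (intro tendsto_intros)
    then show False using 1 by (simp add: LIMSEQ_const_iff)
  qed
  then have eq: "(1 / (x \<bullet> n)) *\<^sub>R n = (1 / (x \<bullet> n')) *\<^sub>R n'" by (simp add: z_def)
  from arg_cong[OF this, of norm] have "x \<bullet> n = x \<bullet> n'" using n by simp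
  then show ?thesis using eq n by simp
qed

context reflector_problem
begin

lemma sel_inner:
  assumes "\<rho> \<in> adm" "x \<in> regular \<rho>"
  shows "x \<bullet> conormal (snd (sel \<rho> x)) (fst (sel \<rho> x)) x = 1 / \<rho> x"
  using sel_supports[OF assms] supports_inverse_at(2)[of X \<rho> _ _ x] D_nonzero X_subset regular_subset assms by blast

text \<open>Origin of \<open>C\<close>: it equals (1 - c)/(1 + c) times 1/\<open>hi\<close>^2, and
  the two factors bound the cosine x . nu, strictly, and 1/\<rho>^2 from below. The upper bound
  provides a common integrable majorant.\<close>

lemma kernel_sel_bounds:
  assumes "\<rho> \<in> adm" "x \<in> regular \<rho>"
  shows "C < kernel x (sel \<rho> x)" "kernel x (sel \<rho> x) \<le> 1 / lo\<^sup>2" "0 \<le> kernel x (sel \<rho> x)"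
proof -
  define P where "P = fst (sel \<rho> x)"
  define d where "d = snd (sel \<rho> x)"
  define p where "p = conormal d P x"
  have P: "P \<in> D" "d \<ge> \<delta> * M" using sel_supports[OF assms] by (auto simp: P_def d_def)
  then have d: "d > 0" and P0: "P \<noteq> 0" using \<delta>M_pos D_nonzero by auto
  have x: "x \<in> X" "norm x = 1" using assms regular_subset X_unit by auto
  have xp: "x \<bullet> p = 1 / \<rho> x" using sel_inner[OF assms] by (simp add: p_def P_def d_def)
  have \<rho>: "lo \<le> \<rho> x" "\<rho> x \<le> hi" "\<rho> x > 0" using assms x adm_pos by (auto simp: adm_def)
  have np: "norm p > 0" using xp \<rho> by auto
  have ap: "(1 - c) * norm p < (1 + c) * (x \<bullet> p)"
    unfolding p_def using conormal_aperture[OF d P0 x(2) ecc_le_c[OF P] c_bounds] .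
  have kern: "kernel x (sel \<rho> x) = ((x \<bullet> p) / norm p) * (1 / \<rho> x)\<^sup>2"
    by (simp add: kernel_def xp[symmetric] p_def P_def d_def power2_eq_square power3_eq_cube)
  show "0 \<le> kernel x (sel \<rho> x)" unfolding kern xp using \<rho> by simp
  have "x \<bullet> p \<le> norm p" using norm_cauchy_schwarz[of x p] x by simp
  then have le1: "(x \<bullet> p) / norm p \<le> 1" using np by simp
  have "(1 / \<rho> x)\<^sup>2 \<le> (1 / lo)\<^sup>2" using \<rho> lo_pos by (intro power_mono frac_le) auto
  then have "((x \<bullet> p) / norm p) * (1 / \<rho> x)\<^sup>2 \<le> 1 * (1 / lo)\<^sup>2"
    using le1 by (intro mult_mono) auto
  then show "kernel x (sel \<rho> x) \<le> 1 / lo\<^sup>2" unfolding kern by (simp add: power_divide)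
  have hi2: "(1 / hi)\<^sup>2 \<le> (1 / \<rho> x)\<^sup>2" using \<rho> hi_pos by (intro power_mono frac_le) auto
  have "C = (1 - c) / (1 + c) * (1 / hi)\<^sup>2"
    using c_bounds unfolding C hi_def by (simp add: power_divide power2_eq_square power3_eq_cube)
  also have "\<dots> \<le> (1 - c) / (1 + c) * (1 / \<rho> x)\<^sup>2"
    using hi2 c_bounds by (intro mult_left_mono) auto
  also have "\<dots> < ((x \<bullet> p) / norm p) * (1 / \<rho> x)\<^sup>2"
    using ap np c_bounds \<rho> by (intro mult_strict_right_mono) (auto simp: field_simps)
  finally show "C < kernel x (sel \<rho> x)" unfolding kern .
qed

text \<open>The surface lies on the inner side of its supporting tangent plane: the surface point at
  x has inner product 1 with the conormal, and x . y <= 1 shows that the other surface points have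
  at most 1.\<close>

lemma conormal_inequality:
  assumes "\<rho> \<in> adm" "x \<in> X" "y \<in> X" "P \<in> D" "supports X \<rho> d P x"
  shows "(\<rho> y *\<^sub>R y - \<rho> x *\<^sub>R x) \<bullet> conormal d P x \<le> 0"
proof -
  have P0: "P \<noteq> 0" using assms D_nonzero by auto
  have d: "d > 0" and nx: "norm x = 1" "norm y = 1" using assms X_unit by (auto simp: supports_def)
  have \<rho>: "\<rho> x > 0" "\<rho> y > 0" using adm_pos assms by auto
  have "x \<bullet> conormal d P x = 1 / \<rho> x"
    using supports_inverse_at(2)[OF assms(5) _ P0] nx by simp
  then have 1: "(\<rho> x *\<^sub>R x) \<bullet> conormal d P x = 1" using \<rho> by simp
  have "y \<bullet> conormal d P x \<le> 1 / d - focal_vec d P \<bullet> y"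
    using inner_unit_bounds(2)[OF nx] d
    by (simp add: conormal_def inner_diff_right inner_commute divide_right_mono)
  also have "\<dots> \<le> 1 / \<rho> y"
    using supports_iff_inverse[where \<rho>=\<rho>, OF X_subset adm_pos[OF assms(1)] P0 assms(2), of d] assms by auto
  finally have "(\<rho> y *\<^sub>R y) \<bullet> conormal d P x \<le> 1"
    using \<rho> by (simp add: field_simps)
  then show ?thesis using 1 by (simp add: inner_diff_left)
qed

text \<open>
  With supporting conormals \<open>p\<close> at the base point and \<open>p'\<close> at another surface point, the secant \<open>v\<close>
  satisfies \<open>v \<bullet> p \<le> 0 \<le> v \<bullet> p'\<close>, and \<open>p'\<close> tends to \<open>p\<close>.
\<close>

lemma is_outer_unit_normal_conormal:
  assumes \<rho>: "\<rho> \<in> adm" and x: "x \<in> regular \<rho>"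
  defines "p \<equiv> conormal (snd (sel \<rho> x)) (fst (sel \<rho> x)) x"
  shows "is_outer_unit_normal X \<rho> x (p /\<^sub>R norm p)"
proof -
  have xX: "x \<in> X" "norm x = 1" using x regular_subset X_unit by auto
  have u: "unique_support X D \<rho> x" using x by (simp add: regular_def)
  note S = sel_supports[OF \<rho> x]
  have P0: "fst (sel \<rho> x) \<noteq> 0" and d0: "snd (sel \<rho> x) > 0" using S D_nonzero \<delta>M_pos by auto
  have xp: "x \<bullet> p = 1 / \<rho> x" unfolding p_def by (rule sel_inner[OF \<rho> x])
  have \<rho>x: "\<rho> x > 0" using adm_pos[OF \<rho> xX(1)] .
  have np: "norm p > 0" using xp \<rho>x by auto
  let ?g = "\<lambda>q. ((q - \<rho> x *\<^sub>R x) \<bullet> (p /\<^sub>R norm p)) / norm (q - \<rho> x *\<^sub>R x)"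
  have "(?g \<longlongrightarrow> 0) (at (\<rho> x *\<^sub>R x) within radial_surface X \<rho>)"
    unfolding tendsto_at_iff_sequentially
  proof (intro allI impI)
    fix Y assume Y: "\<forall>i. Y i \<in> radial_surface X \<rho> - {\<rho> x *\<^sub>R x}" and Yl: "Y \<longlonglongrightarrow> \<rho> x *\<^sub>R x"
    obtain y where y: "\<And>i. y i \<in> X" "\<And>i. Y i = \<rho> (y i) *\<^sub>R y i"
      using Y unfolding radial_surface_def by (auto simp: image_iff) metis
    have "(\<lambda>i. Y i /\<^sub>R norm (Y i)) \<longlonglongrightarrow> (\<rho> x *\<^sub>R x) /\<^sub>R norm (\<rho> x *\<^sub>R x)"
      using Yl \<rho>x xX by (intro tendsto_intros) auto
    moreover have "Y i /\<^sub>R norm (Y i) = y i" for i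
      using y(2)[of i] adm_pos[OF \<rho> y(1)[of i]] X_unit[OF y(1)[of i]] by simp
    ultimately have yl: "y \<longlonglongrightarrow> x" using \<rho>x xX by simp
    \<comment> \<open>The neighbouring points need not be uniquely supported. Any choice of pairs
      there converges, by uniqueness at x.\<close>
    have "\<exists>P d. P \<in> D \<and> d \<ge> \<delta> * M \<and> supports X \<rho> d P (y i)" for i
      using adm_support[OF \<rho> y(1)] by metis
    then obtain P d where Pd: "\<And>i. P i \<in> D" "\<And>i. d i \<ge> \<delta> * M" "\<And>i. supports X \<rho> (d i) (P i) (y i)"
      by metis
    have Pdl: "(\<lambda>i. (P i, d i)) \<longlonglongrightarrow> (fst (sel \<rho> x), snd (sel \<rho> x))"
      using S by (intro supports_tendsto[OF \<rho> tendsto_const y(1) yl xX(1) Pd u]) auto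
    have "(\<lambda>i. conormal (d i) (P i) (y i)) \<longlonglongrightarrow> p"
      unfolding p_def using tendsto_fst[OF Pdl] tendsto_snd[OF Pdl] yl P0 d0
      by (intro tendsto_conormal) auto
    then have "(\<lambda>i. norm (p - conormal (d i) (P i) (y i)) / norm p) \<longlonglongrightarrow> norm (p - p) / norm p"
      using np by (intro tendsto_intros) auto
    then have lim: "(\<lambda>i. norm (p - conormal (d i) (P i) (y i)) / norm p) \<longlonglongrightarrow> 0" by simp
    have "norm (?g (Y i)) \<le> norm (p - conormal (d i) (P i) (y i)) / norm p" for i
    proof -
      define v where "v = Y i - \<rho> x *\<^sub>R x"
      have v: "norm v > 0" using Y by (auto simp: v_def)
      have 1: "v \<bullet> p \<le> 0"
        unfolding v_def y(2) p_def using S by (intro conormal_inequality[OF \<rho> xX(1) y(1)]) auto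
      have "(\<rho> x *\<^sub>R x - Y i) \<bullet> conormal (d i) (P i) (y i) \<le> 0"
        unfolding y(2) using Pd by (intro conormal_inequality[OF \<rho> y(1) xX(1)]) auto
      then have 2: "0 \<le> v \<bullet> conormal (d i) (P i) (y i)" by (simp add: v_def inner_diff_left)
      have "\<bar>v \<bullet> p\<bar> \<le> v \<bullet> (conormal (d i) (P i) (y i) - p)" using 1 2 by (simp add: inner_diff_right)
      also have "\<dots> \<le> norm v * norm (conormal (d i) (P i) (y i) - p)" by (rule norm_cauchy_schwarz)
      finally have "\<bar>v \<bullet> p\<bar> \<le> norm v * norm (p - conormal (d i) (P i) (y i))" by (simp add: norm_minus_commute)
      then have "\<bar>v \<bullet> p\<bar> / norm v \<le> norm (p - conormal (d i) (P i) (y i))" using v by (simp add: field_simps)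
      moreover have "norm (?g (Y i)) = (\<bar>v \<bullet> p\<bar> / norm v) / norm p"
        using np v by (simp add: v_def[symmetric] abs_mult divide_inverse mult_ac)
      ultimately show ?thesis using np by (metis divide_right_mono less_imp_le)
    qed
    then have "(\<lambda>i. ?g (Y i)) \<longlonglongrightarrow> 0"
      by (intro Lim_null_comparison[OF _ lim]) auto
    then show "(?g \<circ> Y) \<longlonglongrightarrow> 0" by (simp add: comp_def)
  qed
  moreover have "x \<bullet> (p /\<^sub>R norm p) > 0" using xp \<rho>x np by simp
  moreover have "norm (p /\<^sub>R norm p) = 1" using np by simp
  ultimately show ?thesis unfolding is_outer_unit_normal_def by blast
qed

text \<open>For a tangential z the normalized points x + z/(i+1) stay in \<open>X\<close>
  eventually, and the secants to the corresponding surface points lie in the plane of x and z. These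
  are the test directions for \<open>inner_ratio_tendsto_unique\<close>.\<close>

lemma outer_unit_normal_unique:
  assumes \<rho>: "\<rho> \<in> adm" and x: "x \<in> X" "x \<notin> S2_frontier \<Omega>"
    and n: "is_outer_unit_normal X \<rho> x n" "is_outer_unit_normal X \<rho> x n'"
  shows "n = n'"
proof (rule inner_ratio_tendsto_unique)
  show "norm n = 1" "norm n' = 1" "0 < x \<bullet> n" "0 < x \<bullet> n'" using n by (auto simp: is_outer_unit_normal_def)
  show nx: "norm x = 1" using X_unit x by auto
  fix z assume z: "z \<noteq> 0" "x \<bullet> z = 0"
  obtain e where e: "e > 0" "\<And>y. norm y = 1 \<Longrightarrow> dist y x < e \<Longrightarrow> y \<in> X" using interior_point[OF x] by metis
  define w where "w i = x + inverse (real (Suc i)) *\<^sub>R z" for i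
  have w0: "w i \<noteq> 0" for i
  proof
    assume "w i = 0"
    then have "x \<bullet> w i = 0" by simp
    then show False using z nx by (simp add: w_def inner_add_right dot_square_norm)
  qed
  have "(\<lambda>i. inverse (real (Suc i)) *\<^sub>R z) \<longlonglongrightarrow> 0 *\<^sub>R z"
    by (intro tendsto_intros LIMSEQ_inverse_real_of_nat)
  then have wl: "w \<longlonglongrightarrow> x"
    unfolding w_def using tendsto_add[OF tendsto_const, of _ 0 sequentially x] by simp
  have "(\<lambda>i. w i /\<^sub>R norm (w i)) \<longlonglongrightarrow> x /\<^sub>R norm x"
    using wl nx by (intro tendsto_intros) auto
  then have yl: "(\<lambda>i. w i /\<^sub>R norm (w i)) \<longlonglongrightarrow> x" using nx by simp
  then have "\<forall>\<^sub>F i in sequentially. dist (w i /\<^sub>R norm (w i)) x < e" using e(1) by (rule tendstoD)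
  then obtain N where N: "\<And>i. i \<ge> N \<Longrightarrow> dist (w i /\<^sub>R norm (w i)) x < e"
    by (auto simp: eventually_sequentially)
  \<comment> \<open>The shift by N makes every term, not only almost all, a point of
    \<open>X\<close>.\<close>
  define y where "y i = w (i + N) /\<^sub>R norm (w (i + N))" for i
  have yX: "y i \<in> X" for i unfolding y_def using w0 N by (intro e(2)) auto
  have yl: "y \<longlonglongrightarrow> x" unfolding y_def using LIMSEQ_ignore_initial_segment[OF yl, of N] .
  define Y where "Y i = \<rho> (y i) *\<^sub>R y i" for i
  define s where "s i = \<rho> (y i) / norm (w (i + N))" for i
  define v where "v i = Y i - \<rho> x *\<^sub>R x" for i
  have s: "s i > 0" for i using adm_pos[OF \<rho> yX] w0 by (simp add: s_def)
  \<comment> \<open>The coefficient of z is never zero, so the secant does not vanish and can be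
    normalized.\<close>
  have v: "v i = (s i - \<rho> x) *\<^sub>R x + (s i * inverse (real (Suc (i + N)))) *\<^sub>R z" for i
    by (simp add: v_def Y_def y_def s_def w_def algebra_simps divide_inverse)
  have "v i \<bullet> z = s i * inverse (real (Suc (i + N))) * (z \<bullet> z)" for i
    using z by (simp add: v inner_add_left)
  then have v0: "v i \<noteq> 0" for i using s[of i] z by (metis inner_zero_left inner_eq_zero_iff inverse_nonzero_iff_nonzero less_irrefl mult_eq_0_iff of_nat_eq_0_iff nat.distinct(1))
  have "(\<lambda>i. \<rho> (y i)) \<longlonglongrightarrow> \<rho> x"
    by (rule adm_joint_tendsto[OF \<rho> tendsto_const yX yl x(1)])
  then have Yl: "Y \<longlonglongrightarrow> \<rho> x *\<^sub>R x" unfolding Y_def using yl by (intro tendsto_intros)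
  have Ys: "\<forall>i. Y i \<in> radial_surface X \<rho> - {\<rho> x *\<^sub>R x}"
    using v0 yX unfolding radial_surface_def v_def Y_def by auto
  have lim: "(\<lambda>i. v i \<bullet> n / norm (v i)) \<longlonglongrightarrow> 0" if "is_outer_unit_normal X \<rho> x n" for n
    using that Ys Yl unfolding is_outer_unit_normal_def tendsto_at_iff_sequentially
    by (auto simp: comp_def v_def)
  define \<alpha> where "\<alpha> i = (s i - \<rho> x) / norm (v i)" for i
  define \<beta> where "\<beta> i = (s i * inverse (real (Suc (i + N)))) / norm (v i)" for i
  have dir: "\<alpha> i *\<^sub>R x + \<beta> i *\<^sub>R z = v i /\<^sub>R norm (v i)" for i
    by (subst v) (simp add: \<alpha>_def \<beta>_def scaleR_add_right divide_inverse mult.commute)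
  have "\<forall>i. norm (\<alpha> i *\<^sub>R x + \<beta> i *\<^sub>R z) = 1" using v0 by (simp add: dir)
  moreover have "(\<lambda>i. (\<alpha> i *\<^sub>R x + \<beta> i *\<^sub>R z) \<bullet> n) \<longlonglongrightarrow> 0" if "is_outer_unit_normal X \<rho> x n" for n
    using lim[OF that] by (simp add: dir divide_inverse mult.commute)
  ultimately show "\<exists>\<alpha> \<beta>. (\<forall>i::nat. norm (\<alpha> i *\<^sub>R x + \<beta> i *\<^sub>R z) = 1) \<and>
      (\<lambda>i. (\<alpha> i *\<^sub>R x + \<beta> i *\<^sub>R z) \<bullet> n) \<longlonglongrightarrow> 0 \<and> (\<lambda>i. (\<alpha> i *\<^sub>R x + \<beta> i *\<^sub>R z) \<bullet> n') \<longlonglongrightarrow> 0"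
    using n by blast
qed

lemma density_eq_kernel:
  assumes \<rho>: "\<rho> \<in> adm" and x: "x \<in> regular \<rho>" "x \<notin> S2_frontier \<Omega>"
  shows "f x * (x \<bullet> outer_normal X \<rho> x) / (\<rho> x)\<^sup>2 = f x * kernel x (sel \<rho> x)"
proof -
  define p where "p = conormal (snd (sel \<rho> x)) (fst (sel \<rho> x)) x"
  have n: "is_outer_unit_normal X \<rho> x (p /\<^sub>R norm p)"
    unfolding p_def by (rule is_outer_unit_normal_conormal[OF \<rho> x(1)])
  have "outer_normal X \<rho> x = p /\<^sub>R norm p"
    unfolding outer_normal_def using x regular_subset
    by (intro the_equality n outer_unit_normal_unique[OF \<rho> _ x(2) _ n]) auto
  moreover have "x \<bullet> p = 1 / \<rho> x" unfolding p_def by (rule sel_inner[OF \<rho> x(1)])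
  ultimately show ?thesis
    by (simp add: kernel_def p_def[symmetric] power2_eq_square power3_eq_cube divide_inverse)
qed

section \<open>Reflector measures as push-forwards of the light density\<close>

definition light :: "(real^3 \<Rightarrow> real) \<Rightarrow> real^3 \<Rightarrow> real" where
  "light \<rho> x = (indicator X x *\<^sub>R f x) * (if x \<in> regular \<rho> then kernel x (sel \<rho> x) else 0)"

text \<open>A genuine Borel measure on the whole space behind the set function
  \<open>reflector_measure\<close>, so that weak convergence against continuous functions can be
  used.\<close>

definition mu :: "(real^3 \<Rightarrow> real) \<Rightarrow> (real^3) measure" where
  "mu \<rho> = distr (density sphere_measure (\<lambda>x. ennreal (light \<rho> x))) borel (\<lambda>x. fst (sel \<rho> x))"

lemma light_measurable:
  assumes \<rho>: "\<rho> \<in> adm" shows "light \<rho> \<in> borel_measurable sphere_measure"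
proof -
  have "continuous_on (regular \<rho>) (\<lambda>x. kernel x (sel \<rho> x))"
    unfolding continuous_on_def
  proof
    fix x assume x: "x \<in> regular \<rho>"
    have "(sel \<rho> \<longlongrightarrow> sel \<rho> x) (at x within regular \<rho>)"
      using sel_continuous[OF \<rho>] x by (simp add: continuous_on_def)
    then show "((\<lambda>x. kernel x (sel \<rho> x)) \<longlongrightarrow> kernel x (sel \<rho> x)) (at x within regular \<rho>)"
      using sel_supports[OF \<rho> x] D_nonzero \<delta>M_pos X_unit x regular_subset
      by (intro tendsto_kernel) auto
  qed
  then have "(\<lambda>x. if x \<in> regular \<rho> then kernel x (sel \<rho> x) else 0) \<in> borel_measurable sphere_measure"
    by (intro borel_measurable_sphere_continuous_on[OF regular_sets[OF \<rho>]]) (auto cong: continuous_on_cong)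
  moreover have "(\<lambda>x. indicator X x *\<^sub>R f x) \<in> borel_measurable sphere_measure"
    using f(1) by (auto simp: set_integrable_def)
  ultimately show ?thesis unfolding light_def by measurable
qed

lemma AE_light_nonneg: assumes \<rho>: "\<rho> \<in> adm" shows "AE x in sphere_measure. 0 \<le> light \<rho> x"
  using f(2)
proof eventually_elim
  case (elim x)
  then show ?case using kernel_sel_bounds(3)[OF \<rho>, of x] by (auto simp: light_def indicator_def)
qed

lemma light_bound:
  assumes \<rho>: "\<rho> \<in> adm" shows "norm (light \<rho> x) \<le> norm (indicator X x *\<^sub>R f x) * (1 / lo\<^sup>2)"
  unfolding light_def norm_mult using kernel_sel_bounds[OF \<rho>, of x]
  by (intro mult_left_mono) auto

lemma light_integrable:
  assumes \<rho>: "\<rho> \<in> adm" shows "integrable sphere_measure (light \<rho>)"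
proof (rule Bochner_Integration.integrable_bound)
  show "integrable sphere_measure (\<lambda>x. (indicator X x *\<^sub>R f x) * (1 / lo\<^sup>2))"
    using f(1) by (intro integrable_mult_left) (simp add: set_integrable_def)
  have "norm (indicator X x *\<^sub>R f x) * (1 / lo\<^sup>2) = norm ((indicator X x *\<^sub>R f x) * (1 / lo\<^sup>2))" for x
    by (simp add: abs_mult)
  then show "AE x in sphere_measure. norm (light \<rho> x) \<le> norm ((indicator X x *\<^sub>R f x) * (1 / lo\<^sup>2))"
    using light_bound[OF \<rho>] by (metis (mono_tags, lifting) AE_I2)
qed (rule light_measurable[OF \<rho>])

lemma focus_measurable: "\<rho> \<in> adm \<Longrightarrow> (\<lambda>x. fst (sel \<rho> x)) \<in> borel_measurable sphere_measure"
  using sel_measurable[of \<rho>] by (simp add: borel_prod[symmetric])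

lemma sets_mu [simp, measurable_cong]: "sets (mu \<rho>) = sets borel" by (simp add: mu_def)

lemma emeasure_mu:
  assumes \<rho>: "\<rho> \<in> adm" and E: "E \<in> sets borel"
  shows "emeasure (mu \<rho>) E = (\<integral>\<^sup>+x. ennreal (light \<rho> x) * indicator E (fst (sel \<rho> x)) \<partial>sphere_measure)"
proof -
  note [measurable] = light_measurable[OF \<rho>] focus_measurable[OF \<rho>] E
  have "emeasure (mu \<rho>) E = emeasure (density sphere_measure (\<lambda>x. ennreal (light \<rho> x)))
      ((\<lambda>x. fst (sel \<rho> x)) -` E \<inter> space sphere_measure)"
    unfolding mu_def by (subst emeasure_distr) auto
  also have "\<dots> = (\<integral>\<^sup>+x. ennreal (light \<rho> x) * indicator ((\<lambda>x. fst (sel \<rho> x)) -` E \<inter> space sphere_measure) x \<partial>sphere_measure)"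
    by (rule emeasure_density) measurable
  finally show ?thesis by (simp add: indicator_def cong: nn_integral_cong_simp)
qed

text \<open>Almost everywhere on \<open>X\<close> the support is unique and the normal is the
  normalized conormal. There x belongs to the trace of E exactly when its one focus lies in E, and
  both integrands agree.\<close>

lemma reflector_measure_eq_mu:
  assumes \<rho>: "\<rho> \<in> adm" and E: "E \<in> sets borel" "E \<subseteq> D"
  shows "reflector_measure X f \<rho> E = emeasure (mu \<rho>) E"
proof -
  have "emeasure (mu \<rho>) E = (\<integral>\<^sup>+x. ennreal (light \<rho> x) * indicator E (fst (sel \<rho> x)) \<partial>sphere_measure)"
    by (rule emeasure_mu[OF \<rho> E(1)])
  also have "\<dots> = (\<integral>\<^sup>+x. ennreal (f x * (x \<bullet> outer_normal X \<rho> x) / (\<rho> x)\<^sup>2) * indicator (trace_set X \<rho> E) x \<partial>sphere_measure)"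
  proof (rule nn_integral_cong_AE)
    show "AE x in sphere_measure. ennreal (light \<rho> x) * indicator E (fst (sel \<rho> x)) =
        ennreal (f x * (x \<bullet> outer_normal X \<rho> x) / (\<rho> x)\<^sup>2) * indicator (trace_set X \<rho> E) x"
      using AE_regular[OF \<rho>] AE_not_in[OF frontier_null]
    proof eventually_elim
      case (elim x)
      show ?case
      proof (cases "x \<in> X")
        case False
        then show ?thesis by (auto simp: light_def trace_set_def trace_at_def)
      next
        case True
        then have x: "x \<in> regular \<rho>" "x \<in> S2" using elim X_subset by auto
        have "x \<in> trace_set X \<rho> E \<longleftrightarrow> fst (sel \<rho> x) \<in> E"
        proof
          assume "x \<in> trace_set X \<rho> E"
          then obtain P d where "P \<in> E" "supports X \<rho> d P x" by (auto simp: trace_set_def trace_at_def)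
          then show "fst (sel \<rho> x) \<in> E" using sel_eq[OF \<rho> x(1), of P d] E(2) by auto
        next
          assume "fst (sel \<rho> x) \<in> E"
          then show "x \<in> trace_set X \<rho> E"
            using sel_supports[OF \<rho> x(1)] True unfolding trace_set_def trace_at_def by blast
        qed
        then show ?thesis
          using density_eq_kernel[OF \<rho> x(1)] elim True x by (auto simp: light_def indicator_def)
      qed
    qed
  qed
  finally show ?thesis by (simp add: reflector_measure_def)
qed

lemma emeasure_mu_outside:
  assumes \<rho>: "\<rho> \<in> adm" and E: "E \<in> sets borel" "E \<inter> D = {}"
  shows "emeasure (mu \<rho>) E = 0"
proof -
  note [measurable] = light_measurable[OF \<rho>] focus_measurable[OF \<rho>]
  have "(\<lambda>x. fst (sel \<rho> x)) -` E \<inter> space sphere_measure = {}" using sel_range[OF \<rho>] E by auto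
  then show ?thesis unfolding mu_def using E(1) by (subst emeasure_distr) auto
qed

lemma integral_mu:
  fixes \<phi> :: "real^3 \<Rightarrow> real"
  assumes \<rho>: "\<rho> \<in> adm" and \<phi>: "\<phi> \<in> borel_measurable borel"
  shows "integral\<^sup>L (mu \<rho>) \<phi> = (LINT x|sphere_measure. light \<rho> x * \<phi> (fst (sel \<rho> x)))"
proof -
  note [measurable] = light_measurable[OF \<rho>] focus_measurable[OF \<rho>] \<phi>
  have "integral\<^sup>L (mu \<rho>) \<phi> = integral\<^sup>L (density sphere_measure (\<lambda>x. ennreal (light \<rho> x))) (\<lambda>x. \<phi> (fst (sel \<rho> x)))"
    unfolding mu_def by (rule integral_distr) measurable
  also have "\<dots> = (LINT x|sphere_measure. light \<rho> x *\<^sub>R \<phi> (fst (sel \<rho> x)))"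
    by (rule integral_density) (auto intro: AE_light_nonneg[OF \<rho>])
  finally show ?thesis by simp
qed

lemma finite_mu:
  assumes \<rho>: "\<rho> \<in> adm" shows "finite_measure (mu \<rho>)"
proof (rule finite_measureI)
  note [measurable] = light_measurable[OF \<rho>] focus_measurable[OF \<rho>]
  have "emeasure (mu \<rho>) (space (mu \<rho>)) = (\<integral>\<^sup>+x. ennreal (light \<rho> x) \<partial>sphere_measure)"
  proof -
    have "emeasure (mu \<rho>) (space (mu \<rho>)) = emeasure (density sphere_measure (\<lambda>x. ennreal (light \<rho> x))) (space sphere_measure)"
      unfolding mu_def by (simp add: emeasure_distr)
    also have "\<dots> = (\<integral>\<^sup>+x. ennreal (light \<rho> x) * indicator (space sphere_measure) x \<partial>sphere_measure)"
      by (rule emeasure_density[OF _ sets.top]) measurable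
    also have "\<dots> = (\<integral>\<^sup>+x. ennreal (light \<rho> x) \<partial>sphere_measure)"
      by (intro nn_integral_cong) simp
    finally show ?thesis .
  qed
  also have "\<dots> = ennreal (LINT x|sphere_measure. light \<rho> x)"
    by (rule nn_integral_eq_integral[OF light_integrable[OF \<rho>] AE_light_nonneg[OF \<rho>]])
  finally show "emeasure (mu \<rho>) (space (mu \<rho>)) \<noteq> \<infinity>" by simp
qed

text \<open>Dominated convergence: the supporting pairs, and with them kernel and focus, converge at
  almost every x, and |f|/\<open>lo\<close>^2 times a bound of \<phi> on D dominates.\<close>

lemma mu_tendsto:
  fixes \<phi> :: "real^3 \<Rightarrow> real"
  assumes \<rho>: "\<And>n. \<rho> n \<in> adm" and lim: "\<And>z. z \<in> X \<Longrightarrow> (\<lambda>n. \<rho> n z) \<longlonglongrightarrow> \<rho>0 z"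
    and \<phi>: "continuous_on UNIV \<phi>"
  shows "(\<lambda>n. integral\<^sup>L (mu (\<rho> n)) \<phi>) \<longlonglongrightarrow> integral\<^sup>L (mu \<rho>0) \<phi>"
proof -
  have \<rho>0: "\<rho>0 \<in> adm" using \<rho> lim by (rule adm_closed)
  have \<phi>m [measurable]: "\<phi> \<in> borel_measurable borel" using \<phi> by (rule borel_measurable_continuous_onI)
  have "compact (\<phi> ` D)" using \<phi> D by (intro compact_continuous_image) (auto intro: continuous_on_subset)
  then have "bounded (\<phi> ` D)" by (rule compact_imp_bounded)
  then obtain B where B: "\<And>y. y \<in> D \<Longrightarrow> norm (\<phi> y) \<le> B"
    unfolding bounded_iff by blast
  have meas: "(\<lambda>x. light \<rho> x * \<phi> (fst (sel \<rho> x))) \<in> borel_measurable sphere_measure" if "\<rho> \<in> adm" for \<rho>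
    using light_measurable[OF that] measurable_compose[OF focus_measurable[OF that] \<phi>m] by measurable
  have "(\<lambda>n. LINT x|sphere_measure. light (\<rho> n) x * \<phi> (fst (sel (\<rho> n) x)))
     \<longlonglongrightarrow> (LINT x|sphere_measure. light \<rho>0 x * \<phi> (fst (sel \<rho>0 x)))"
  proof (rule integral_dominated_convergence)
    show "integrable sphere_measure (\<lambda>x. norm (indicator X x *\<^sub>R f x) * (1 / lo\<^sup>2) * B)"
      using f(1) by (intro integrable_mult_left integrable_norm) (simp add: set_integrable_def)
    show "AE x in sphere_measure. norm (light (\<rho> n) x * \<phi> (fst (sel (\<rho> n) x)))
        \<le> norm (indicator X x *\<^sub>R f x) * (1 / lo\<^sup>2) * B" for n
    proof (rule AE_I2)
      fix x show "norm (light (\<rho> n) x * \<phi> (fst (sel (\<rho> n) x))) \<le> norm (indicator X x *\<^sub>R f x) * (1 / lo\<^sup>2) * B"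
        unfolding norm_mult[of "light (\<rho> n) x"]
        using light_bound[OF \<rho>] B sel_range[OF \<rho>] by (intro mult_mono) auto
    qed
    \<comment> \<open>Countably many null sets, so almost every x is uniquely supported for all
      members of the sequence at once.\<close>
    have "AE x in sphere_measure. \<forall>n. x \<in> X \<longrightarrow> x \<in> regular (\<rho> n)"
      unfolding AE_all_countable using AE_regular[OF \<rho>] by blast
    then show "AE x in sphere_measure. (\<lambda>n. light (\<rho> n) x * \<phi> (fst (sel (\<rho> n) x))) \<longlonglongrightarrow> light \<rho>0 x * \<phi> (fst (sel \<rho>0 x))"
      using AE_regular[OF \<rho>0]
    proof eventually_elim
      case (elim x)
      show ?case
      proof (cases "x \<in> X")
        case True
        then have x: "\<And>n. x \<in> regular (\<rho> n)" "x \<in> regular \<rho>0" using elim by auto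
        have s: "(\<lambda>n. sel (\<rho> n) x) \<longlonglongrightarrow> sel \<rho>0 x"
          by (rule sel_tendsto[OF \<rho> lim x(1) tendsto_const x(2)])
        have "(\<lambda>n. kernel x (sel (\<rho> n) x)) \<longlonglongrightarrow> kernel x (sel \<rho>0 x)"
          using s sel_supports[OF \<rho>0 x(2)] D_nonzero \<delta>M_pos X_unit True
          by (intro tendsto_kernel) auto
        then have "(\<lambda>n. light (\<rho> n) x) \<longlonglongrightarrow> light \<rho>0 x"
          using x unfolding light_def by (auto intro!: tendsto_intros)
        moreover have "(\<lambda>n. \<phi> (fst (sel (\<rho> n) x))) \<longlonglongrightarrow> \<phi> (fst (sel \<rho>0 x))"
          by (rule continuous_on_tendsto_compose[OF \<phi> tendsto_fst[OF s]]) auto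
        ultimately show ?thesis by (rule tendsto_mult)
      qed (simp add: light_def)
    qed
  qed (auto intro: meas \<rho> \<rho>0)
  then show ?thesis using integral_mu \<rho> \<rho>0 \<phi>m by simp
qed

text \<open>Arzela-Ascoli is applied to the reciprocals, for which the Lipschitz bound holds. Their
  limit is at least 1/\<open>hi\<close>, so it can be inverted again.\<close>

lemma adm_compact:
  assumes \<rho>: "\<And>n. \<rho> n \<in> adm"
  obtains r \<rho>0 where "strict_mono (r :: nat \<Rightarrow> nat)" "\<rho>0 \<in> adm" "\<And>z. z \<in> X \<Longrightarrow> (\<lambda>n. \<rho> (r n) z) \<longlonglongrightarrow> \<rho>0 z"
proof -
  obtain g r where r: "strict_mono (r :: nat \<Rightarrow> nat)"
    and g: "\<And>e. 0 < e \<Longrightarrow> \<exists>N. \<forall>n x. n \<ge> N \<and> x \<in> X \<longrightarrow> norm (1 / \<rho> (r n) x - g x) < e"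
  proof (rule Arzela_Ascoli[OF X_compact, of "\<lambda>n x. 1 / \<rho> n x" "1 / lo"])
    show "norm (1 / \<rho> n x) \<le> 1 / lo" if "x \<in> X" for n x
    proof -
      have "lo \<le> \<rho> n x" using \<rho> that by (simp add: adm_def)
      then show ?thesis using lo_pos by (simp add: frac_le)
    qed
    fix x and e :: real assume x: "x \<in> X" and e: "0 < e"
    have "norm (1 / \<rho> n x - 1 / \<rho> n y) < e" if "y \<in> X" "norm (x - y) < e * (\<delta> * M)" for n y
    proof -
      have "norm (x - y) / (\<delta> * M) < e" using that \<delta>M_pos by (simp add: field_simps)
      then show ?thesis using adm_lipschitz[OF \<rho> x that(1), of n] by simp
    qed
    moreover have "0 < e * (\<delta> * M)" using e \<delta>M_pos by simp
    ultimately show "\<exists>d>0. \<forall>n y. y \<in> X \<and> norm (x - y) < d \<longrightarrow> norm (1 / \<rho> n x - 1 / \<rho> n y) < e"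
      by blast
  qed blast
  define \<rho>0 where "\<rho>0 x = 1 / g x" for x
  have lim: "(\<lambda>n. \<rho> (r n) z) \<longlonglongrightarrow> \<rho>0 z" if z: "z \<in> X" for z
  proof -
    have 1: "(\<lambda>n. 1 / \<rho> (r n) z) \<longlonglongrightarrow> g z"
      unfolding LIMSEQ_iff using g z by blast
    have b: "1 / hi \<le> 1 / \<rho> (r n) z" for n
    proof -
      have "0 < \<rho> (r n) z" "\<rho> (r n) z \<le> hi" using adm_pos[OF \<rho> z] \<rho> z by (auto simp: adm_def)
      then show ?thesis by (simp add: frac_le)
    qed
    have "1 / hi \<le> g z" by (rule LIMSEQ_le_const[OF 1]) (use b in auto)
    then have "g z > 0" using hi_pos by (meson less_le_trans zero_less_divide_1_iff)
    then have "(\<lambda>n. 1 / (1 / \<rho> (r n) z)) \<longlonglongrightarrow> 1 / g z" using 1 by (intro tendsto_intros) auto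
    then show ?thesis by (simp add: \<rho>0_def)
  qed
  have "\<rho>0 \<in> adm" by (rule adm_closed[of "\<lambda>n. \<rho> (r n)"]) (use \<rho> lim in auto)
  then show ?thesis using that r lim by blast
qed

end

section \<open>Finitely many foci\<close>

lemma integral_atomic:
  fixes \<phi> :: "'a::t2_space \<Rightarrow> real"
  assumes N: "finite_measure N" "sets N = sets borel" and A: "finite A" "emeasure N (UNIV - A) = 0"
    and \<phi>: "\<phi> \<in> borel_measurable borel"
  shows "integral\<^sup>L N \<phi> = (\<Sum>P\<in>A. \<phi> P * measure N {P})"
proof -
  interpret finite_measure N by fact
  note [measurable_cong] = N(2) and [measurable] = \<phi>
  have "UNIV - A \<in> sets borel" using A(1) by (intro borel_open) (simp add: finite_imp_closed open_Diff)
  then have "UNIV - A \<in> null_sets N" using A N(2) by (auto simp: null_sets_def)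
  then have AE: "AE y in N. y \<in> A" by (rule AE_I') auto
  have single: "{P} \<in> sets N" for P using N(2) by simp
  have "integral\<^sup>L N \<phi> = (LINT y|N. (\<Sum>P\<in>A. \<phi> P * indicator {P} y))"
  proof (rule integral_cong_AE)
    show "AE y in N. \<phi> y = (\<Sum>P\<in>A. \<phi> P * indicator {P} y)"
      using AE by eventually_elim (use A(1) in \<open>simp add: indicator_def sum.delta' if_distrib cong: if_cong\<close>)
  qed (use single in measurable)
  also have "\<dots> = (\<Sum>P\<in>A. (LINT y|N. \<phi> P * indicator {P} y))"
    using single by (intro Bochner_Integration.integral_sum integrable_mult_right) (simp add: less_top[symmetric])
  also have "\<dots> = (\<Sum>P\<in>A. \<phi> P * measure N {P})"
    using single sets_eq_imp_space_eq[OF N(2)] by (intro sum.cong) auto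
  finally show ?thesis .
qed

text \<open>The restrictions to the complement of p coincide, so the measures differ only in the
  mass of {p}, and that difference equals the difference of the total masses.\<close>

lemma integral_eq_up_to_atom:
  fixes \<phi> :: "'a::t2_space \<Rightarrow> real"
  assumes N: "finite_measure N1" "sets N1 = sets borel" "finite_measure N2" "sets N2 = sets borel"
    and eq: "\<And>E. E \<in> sets borel \<Longrightarrow> p \<notin> E \<Longrightarrow> emeasure N1 E = emeasure N2 E"
    and \<phi>: "\<phi> \<in> borel_measurable borel" "\<And>y. 0 \<le> \<phi> y \<and> \<phi> y \<le> 1"
  shows "integral\<^sup>L N1 \<phi> = integral\<^sup>L N2 \<phi> + \<phi> p * (measure N1 UNIV - measure N2 UNIV)"
proof -
  let ?S = "- {p}"
  have S: "?S \<in> sets borel" by auto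
  have split: "integral\<^sup>L N \<phi> = integral\<^sup>L (density N (\<lambda>y. ennreal (indicator ?S y))) \<phi> + \<phi> p * measure N {p}"
    and tot: "measure N UNIV = measure N ?S + measure N {p}"
    if N: "finite_measure N" "sets N = sets borel" for N
  proof -
    interpret finite_measure N by fact
    note [measurable_cong] = N(2) and [measurable] = \<phi>(1)
    have [measurable]: "?S \<in> sets N" "{p} \<in> sets N" using N(2) S by auto
    have int: "integrable N \<phi>" using \<phi>(2) by (intro integrable_const_bound[where B=1]) auto
    have i1: "integrable N (\<lambda>y. indicator ?S y *\<^sub>R \<phi> y)" using int by (intro integrable_mult_indicator) auto
    have i2: "integrable N (\<lambda>y. \<phi> p * indicator {p} y)" by (intro integrable_mult_right) (simp add: less_top[symmetric])
    have "integral\<^sup>L N \<phi> = (LINT y|N. indicator ?S y *\<^sub>R \<phi> y + \<phi> p * indicator {p} y)"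
      by (intro Bochner_Integration.integral_cong) (auto simp: indicator_def)
    also have "\<dots> = (LINT y|N. indicator ?S y *\<^sub>R \<phi> y) + (LINT y|N. \<phi> p * indicator {p} y)"
      using i1 i2 by (rule Bochner_Integration.integral_add)
    also have "(LINT y|N. indicator ?S y *\<^sub>R \<phi> y) = integral\<^sup>L (density N (\<lambda>y. ennreal (indicator ?S y))) \<phi>"
      by (rule integral_density[symmetric]) auto
    also have "(LINT y|N. \<phi> p * indicator {p} y) = \<phi> p * measure N {p}"
      using sets_eq_imp_space_eq[OF N(2)] by simp
    finally show "integral\<^sup>L N \<phi> = integral\<^sup>L (density N (\<lambda>y. ennreal (indicator ?S y))) \<phi> + \<phi> p * measure N {p}" .
    have "measure N (?S \<union> {p}) = measure N ?S + measure N {p}"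
      by (rule finite_measure_Union) auto
    then show "measure N UNIV = measure N ?S + measure N {p}" by (simp add: Un_commute)
  qed
  have "density N1 (\<lambda>y. ennreal (indicator ?S y)) = density N2 (\<lambda>y. ennreal (indicator ?S y))"
  proof (rule measure_eqI)
    fix E assume "E \<in> sets (density N1 (\<lambda>y. ennreal (indicator ?S y)))"
    then have E: "E \<in> sets borel" using N by simp
    then show "emeasure (density N1 (\<lambda>y. ennreal (indicator ?S y))) E = emeasure (density N2 (\<lambda>y. ennreal (indicator ?S y))) E"
      using eq[of "?S \<inter> E"] N S by (simp add: ennreal_indicator emeasure_restricted sets.Int)
  qed (use N in simp)
  moreover have "measure N1 ?S = measure N2 ?S" using eq[OF S] by (simp add: measure_def)
  ultimately show ?thesis using split[OF N(1,2)] split[OF N(3,4)] tot[OF N(1,2)] tot[OF N(3,4)]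
    by (simp add: algebra_simps)
qed

text \<open>Converse direction: continuous test functions determine the measure of closed sets,
  which form an intersection-stable generator. With real-valued measures, t may have any
  sign.\<close>

lemma measure_eq_plus_atom:
  fixes N1 N2 :: "'a::metric_space measure"
  assumes N: "finite_measure N1" "sets N1 = sets borel" "finite_measure N2" "sets N2 = sets borel"
    and eq: "\<And>\<phi>. continuous_on UNIV \<phi> \<Longrightarrow> (\<And>y. 0 \<le> \<phi> y \<and> \<phi> y \<le> (1::real)) \<Longrightarrow>
      integral\<^sup>L N1 \<phi> = integral\<^sup>L N2 \<phi> + \<phi> p * t"
    and E: "E \<in> sets borel"
  shows "measure N1 E = measure N2 E + t * indicator E p"
proof -
  interpret N1: finite_measure N1 by fact
  interpret N2: finite_measure N2 by fact
  have sp: "space N1 = UNIV" "space N2 = UNIV" using sets_eq_imp_space_eq[OF N(2)] sets_eq_imp_space_eq[OF N(4)] by auto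
  have closed_case: "measure N1 K = measure N2 K + t * indicator K p" if K: "closed K" for K
  \<comment> \<open>The distance to the empty set has the value 0, so the approximating functions
    would fail there.\<close>
  proof (cases "K = {}")
    case False
    define \<phi> where "\<phi> j y = max 0 (1 - real j * infdist y K)" for j y
    have cont: "continuous_on UNIV (\<phi> j)" for j
      unfolding \<phi>_def by (intro continuous_intros)
    have bd: "0 \<le> \<phi> j y \<and> \<phi> j y \<le> 1" for j y
      by (simp add: \<phi>_def infdist_nonneg)
    have lim: "(\<lambda>j. \<phi> j y) \<longlonglongrightarrow> indicator K y" for y
    proof (cases "y \<in> K")
      case True then show ?thesis by (simp add: \<phi>_def)
    next
      case False
      then have d: "infdist y K > 0"
        using in_closed_iff_infdist_zero[OF K \<open>K \<noteq> {}\<close>, of y] infdist_nonneg[of y K] by auto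
      then obtain j0 where j0: "1 < real j0 * infdist y K" using reals_Archimedean3 by blast
      have "\<phi> j y = 0" if "j \<ge> j0" for j
      proof -
        have "real j0 * infdist y K \<le> real j * infdist y K" using that d by (intro mult_right_mono) auto
        then show ?thesis using j0 by (simp add: \<phi>_def)
      qed
      then have "eventually (\<lambda>j. \<phi> j y = indicator K y) sequentially"
        using False by (auto simp: eventually_sequentially)
      then show ?thesis by (rule tendsto_eventually)
    qed
    have int: "(\<lambda>j. integral\<^sup>L N (\<phi> j)) \<longlonglongrightarrow> measure N K" if N: "finite_measure N" "sets N = sets borel" for N
    proof -
      interpret finite_measure N by fact
      note [measurable_cong] = N(2)
      have [measurable]: "\<phi> j \<in> borel_measurable borel" for j using cont by (rule borel_measurable_continuous_onI)
      have [measurable]: "K \<in> sets borel" using K by auto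
      have "(\<lambda>j. integral\<^sup>L N (\<phi> j)) \<longlonglongrightarrow> integral\<^sup>L N (indicator K)"
        by (rule integral_dominated_convergence[where w="\<lambda>_. 1"]) (use bd lim in auto)
      then show ?thesis using sets_eq_imp_space_eq[OF N(2)] by simp
    qed
    have "(\<lambda>j. integral\<^sup>L N2 (\<phi> j) + \<phi> j p * t) \<longlonglongrightarrow> measure N2 K + indicator K p * t"
      using int[OF N(3,4)] lim by (intro tendsto_intros)
    then have "(\<lambda>j. integral\<^sup>L N1 (\<phi> j)) \<longlonglongrightarrow> measure N2 K + indicator K p * t"
      using eq[OF cont bd] by simp
    then have "measure N1 K = measure N2 K + indicator K p * t"
      using LIMSEQ_unique int[OF N(1,2)] by blast
    then show ?thesis by simp
  qed simp
  have "Int_stable (Collect closed)" "Collect closed \<subseteq> Pow UNIV" "E \<in> sigma_sets UNIV (Collect closed)"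
    using E by (auto simp: Int_stable_def borel_eq_closed)
  then show ?thesis
  proof (induct E rule: sigma_sets_induct_disjoint)
    case (basic K) then show ?case using closed_case by auto
  next
    case empty then show ?case by simp
  next
    case (compl B)
    have B: "B \<in> sets N1" "B \<in> sets N2" using compl(1) N by (auto simp: borel_eq_closed)
    show ?case
      using N1.finite_measure_compl[OF B(1)] N2.finite_measure_compl[OF B(2)] compl(2) closed_case[of UNIV] sp
      by (auto simp: indicator_def)
  next
    case (union B)
    have "range B \<subseteq> sets N1" "range B \<subseteq> sets N2" using union(2) N by (auto simp: borel_eq_closed)
    then have 1: "(\<lambda>i. measure N1 (B i)) sums measure N1 (\<Union>i. B i)"
      and 2: "(\<lambda>i. measure N2 (B i)) sums measure N2 (\<Union>i. B i)"
      using union(1) by (auto intro!: N1.finite_measure_UNION N2.finite_measure_UNION)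
    have "(\<lambda>i. t * indicator (B i) p) sums (t * indicator (\<Union>i. B i) p)"
      using union(1) by (intro sums_mult indicator_sums) (auto simp: disjoint_family_on_def)
    from sums_add[OF 2 this] have "(\<lambda>i. measure N1 (B i)) sums (measure N2 (\<Union>i. B i) + t * indicator (\<Union>i. B i) p)"
      using union(3) by simp
    then show ?case using sums_unique2[OF 1] by simp
  qed
qed

lemma tendsto_Min:
  fixes g :: "'a \<Rightarrow> 'b \<Rightarrow> real"
  assumes "finite A" "A \<noteq> {}" "\<And>P. P \<in> A \<Longrightarrow> ((\<lambda>n. g n P) \<longlongrightarrow> l P) F"
  shows "((\<lambda>n. Min (g n ` A)) \<longlongrightarrow> Min (l ` A)) F"
  using assms by (induction A rule: finite_ne_induct) (auto intro!: tendsto_min)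

context reflector_problem
begin

lemma sets_\<eta>: "sets \<eta> = sets (restrict_space borel D)" using \<eta> by (simp add: radon_measure_on_def)

lemma D_borel: "D \<in> sets borel" using D(1) by (simp add: compact_imp_closed)

lemma space_\<eta>: "space \<eta> = D"
  using sets_eq_imp_space_eq[OF sets_\<eta>] by (simp add: space_restrict_space)

lemma finite_\<eta>: "finite_measure \<eta>"
proof (rule finite_measureI)
  have "emeasure \<eta> D < \<infinity>" using \<eta> D(1) unfolding radon_measure_on_def by blast
  then show "emeasure \<eta> (space \<eta>) \<noteq> \<infinity>" by (simp add: space_\<eta>)
qed

text \<open>The measure \<eta> lives on the space D; its image on all of space has the same
  measurable sets as \<open>mu\<close> and can be compared with it.\<close>

definition eta :: "(real^3) measure" where "eta = distr \<eta> borel (\<lambda>y. y)"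

lemma id_measurable: "(\<lambda>y. y) \<in> borel_measurable \<eta>"
proof -
  have "(\<lambda>y. y) \<in> borel_measurable (restrict_space borel D)" by (rule measurable_restrict_space1) simp
  then show ?thesis by (simp cong: measurable_cong_sets add: sets_\<eta>)
qed

lemma sets_eta [simp, measurable_cong]: "sets eta = sets borel" by (simp add: eta_def)

lemma finite_eta: "finite_measure eta"
  unfolding eta_def using finite_\<eta> id_measurable by (rule finite_measure.finite_measure_distr)

lemma emeasure_eta: "E \<in> sets borel \<Longrightarrow> emeasure eta E = emeasure \<eta> (E \<inter> D)"
  unfolding eta_def by (subst emeasure_distr[OF id_measurable]) (auto simp: space_\<eta> Int_commute)

lemma measure_eta_UNIV: "measure eta UNIV = measure \<eta> D"
  by (simp add: measure_def emeasure_eta)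

lemma \<eta>_pos: "measure \<eta> D > 0"
proof -
  interpret finite_measure \<eta> by (rule finite_\<eta>)
  have "openin (top_of_set D) D" by simp
  then have "emeasure \<eta> D > 0" using P0 P0_D unfolding measure_support_def by blast
  then show ?thesis by (simp add: emeasure_eq_measure)
qed

lemma space_mu [simp]: "space (mu \<rho>) = UNIV" by (simp add: mu_def)

lemma measure_mu_UNIV:
  assumes "\<rho> \<in> adm" shows "measure (mu \<rho>) UNIV = (LINT x|sphere_measure. light \<rho> x)"
  using integral_mu[OF assms, of "\<lambda>_. 1"] by simp

text \<open>The kernel exceeds \<open>C\<close> at almost every point of \<open>X\<close>, so the
  total light strictly exceeds C times the integral of f. Here \<open>X\<close> is not null:
  \<eta>(D) > 0 because P0 is in the support, and the energy condition then makes that integral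
  positive.\<close>

lemma mu_mass: assumes \<rho>: "\<rho> \<in> adm" shows "measure \<eta> D < measure (mu \<rho>) UNIV"
proof -
  interpret finite_measure sphere_measure by (rule finite_sphere_measure)
  let ?h = "\<lambda>x. indicator X x *\<^sub>R f x"
  have h: "integrable sphere_measure ?h" using f(1) by (simp add: set_integrable_def)
  have le: "measure \<eta> D \<le> C * (LINT x|sphere_measure. ?h x)"
    using energy C_pos by (simp add: set_lebesgue_integral_def field_simps)
  have X0: "emeasure sphere_measure X \<noteq> 0"
  proof
    assume "emeasure sphere_measure X = 0"
    then have "AE x in sphere_measure. x \<notin> X" using X_sets by (intro AE_not_in) (auto simp: null_sets_def)
    then have "AE x in sphere_measure. ?h x = 0" by eventually_elim simp
    then have "(LINT x|sphere_measure. ?h x) = 0" by (rule integral_eq_zero_AE)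
    then show False using le \<eta>_pos by simp
  qed
  have "(LINT x|sphere_measure. C * ?h x) < (LINT x|sphere_measure. light \<rho> x)"
  proof (rule integral_less_AE[where A=X])
    have *: "AE x in sphere_measure. (x \<in> X \<longrightarrow> C * ?h x < light \<rho> x) \<and> C * ?h x \<le> light \<rho> x"
      using AE_regular[OF \<rho>] f(2)
    proof eventually_elim
      case (elim x)
      show ?case
      proof (cases "x \<in> X")
        case True
        then have x: "x \<in> regular \<rho>" "f x > 0" using elim by auto
        have "C * f x < kernel x (sel \<rho> x) * f x"
          using kernel_sel_bounds(1)[OF \<rho> x(1)] x(2) by (rule mult_strict_right_mono)
        then show ?thesis using x True by (simp add: light_def mult.commute)
      qed (simp add: light_def)
    qed
    then show "AE x in sphere_measure. x \<in> X \<longrightarrow> C * ?h x \<noteq> light \<rho> x" by eventually_elim auto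
    show "AE x in sphere_measure. C * ?h x \<le> light \<rho> x" using * by eventually_elim auto
  qed (use h light_integrable[OF \<rho>] X0 X_sets in auto)
  then show ?thesis using le by (simp add: measure_mu_UNIV[OF \<rho>])
qed

section \<open>Intersections of finitely many solid ellipsoids\<close>

definition lower :: "(real^3) set \<Rightarrow> (real^3 \<Rightarrow> real) \<Rightarrow> real^3 \<Rightarrow> real" where
  "lower A e x = Min ((\<lambda>P. ellipsoid_radius (e P) P x) ` A)"

text \<open>Holding the parameter at P0 fixed at k \<delta> M bounds the minimum of the radii by
  \<open>hi\<close>, whatever the other parameters are.\<close>

definition feasible :: "(real^3) set \<Rightarrow> (real^3 \<Rightarrow> real) \<Rightarrow> bool" where
  "feasible A e \<longleftrightarrow> finite A \<and> A \<subseteq> D \<and> P0 \<in> A \<and> e P0 = k * \<delta> * M \<and> (\<forall>P\<in>A. \<delta> * M \<le> e P)"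

lemma lower_le: "feasible A e \<Longrightarrow> P \<in> A \<Longrightarrow> lower A e x \<le> ellipsoid_radius (e P) P x"
  unfolding lower_def feasible_def by (intro Min_le) auto

lemma lower_attained: assumes "feasible A e" obtains P where "P \<in> A" "lower A e x = ellipsoid_radius (e P) P x"
proof -
  have "lower A e x \<in> (\<lambda>P. ellipsoid_radius (e P) P x) ` A"
    unfolding lower_def using assms by (intro Min_in) (auto simp: feasible_def)
  then show ?thesis using that by auto
qed

lemma feasible_pos: "feasible A e \<Longrightarrow> P \<in> A \<Longrightarrow> 0 < e P \<and> P \<in> D \<and> P \<noteq> 0"
  using \<delta>M_pos D_nonzero unfolding feasible_def by fastforce

lemma lower_supports:
  assumes "feasible A e" "P \<in> A" "lower A e x = ellipsoid_radius (e P) P x"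
  shows "supports X (lower A e) (e P) P x"
  unfolding supports_def using assms feasible_pos lower_le by auto

lemma radius_le:
  assumes "P \<in> D" "d \<ge> \<delta> * M" "norm x = 1"
  shows "ellipsoid_radius d P x \<le> d / (1 - c)" "d / (1 + c) \<le> ellipsoid_radius d P x"
proof -
  have d: "d > 0" "P \<noteq> 0" using assms \<delta>M_pos D_nonzero by auto
  note e = ecc_le_c[OF assms(1,2)] ecc_pos[OF d] ellipsoid_radius_bounds[OF d assms(3)]
  have "d / (1 - ecc d P) \<le> d / (1 - c)" using e d c_bounds by (intro divide_left_mono mult_pos_pos) auto
  then show "ellipsoid_radius d P x \<le> d / (1 - c)" using e(4) by linarith
  have "d / (1 + c) \<le> d / (1 + ecc d P)" using e d c_bounds by (intro divide_left_mono mult_pos_pos) auto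
  then show "d / (1 + c) \<le> ellipsoid_radius d P x" using e(3) by linarith
qed

lemma lower_adm: assumes e: "feasible A e" shows "lower A e \<in> adm"
proof (rule admI)
  fix x assume x: "x \<in> X"
  obtain P where P: "P \<in> A" "lower A e x = ellipsoid_radius (e P) P x" using lower_attained[OF e] .
  then show "\<exists>P\<in>D. \<exists>d\<ge>\<delta> * M. supports X (lower A e) d P x"
    using lower_supports[OF e P] e by (auto simp: feasible_def)
  have "lower A e x \<le> ellipsoid_radius (e P0) P0 x" using e by (intro lower_le) (auto simp: feasible_def)
  also have "\<dots> \<le> e P0 / (1 - c)" using radius_le(1)[OF P0_D _ X_unit[OF x]] e by (auto simp: feasible_def)
  also have "\<dots> = hi" using e by (simp add: hi_def feasible_def)
  finally show "lower A e x \<le> hi" .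
qed

lemma lower_sel:
  assumes e: "feasible A e" and x: "x \<in> regular (lower A e)" and P: "P \<in> A" "lower A e x = ellipsoid_radius (e P) P x"
  shows "sel (lower A e) x = (P, e P)"
  using feasible_pos[OF e P(1)] by (intro sel_eq[OF lower_adm[OF e] x] lower_supports[OF e P]) auto

lemma lower_sel_focus:
  assumes e: "feasible A e" and x: "x \<in> regular (lower A e)"
  shows "fst (sel (lower A e) x) \<in> A"
    "lower A e x = ellipsoid_radius (e (fst (sel (lower A e) x))) (fst (sel (lower A e) x)) x"
proof -
  obtain P where P: "P \<in> A" "lower A e x = ellipsoid_radius (e P) P x" using lower_attained[OF e] .
  then show "fst (sel (lower A e) x) \<in> A"
    "lower A e x = ellipsoid_radius (e (fst (sel (lower A e) x))) (fst (sel (lower A e) x)) x"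
    using lower_sel[OF e x P] by auto
qed

abbreviation flux :: "(real^3) set \<Rightarrow> (real^3 \<Rightarrow> real) \<Rightarrow> real^3 \<Rightarrow> real" where
  "flux A e P \<equiv> measure (mu (lower A e)) {P}"

text \<open>Enlarging the other ellipsoids while that of P stays fixed keeps P minimal wherever it
  was minimal. There the supporting pair is the same, hence so is the light.\<close>

lemma flux_mono:
  assumes e: "feasible A e" "feasible A e'" and le: "\<And>Q. Q \<in> A \<Longrightarrow> e Q \<le> e' Q" and P: "P \<in> A" "e P = e' P"
  shows "flux A e P \<le> flux A e' P"
proof -
  note adm = lower_adm[OF e(1)] lower_adm[OF e(2)]
  interpret N: finite_measure "mu (lower A e')" by (rule finite_mu[OF adm(2)])
  have "emeasure (mu (lower A e)) {P} \<le> emeasure (mu (lower A e')) {P}"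
    unfolding emeasure_mu[OF adm(1) borel_singleton[OF sets.empty_sets]] emeasure_mu[OF adm(2) borel_singleton[OF sets.empty_sets]]
  proof (rule nn_integral_mono_AE)
    show "AE x in sphere_measure. ennreal (light (lower A e) x) * indicator {P} (fst (sel (lower A e) x))
        \<le> ennreal (light (lower A e') x) * indicator {P} (fst (sel (lower A e') x))"
      using AE_regular[OF adm(1)] AE_regular[OF adm(2)]
    proof eventually_elim
      case (elim x)
      show ?case
      proof (cases "x \<in> X \<and> fst (sel (lower A e) x) = P")
        case True
        then have x: "x \<in> regular (lower A e)" "x \<in> regular (lower A e')" "norm x = 1"
          using elim X_unit by auto
        obtain Q where Q: "Q \<in> A" "lower A e' x = ellipsoid_radius (e' Q) Q x" using lower_attained[OF e(2)] .
        have eq: "lower A e x = ellipsoid_radius (e P) P x" using lower_sel_focus[OF e(1) x(1)] True by simp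
        have "lower A e x \<le> ellipsoid_radius (e Q) Q x" by (rule lower_le[OF e(1) Q(1)])
        also have "\<dots> \<le> lower A e' x" unfolding Q(2)
          using feasible_pos[OF e(1) Q(1)] le[OF Q(1)] x(3) by (intro ellipsoid_radius_mono) auto
        finally have "lower A e' x = ellipsoid_radius (e' P) P x"
          using lower_le[OF e(2) P(1), of x] P(2) eq by simp
        then have "sel (lower A e') x = sel (lower A e) x"
          using lower_sel[OF e(2) x(2) P(1)] lower_sel[OF e(1) x(1) P(1) eq] P(2) by simp
        then show ?thesis using x by (simp add: light_def)
      next
        case False
        then show ?thesis by (auto simp: light_def)
      qed
    qed
  qed
  then show ?thesis unfolding measure_def by (rule enn2real_mono) (simp add: less_top[symmetric])
qed

lemma flux_zero:
  assumes e: "feasible A e" and no: "\<And>x. x \<in> regular (lower A e) \<Longrightarrow> fst (sel (lower A e) x) \<noteq> P"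
  shows "flux A e P = 0"
proof -
  have "emeasure (mu (lower A e)) {P} = (\<integral>\<^sup>+x. 0 \<partial>sphere_measure)"
    unfolding emeasure_mu[OF lower_adm[OF e] borel_singleton[OF sets.empty_sets]]
    by (rule nn_integral_cong) (use no in \<open>auto simp: light_def\<close>)
  then show ?thesis by (simp add: measure_def)
qed

lemma mu_lower_outside: assumes e: "feasible A e" shows "emeasure (mu (lower A e)) (UNIV - A) = 0"
proof -
  have "finite A" using e by (simp add: feasible_def)
  then have U: "UNIV - A \<in> sets borel" by (intro borel_open) (simp add: finite_imp_closed open_Diff)
  have "emeasure (mu (lower A e)) (UNIV - A) = (\<integral>\<^sup>+x. 0 \<partial>sphere_measure)"
    unfolding emeasure_mu[OF lower_adm[OF e] U]
    by (intro nn_integral_cong) (use lower_sel_focus(1)[OF e] in \<open>auto simp: light_def indicator_def\<close>)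
  then show ?thesis by simp
qed

lemma integral_mu_lower:
  assumes e: "feasible A e" and \<phi>: "\<phi> \<in> borel_measurable borel"
  shows "integral\<^sup>L (mu (lower A e)) \<phi> = (\<Sum>P\<in>A. \<phi> P * flux A e P)"
  using e finite_mu[OF lower_adm[OF e]] mu_lower_outside[OF e] \<phi>
  by (intro integral_atomic) (auto simp: feasible_def)

lemma flux_total: assumes e: "feasible A e" shows "(\<Sum>P\<in>A. flux A e P) = measure (mu (lower A e)) UNIV"
  using integral_mu_lower[OF e, of "\<lambda>_. 1"] by simp

text \<open>The function \<phi> is continuous, 1 at P and 0 at the other foci, so the light at P is
  an integral of \<phi> and weak convergence applies.\<close>

lemma flux_tendsto:
  assumes e: "\<And>n. feasible A (e n)" "feasible A e0" and lim: "\<And>P. P \<in> A \<Longrightarrow> (\<lambda>n. e n P) \<longlonglongrightarrow> e0 P" and P: "P \<in> A"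
  shows "(\<lambda>n. flux A (e n) P) \<longlonglongrightarrow> flux A e0 P"
proof -
  have A: "finite A" "A \<noteq> {}" using e(2) P by (auto simp: feasible_def)
  define \<phi> where "\<phi> y = (\<Prod>Q\<in>A - {P}. dist y Q / dist P Q)" for y
  have cont: "continuous_on UNIV \<phi>" unfolding \<phi>_def by (intro continuous_intros) auto
  have \<phi>m: "\<phi> \<in> borel_measurable borel" using cont by (rule borel_measurable_continuous_onI)
  have 1: "\<phi> P = 1" unfolding \<phi>_def by (intro prod.neutral) auto
  have 0: "\<phi> Q = 0" if "Q \<in> A" "Q \<noteq> P" for Q
    unfolding \<phi>_def using that A by (intro prod_zero) (auto intro!: bexI[of _ Q])
  have eq: "integral\<^sup>L (mu (lower A e)) \<phi> = flux A e P" if "feasible A e" for e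
  proof -
    have "integral\<^sup>L (mu (lower A e)) \<phi> = (\<Sum>Q\<in>A. \<phi> Q * flux A e Q)" by (rule integral_mu_lower[OF that \<phi>m])
    also have "\<dots> = (\<Sum>Q\<in>A. if Q = P then flux A e P else 0)" using 0 1 by (intro sum.cong) auto
    also have "\<dots> = flux A e P" using A P by simp
    finally show ?thesis .
  qed
  have "(\<lambda>n. lower A (e n) z) \<longlonglongrightarrow> lower A e0 z" if z: "z \<in> X" for z
    unfolding lower_def using A lim feasible_pos[OF e(2)] X_unit[OF z]
    by (intro tendsto_Min tendsto_ellipsoid_radius tendsto_const) auto
  from mu_tendsto[OF lower_adm[OF e(1)] this cont] show ?thesis using eq e by simp
qed

text \<open>
  The parameters \<open>e P\<close> are the smallest ones for which no focus other than \<open>P0\<close> receives too much light;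
  such families of parameters are closed under pointwise minima.
\<close>

lemma discrete_solution:
  assumes A: "finite A" "A \<subseteq> D" "P0 \<in> A" and g: "\<And>P. P \<in> A \<Longrightarrow> 0 \<le> g P" "(\<Sum>P\<in>A. g P) \<le> measure \<eta> D"
  obtains e where "feasible A e" "\<And>P. P \<in> A \<Longrightarrow> P \<noteq> P0 \<Longrightarrow> flux A e P = g P"
proof -
  define W where "W = {e. feasible A e \<and> (\<forall>P\<in>A - {P0}. flux A e P \<le> g P)}"
  have kM: "\<delta> * M \<le> k * \<delta> * M" using k_ge_1 \<delta>M_pos mult_right_mono[of 1 k "\<delta> * M"] by simp
  \<comment> \<open>With parameter at least 2 \<open>hi\<close> + 1 the radius exceeds
    \<open>hi\<close>, so these ellipsoids never attain the minimum and their foci receive nothing.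
    This shows that \<open>W\<close> is nonempty.\<close>
  define e1 where "e1 P = (if P = P0 then k * \<delta> * M else max (\<delta> * M) (2 * hi + 1))" for P
  have e1: "feasible A e1" using A kM by (auto simp: feasible_def e1_def)
  have "flux A e1 P = 0" if P: "P \<in> A" "P \<noteq> P0" for P
  proof (rule flux_zero[OF e1])
    fix x assume x: "x \<in> regular (lower A e1)"
    then have xX: "x \<in> X" using regular_subset by auto
    show "fst (sel (lower A e1) x) \<noteq> P"
    proof
      assume "fst (sel (lower A e1) x) = P"
      then have "lower A e1 x = ellipsoid_radius (e1 P) P x" using lower_sel_focus[OF e1 x] by simp
      moreover have "e1 P / 2 \<le> ellipsoid_radius (e1 P) P x"
        using feasible_pos[OF e1 P(1)] X_unit[OF xX] by (intro ellipsoid_radius_bounds_simple) auto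
      moreover have "lower A e1 x \<le> hi" using lower_adm[OF e1] xX by (simp add: adm_def)
      moreover have "e1 P \<ge> 2 * hi + 1" using P by (simp add: e1_def)
      ultimately show False by linarith
    qed
  qed
  then have e1W: "e1 \<in> W" using e1 g by (simp add: W_def)
  \<comment> \<open>At P the minimum takes the value of one of the two families, and every other
    parameter of that family is at least the minimum. So \<open>flux_mono\<close> compares with that
    family.\<close>
  have W_min: "(\<lambda>P. min (e P) (e' P)) \<in> W" if e: "e \<in> W" "e' \<in> W" for e e'
  proof -
    have o: "feasible A e" "feasible A e'" using e by (auto simp: W_def)
    then have mo: "feasible A (\<lambda>P. min (e P) (e' P))" by (auto simp: feasible_def)
    have "flux A (\<lambda>P. min (e P) (e' P)) P \<le> g P" if P: "P \<in> A" "P \<noteq> P0" for P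
    proof (cases "e P \<le> e' P")
      case True
      then have "flux A (\<lambda>P. min (e P) (e' P)) P \<le> flux A e P" by (intro flux_mono[OF mo o(1) _ P(1)]) auto
      then show ?thesis using e P by (force simp: W_def)
    next
      case False
      then have "flux A (\<lambda>P. min (e P) (e' P)) P \<le> flux A e' P" by (intro flux_mono[OF mo o(2) _ P(1)]) auto
      then show ?thesis using e P by (force simp: W_def)
    qed
    then show ?thesis using mo by (simp add: W_def)
  qed
  define es where "es P = Inf ((\<lambda>e. e P) ` W)" for P
  have W_ge: "\<delta> * M \<le> e P" if "e \<in> W" "P \<in> A" for e P using that by (auto simp: W_def feasible_def)
  have es_le: "es P \<le> e P" if "e \<in> W" "P \<in> A" for e P
    unfolding es_def using that W_ge by (intro cInf_lower bdd_belowI2[of _ "\<delta> * M"]) auto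
  have es_ge: "\<delta> * M \<le> es P" if "P \<in> A" for P
    unfolding es_def using that W_ge e1W by (intro cInf_greatest) auto
  have es_P0: "es P0 = k * \<delta> * M"
  proof -
    have "(\<lambda>e. e P0) ` W = {k * \<delta> * M}" using e1W by (auto simp: W_def feasible_def)
    then show ?thesis by (simp add: es_def)
  qed
  have es: "feasible A es" using A es_ge es_P0 by (simp add: feasible_def)
  \<comment> \<open>The infimum is taken separately at each focus. Closure under minima gives a
    single member of \<open>W\<close> close to it at all foci at once.\<close>
  have approx: "\<exists>e\<in>W. \<forall>P\<in>B. e P < es P + r" if r: "r > 0" and B: "finite B" "B \<subseteq> A" for r :: real and B
    using B
  proof (induction B rule: finite_induct)
    case empty then show ?case using e1W by auto
  next
    case (insert P B)
    then obtain e where e: "e \<in> W" "\<And>Q. Q \<in> B \<Longrightarrow> e Q < es Q + r" by auto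
    have "Inf ((\<lambda>e. e P) ` W) < es P + r" using r by (simp add: es_def)
    then obtain e' where e': "e' \<in> W" "e' P < es P + r" using cInf_lessD[of "(\<lambda>e. e P) ` W"] e1W by auto
    have "\<forall>Q\<in>insert P B. min (e Q) (e' Q) < es Q + r" using e(2) e'(2) by (auto simp: min_less_iff_disj)
    then show ?case using W_min[OF e(1) e'(1)] by (intro bexI[of _ "\<lambda>P. min (e P) (e' P)"])
  qed
  have "\<exists>e\<in>W. \<forall>P\<in>A. e P < es P + inverse (real (Suc n))" for n using approx[OF _ A(1)] by simp
  then obtain e where e: "\<And>n. e n \<in> W" "\<And>n P. P \<in> A \<Longrightarrow> e n P < es P + inverse (real (Suc n))" by metis
  have e_lim: "(\<lambda>n. e n P) \<longlonglongrightarrow> es P" if P: "P \<in> A" for P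
  proof (rule tendsto_sandwich[where f="\<lambda>_. es P" and h="\<lambda>n. es P + inverse (real (Suc n))"])
    show "(\<lambda>n. es P + inverse (real (Suc n))) \<longlonglongrightarrow> es P"
      using tendsto_add[OF tendsto_const LIMSEQ_inverse_real_of_nat, of "es P"] by simp
    show "\<forall>\<^sub>F n in sequentially. es P \<le> e n P" using es_le[OF e(1) P] by (intro always_eventually allI)
    show "\<forall>\<^sub>F n in sequentially. e n P \<le> es P + inverse (real (Suc n))"
      using e(2)[OF P] by (intro always_eventually allI less_imp_le)
  qed (rule tendsto_const)
  have e_ok: "feasible A (e n)" for n using e(1)[of n] by (simp add: W_def)
  have es_m: "flux A es P \<le> g P" if "P \<in> A" "P \<noteq> P0" for P
    by (rule LIMSEQ_le_const2[OF flux_tendsto[OF e_ok es e_lim that(1)]]) (use e(1) that in \<open>auto simp: W_def\<close>)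
  have "flux A es P = g P" if P: "P \<in> A" "P \<noteq> P0" for P
  proof (rule ccontr)
    assume "flux A es P \<noteq> g P"
    then have less: "flux A es P < g P" using es_m[OF P] by simp
    \<comment> \<open>At parameter \<delta> M the bound on k puts the ellipsoid at P inside the one
      at P0. By uniqueness of the support P0 then receives nothing, and the total light is at most
      the sum of \<open>g\<close>, which contradicts the strict excess.\<close>
    have "es P \<noteq> \<delta> * M"
    proof
      assume eq: "es P = \<delta> * M"
      have "flux A es P0 = 0"
      proof (rule flux_zero[OF es])
        fix x assume x: "x \<in> regular (lower A es)"
        then have nx: "norm x = 1" using regular_subset X_unit by auto
        show "fst (sel (lower A es) x) \<noteq> P0"
        proof
          assume s: "fst (sel (lower A es) x) = P0"
          have "ellipsoid_radius (es P) P x \<le> \<delta> * M / (1 - c)"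
            using radius_le(1)[OF _ _ nx, of P "es P"] P A eq by auto
          also have "\<dots> = \<delta> * M * ((1 + c) / (1 - c)) / (1 + c)" using c_bounds by simp
          also have "\<dots> \<le> \<delta> * M * k / (1 + c)"
            using k \<delta>M_pos c_bounds by (intro divide_right_mono mult_left_mono) auto
          also have "\<dots> \<le> ellipsoid_radius (es P0) P0 x"
            using radius_le(2)[OF P0_D kM nx] by (simp add: es_P0 mult_ac)
          also have "\<dots> = lower A es x" using lower_sel_focus[OF es x] s by simp
          finally have "lower A es x = ellipsoid_radius (es P) P x" using lower_le[OF es P(1), of x] by simp
          from lower_sel[OF es x P(1) this] show False using s P by simp
        qed
      qed
      then have "(\<Sum>Q\<in>A. flux A es Q) = (\<Sum>Q\<in>A - {P0}. flux A es Q)"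
        using A by (subst sum.remove[of A P0]) auto
      also have "\<dots> \<le> (\<Sum>Q\<in>A - {P0}. g Q)" using es_m by (intro sum_mono) auto
      also have "\<dots> \<le> (\<Sum>Q\<in>A. g Q)" using A g by (intro sum_mono2) auto
      finally show False using flux_total[OF es] mu_mass[OF lower_adm[OF es]] g(2) by simp
    qed
    then have gt: "es P > \<delta> * M" using es_ge[OF P(1)] by simp
    \<comment> \<open>Lowering only the parameter at P keeps the light at P below \<open>g P\<close>
      for a small step, by continuity, and cannot increase the light at the other foci. So
      \<open>h n\<close> is in \<open>W\<close>, against the minimality of
      \<open>es P\<close>.\<close>
    define h where "h n = es(P := max (\<delta> * M) (es P - inverse (real (Suc n))))" for n
    have h_ok: "feasible A (h n)" for n using es P by (auto simp: feasible_def h_def)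
    have h_lim: "(\<lambda>n. h n Q) \<longlonglongrightarrow> es Q" if "Q \<in> A" for Q
    proof (cases "Q = P")
      case True
      have "(\<lambda>n. max (\<delta> * M) (es P - inverse (real (Suc n)))) \<longlonglongrightarrow> max (\<delta> * M) (es P - 0)"
        by (intro tendsto_intros LIMSEQ_inverse_real_of_nat)
      then show ?thesis using True gt by (simp add: h_def max_def)
    qed (simp add: h_def)
    have "eventually (\<lambda>n. flux A (h n) P < g P) sequentially"
      using order_tendstoD(2)[OF flux_tendsto[OF h_ok es h_lim P(1)] less] .
    then obtain n where n: "flux A (h n) P < g P" by (auto simp: eventually_sequentially)
    have "flux A (h n) Q \<le> g Q" if Q: "Q \<in> A" "Q \<noteq> P0" for Q
    proof (cases "Q = P")
      case False
      have "flux A (h n) Q \<le> flux A es Q" using gt False by (intro flux_mono[OF h_ok es _ Q(1)]) (auto simp: h_def)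
      then show ?thesis using es_m[OF Q] by simp
    qed (use n in simp)
    then have "h n \<in> W" using h_ok by (simp add: W_def)
    then have "es P \<le> h n P" using es_le P by simp
    then show False using gt by (simp add: h_def max_def split: if_splits)
  qed
  then show ?thesis using that es by blast
qed

end

section \<open>Existence and minimality\<close>

context reflector_problem
begin

section \<open>Solutions as the target measure plus a point mass\<close>

abbreviation solutions :: "(real^3 \<Rightarrow> real) set" where
  "solutions \<equiv> reflector_solutions X D f \<eta> \<delta> k P0"

text \<open>For a solution this is the weight of the point mass at P0 by which its reflector measure
  exceeds \<eta>.\<close>

definition surplus :: "(real^3 \<Rightarrow> real) \<Rightarrow> real" where
  "surplus \<rho> = measure (mu \<rho>) UNIV - measure \<eta> D"

lemma surplus_pos: "\<rho> \<in> adm \<Longrightarrow> surplus \<rho> > 0"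
  using mu_mass by (simp add: surplus_def)

lemma solutions_iff:
  "\<rho> \<in> solutions \<longleftrightarrow> \<rho> \<in> adm \<and>
     (\<forall>E\<in>sets borel. E \<subseteq> D \<longrightarrow> emeasure \<eta> E \<le> reflector_measure X f \<rho> E) \<and>
     (\<forall>E\<in>sets borel. E \<subseteq> D \<and> P0 \<notin> E \<longrightarrow> emeasure \<eta> E = reflector_measure X f \<rho> E)"
  unfolding reflector_solutions_def adm_def lo_def hi_def M[symmetric] c[symmetric] by auto

lemma reflector_measure_surplus:
  assumes \<rho>: "\<rho> \<in> adm"
    and eq: "\<And>\<phi>. continuous_on UNIV \<phi> \<Longrightarrow> (\<And>y. 0 \<le> \<phi> y \<and> \<phi> y \<le> (1::real)) \<Longrightarrow>
      integral\<^sup>L (mu \<rho>) \<phi> = integral\<^sup>L eta \<phi> + \<phi> P0 * surplus \<rho>"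
    and E: "E \<in> sets borel" "E \<subseteq> D"
  shows "reflector_measure X f \<rho> E = emeasure \<eta> E + ennreal (surplus \<rho>) * indicator E P0"
proof -
  interpret m: finite_measure "mu \<rho>" by (rule finite_mu[OF \<rho>])
  interpret e: finite_measure eta by (rule finite_eta)
  have "measure (mu \<rho>) E = measure eta E + surplus \<rho> * indicator E P0"
    by (rule measure_eq_plus_atom[OF finite_mu[OF \<rho>] sets_mu finite_eta sets_eta eq E(1)])
  then have "emeasure (mu \<rho>) E = emeasure eta E + ennreal (surplus \<rho> * indicator E P0)"
    using surplus_pos[OF \<rho>] by (simp add: m.emeasure_eq_measure e.emeasure_eq_measure)
  moreover have "emeasure eta E = emeasure \<eta> E" using emeasure_eta[OF E(1)] E(2) by (simp add: Int_absorb2)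
  ultimately show ?thesis
    using reflector_measure_eq_mu[OF \<rho> E] by (auto simp: indicator_def)
qed

lemma integral_solution:
  assumes \<rho>: "\<rho> \<in> solutions" and \<phi>: "continuous_on UNIV \<phi>" "\<And>y. 0 \<le> \<phi> y \<and> \<phi> y \<le> (1::real)"
  shows "integral\<^sup>L (mu \<rho>) \<phi> = integral\<^sup>L eta \<phi> + \<phi> P0 * surplus \<rho>"
proof -
  have adm: "\<rho> \<in> adm" using \<rho> by (simp add: solutions_iff)
  have off: "emeasure (mu \<rho>) E = emeasure eta E" if E: "E \<in> sets borel" "P0 \<notin> E" for E
  proof -
    have b: "E \<inter> D \<in> sets borel" "E - D \<in> sets borel" using E D_borel by auto
    have "emeasure (mu \<rho>) E = emeasure (mu \<rho>) ((E \<inter> D) \<union> (E - D))" by (simp add: Int_Diff_Un)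
    also have "\<dots> = emeasure (mu \<rho>) (E \<inter> D) + emeasure (mu \<rho>) (E - D)"
      using b by (intro plus_emeasure[symmetric]) auto
    also have "emeasure (mu \<rho>) (E - D) = 0" using b by (intro emeasure_mu_outside[OF adm]) auto
    also have "emeasure (mu \<rho>) (E \<inter> D) = emeasure \<eta> (E \<inter> D)"
      using \<rho> b E reflector_measure_eq_mu[OF adm b(1)] by (simp add: solutions_iff)
    finally show ?thesis using emeasure_eta[OF E(1)] by simp
  qed
  show ?thesis
    using integral_eq_up_to_atom[OF finite_mu[OF adm] sets_mu finite_eta sets_eta off
        borel_measurable_continuous_onI[OF \<phi>(1)] \<phi>(2)]
    by (simp add: surplus_def measure_eta_UNIV)
qed

lemma reflector_measure_solution:
  assumes "\<rho> \<in> solutions" "E \<in> sets borel" "E \<subseteq> D"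
  shows "reflector_measure X f \<rho> E = emeasure \<eta> E + ennreal (surplus \<rho>) * indicator E P0"
proof -
  have "\<rho> \<in> adm" using assms(1) by (simp add: solutions_iff)
  from reflector_measure_surplus[OF this integral_solution[OF assms(1)] assms(2,3)] show ?thesis .
qed

text \<open>Serves twice: \<open>a n\<close> is the integral against a discretization of \<eta> in
  the existence proof, and the constant integral against \<eta> along a minimizing sequence. The
  test function 1 yields convergence of the surplus.\<close>

lemma solution_limit:
  assumes \<rho>: "\<And>n. \<rho> n \<in> adm"
    and eq: "\<And>n \<phi>. continuous_on UNIV \<phi> \<Longrightarrow> (\<And>y. 0 \<le> \<phi> y \<and> \<phi> y \<le> (1::real)) \<Longrightarrow>
      integral\<^sup>L (mu (\<rho> n)) \<phi> = a n \<phi> + \<phi> P0 * surplus (\<rho> n)"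
    and a: "\<And>\<phi>. continuous_on UNIV \<phi> \<Longrightarrow> (\<And>y. 0 \<le> \<phi> y \<and> \<phi> y \<le> (1::real)) \<Longrightarrow>
      (\<lambda>n. a n \<phi>) \<longlonglongrightarrow> integral\<^sup>L eta \<phi>"
  obtains r \<rho>0 where "strict_mono (r :: nat \<Rightarrow> nat)" "\<rho>0 \<in> solutions" "(\<lambda>n. surplus (\<rho> (r n))) \<longlonglongrightarrow> surplus \<rho>0"
proof -
  obtain r \<rho>0 where r: "strict_mono (r :: nat \<Rightarrow> nat)" "\<rho>0 \<in> adm" "\<And>z. z \<in> X \<Longrightarrow> (\<lambda>n. \<rho> (r n) z) \<longlonglongrightarrow> \<rho>0 z"
    by (rule adm_compact[where \<rho>=\<rho>, OF \<rho>]) (blast intro: that)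
  have lim: "(\<lambda>n. integral\<^sup>L (mu (\<rho> (r n))) \<phi>) \<longlonglongrightarrow> integral\<^sup>L (mu \<rho>0) \<phi>" if "continuous_on UNIV \<phi>" for \<phi> :: "real^3 \<Rightarrow> real"
    by (rule mu_tendsto[OF \<rho> r(3) that])
  have "(\<lambda>n. measure (mu (\<rho> (r n))) UNIV) \<longlonglongrightarrow> measure (mu \<rho>0) UNIV"
    using lim[of "\<lambda>_. 1"] by simp
  then have s: "(\<lambda>n. surplus (\<rho> (r n))) \<longlonglongrightarrow> surplus \<rho>0"
    unfolding surplus_def by (intro tendsto_intros)
  have eq0: "integral\<^sup>L (mu \<rho>0) \<phi> = integral\<^sup>L eta \<phi> + \<phi> P0 * surplus \<rho>0"
    if \<phi>: "continuous_on UNIV \<phi>" "\<And>y. 0 \<le> \<phi> y \<and> \<phi> y \<le> (1::real)" for \<phi>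
  proof (rule LIMSEQ_unique[OF lim[OF \<phi>(1)]])
    have "(\<lambda>n. a (r n) \<phi>) \<longlonglongrightarrow> integral\<^sup>L eta \<phi>"
      using LIMSEQ_subseq_LIMSEQ[OF a[OF \<phi>] r(1)] by (simp add: comp_def)
    then show "(\<lambda>n. integral\<^sup>L (mu (\<rho> (r n))) \<phi>) \<longlonglongrightarrow> integral\<^sup>L eta \<phi> + \<phi> P0 * surplus \<rho>0"
      unfolding eq[OF \<phi>] using s by (intro tendsto_intros)
  qed
  have "reflector_measure X f \<rho>0 E = emeasure \<eta> E + ennreal (surplus \<rho>0) * indicator E P0"
    if "E \<in> sets borel" "E \<subseteq> D" for E
    by (rule reflector_measure_surplus[OF r(2) eq0 that])
  then have "\<rho>0 \<in> solutions" using r(2) by (simp add: solutions_iff)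
  from that[OF r(1) this s] show ?thesis .
qed

text \<open>The measure \<eta> is replaced by its images under maps from D to D with finitely many
  values that converge pointwise to the identity. The images are atomic, and dominated convergence
  gives their weak convergence to \<eta>.\<close>

lemma solutions_nonempty: "solutions \<noteq> {}"
proof -
  interpret e: finite_measure \<eta> by (rule finite_\<eta>)
  from borel_measurable_implies_sequence_metric[OF id_measurable, of 0]
  obtain F where "(\<forall>i. simple_function \<eta> (F i)) \<and> (\<forall>y\<in>space \<eta>. (\<lambda>i. F i y) \<longlonglongrightarrow> y) \<and>
    (\<forall>i. \<forall>y\<in>space \<eta>. dist (F i y) 0 \<le> 2 * dist y 0)" ..
  then have F: "\<And>i. simple_function \<eta> (F i)" "\<And>y. y \<in> D \<Longrightarrow> (\<lambda>i. F i y) \<longlonglongrightarrow> y"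
    unfolding space_\<eta> by blast+
  \<comment> \<open>Simple functions that approximate the identity may take values outside D. Moving
    each value to a nearest point of D at most doubles the distance to y.\<close>
  define G where "G i y = closest_point D (F i y)" for i y
  have G: "simple_function \<eta> (G i)" for i
    unfolding G_def using simple_function_compose1[OF F(1)] .
  have cD: "closed D" "D \<noteq> {}" using D(1) P0_D by (auto simp: compact_imp_closed)
  have GD: "G i y \<in> D" for i y unfolding G_def using cD by (rule closest_point_in_set)
  have Glim: "(\<lambda>i. G i y) \<longlonglongrightarrow> y" if y: "y \<in> D" for y
  proof -
    have near: "dist (F i y) (G i y) \<le> dist (F i y) y" for i
      unfolding G_def using cD y by (intro closest_point_le)
    have le: "norm (dist (G i y) y) \<le> 2 * dist (F i y) y" for i
    proof -
      have "dist (G i y) y \<le> dist (F i y) (G i y) + dist (F i y) y" by (rule dist_triangle3)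
      also have "\<dots> \<le> dist (F i y) y + dist (F i y) y" by (intro add_right_mono near)
      finally show ?thesis by simp
    qed
    have "(\<lambda>i. dist (F i y) y) \<longlonglongrightarrow> 0"
      using F(2)[OF y] by (rule tendsto_dist_iff[THEN iffD1])
    then have "(\<lambda>i. 2 * dist (F i y) y) \<longlonglongrightarrow> 0" by (rule tendsto_mult_right_zero)
    then have "(\<lambda>i. dist (G i y) y) \<longlonglongrightarrow> 0"
      by (rule Lim_null_comparison[OF always_eventually[OF allI[OF le]]])
    then show ?thesis by (rule tendsto_dist_iff[THEN iffD2])
  qed
  have Gm [measurable]: "G i \<in> borel_measurable \<eta>" for i
    using G by (rule borel_measurable_simple_function)
  define N where "N i = distr \<eta> borel (G i)" for i
  have N: "finite_measure (N i)" "sets (N i) = sets borel" "space (N i) = UNIV" for i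
    unfolding N_def using e.finite_measure_distr[OF Gm] by auto
  define A where "A i = insert P0 (G i ` D)" for i
  have A: "finite (A i)" "A i \<subseteq> D" "P0 \<in> A i" for i
    using simple_functionD(1)[OF G] GD P0_D by (auto simp: A_def space_\<eta>)
  have NA: "emeasure (N i) (UNIV - A i) = 0" for i
  proof -
    have U: "UNIV - A i \<in> sets borel" using A(1) by (intro borel_open) (simp add: finite_imp_closed open_Diff)
    have "G i -` (UNIV - A i) \<inter> space \<eta> = {}" by (auto simp: A_def space_\<eta>)
    then show ?thesis unfolding N_def by (subst emeasure_distr[OF Gm U]) simp
  qed
  have N_int: "integral\<^sup>L (N i) \<phi> = (\<Sum>P\<in>A i. \<phi> P * measure (N i) {P})" if "\<phi> \<in> borel_measurable borel" for i \<phi>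
    by (rule integral_atomic[OF N(1,2) A(1) NA that])
  have N_tot: "(\<Sum>P\<in>A i. measure (N i) {P}) = measure \<eta> D" for i
  proof -
    have "(\<Sum>P\<in>A i. measure (N i) {P}) = measure (N i) UNIV" using N_int[of "\<lambda>_. 1" i] N(3) by simp
    also have "\<dots> = measure \<eta> D"
      unfolding measure_def N_def using space_\<eta> by (subst emeasure_distr[OF Gm]) auto
    finally show ?thesis .
  qed
  have "\<exists>e. feasible (A i) e \<and> (\<forall>P\<in>A i. P \<noteq> P0 \<longrightarrow> flux (A i) e P = measure (N i) {P})" for i
    by (rule discrete_solution[where g="\<lambda>P. measure (N i) {P}", OF A]) (use N_tot[of i] in auto)
  \<comment> \<open>At P0 no exact amount is prescribed; the whole excess of light collects
    there.\<close>
  then obtain e where e: "\<And>i. feasible (A i) (e i)" "\<And>i P. P \<in> A i \<Longrightarrow> P \<noteq> P0 \<Longrightarrow> flux (A i) (e i) P = measure (N i) {P}"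
    by metis
  have sur: "integral\<^sup>L (mu (lower (A i) (e i))) \<phi> = integral\<^sup>L (N i) \<phi> + \<phi> P0 * surplus (lower (A i) (e i))"
    if "continuous_on UNIV \<phi>" "\<And>y. 0 \<le> \<phi> y \<and> \<phi> y \<le> (1::real)" for i and \<phi> :: "real^3 \<Rightarrow> real"
  proof -
    have \<phi>m: "\<phi> \<in> borel_measurable borel" using that(1) by (rule borel_measurable_continuous_onI)
    have diff: "(\<Sum>P\<in>A i. \<psi> P * flux (A i) (e i) P) - (\<Sum>P\<in>A i. \<psi> P * measure (N i) {P})
        = \<psi> P0 * (flux (A i) (e i) P0 - measure (N i) {P0})" for \<psi> :: "real^3 \<Rightarrow> real"
    proof -
      have "(\<Sum>P\<in>A i. \<psi> P * flux (A i) (e i) P) - (\<Sum>P\<in>A i. \<psi> P * measure (N i) {P})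
          = (\<Sum>P\<in>A i. if P = P0 then \<psi> P0 * (flux (A i) (e i) P0 - measure (N i) {P0}) else 0)"
        unfolding sum_subtractf[symmetric] using e(2) by (intro sum.cong) (auto simp: right_diff_distrib)
      then show ?thesis using A by simp
    qed
    have "surplus (lower (A i) (e i)) = flux (A i) (e i) P0 - measure (N i) {P0}"
      using diff[of "\<lambda>_. 1"] flux_total[OF e(1)] N_tot by (simp add: surplus_def)
    then show ?thesis using diff[of \<phi>] integral_mu_lower[OF e(1) \<phi>m] N_int[OF \<phi>m] by simp
  qed
  have Nlim: "(\<lambda>i. integral\<^sup>L (N i) \<phi>) \<longlonglongrightarrow> integral\<^sup>L eta \<phi>"
    if \<phi>: "continuous_on UNIV \<phi>" "\<And>y. 0 \<le> \<phi> y \<and> \<phi> y \<le> (1::real)" for \<phi>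
  proof -
    have \<phi>m [measurable]: "\<phi> \<in> borel_measurable borel" using \<phi>(1) by (rule borel_measurable_continuous_onI)
    have 1: "integral\<^sup>L (N i) \<phi> = (LINT y|\<eta>. \<phi> (G i y))" for i
      unfolding N_def by (rule integral_distr[OF Gm \<phi>m])
    have 2: "integral\<^sup>L eta \<phi> = (LINT y|\<eta>. \<phi> y)"
      unfolding eta_def by (rule integral_distr[OF id_measurable \<phi>m])
    have "(\<lambda>i. LINT y|\<eta>. \<phi> (G i y)) \<longlonglongrightarrow> (LINT y|\<eta>. \<phi> y)"
    proof (rule integral_dominated_convergence[where w="\<lambda>_. 1"])
      show "AE y in \<eta>. (\<lambda>i. \<phi> (G i y)) \<longlonglongrightarrow> \<phi> y"
        by (rule AE_I2) (auto simp: space_\<eta> intro!: continuous_on_tendsto_compose[OF \<phi>(1)] Glim)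
      show "\<phi> \<in> borel_measurable \<eta>" using measurable_compose[OF id_measurable \<phi>m] .
    qed (use \<phi>(2) in auto)
    then show ?thesis unfolding 1 2 .
  qed
  show ?thesis by (rule solution_limit[OF lower_adm[OF e(1)] sur Nlim]) auto
qed

text \<open>A minimizing sequence has a subsequence converging to a solution, and the surplus
  converges along it. Minimal surplus is minimal light at P0, since the two differ by the constant
  \<eta>({P0}).\<close>

lemma minimal_solution:
  obtains \<rho> where "\<rho> \<in> solutions" "\<And>\<rho>'. \<rho>' \<in> solutions \<Longrightarrow> surplus \<rho> \<le> surplus \<rho>'"
proof -
  define s where "s = Inf (surplus ` solutions)"
  have pos: "surplus \<rho> > 0" if "\<rho> \<in> solutions" for \<rho> using that surplus_pos by (simp add: solutions_iff)
  then have bdd: "bdd_below (surplus ` solutions)" by (intro bdd_belowI2[of _ 0]) (auto intro: less_imp_le)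
  have le: "s \<le> surplus \<rho>" if "\<rho> \<in> solutions" for \<rho> unfolding s_def using that bdd by (intro cInf_lower) auto
  have "\<exists>\<rho>\<in>solutions. surplus \<rho> < s + inverse (real (Suc n))" for n
    using cInf_lessD[of "surplus ` solutions" "s + inverse (real (Suc n))"] solutions_nonempty by (auto simp: s_def)
  then obtain \<rho> where \<rho>: "\<And>n. \<rho> n \<in> solutions" "\<And>n. surplus (\<rho> n) < s + inverse (real (Suc n))" by metis
  have adm: "\<rho> n \<in> adm" for n using \<rho>(1)[of n] by (simp add: solutions_iff)
  obtain r \<rho>0 where r: "strict_mono (r :: nat \<Rightarrow> nat)" "\<rho>0 \<in> solutions" "(\<lambda>n. surplus (\<rho> (r n))) \<longlonglongrightarrow> surplus \<rho>0"
    by (rule solution_limit[OF adm integral_solution[OF \<rho>(1)] tendsto_const])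
  have "(\<lambda>n. s + inverse (real (Suc (r n)))) \<longlonglongrightarrow> s + 0"
    using LIMSEQ_subseq_LIMSEQ[OF LIMSEQ_inverse_real_of_nat r(1)] by (intro tendsto_intros) (simp add: comp_def)
  then have "surplus \<rho>0 \<le> s + 0"
    by (rule LIMSEQ_le[OF r(3)]) (intro exI allI impI less_imp_le[OF \<rho>(2)])
  then show ?thesis using that[OF r(2)] le by force
qed

end

theorem mainTheorem5:
  fixes D \<Omega> X :: "(real^3) set" and f :: "real^3 \<Rightarrow> real" and \<eta> :: "(real^3) measure"
    and \<delta> k M c C :: real and P0 :: "real^3"
  assumes D: "compact D" "0 \<notin> D"
    and D_shape: "(\<exists>a b. a \<noteq> 0 \<and> D \<subseteq> {y. a \<bullet> y = b}) \<or> countable D"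
    and M: "M = max_dist D"
    and \<Omega>: "\<Omega> \<subseteq> S2" "emeasure sphere_measure (S2_frontier \<Omega>) = 0"
    and X: "X = S2_closure \<Omega>"
    and f: "set_integrable sphere_measure X f" "AE x in sphere_measure. x \<in> X \<longrightarrow> f x > 0"
    and \<eta>: "radon_measure_on D \<eta>"
    and \<delta>: "\<delta> > 0"
    and c: "c = c_of \<delta>"
    and k: "k \<ge> (1 + c) / (1 - c)"
    and C: "C = (1 - c)^3 / ((1 + c) * (k * \<delta> * M)\<^sup>2)"
    and energy: "(LINT x:X|sphere_measure. f x) \<ge> 1 / C * measure \<eta> D"
    and P0: "P0 \<in> measure_support D \<eta>"
  shows "\<exists>\<rho> \<in> reflector_solutions X D f \<eta> \<delta> k P0.
    reflector_measure X f \<rho> {P0} =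
      (INF \<rho>' \<in> reflector_solutions X D f \<eta> \<delta> k P0. reflector_measure X f \<rho>' {P0}) \<and>
    (reflector_measure X f \<rho> {P0} > 0 \<longrightarrow>
      (\<forall>G. openin (top_of_set D) G \<and> P0 \<in> G \<longrightarrow> reflector_measure X f \<rho> G > emeasure \<eta> G)) \<and>
    (reflector_measure X f \<rho> {P0} = 0 \<longrightarrow>
      (\<forall>E\<in>sets borel. E \<subseteq> D \<longrightarrow> reflector_measure X f \<rho> E = emeasure \<eta> E))"
proof -
  interpret reflector_problem D \<Omega> X f \<eta> \<delta> k M c C P0
    using assms by (rule reflector_problem.intro)
  interpret e: finite_measure \<eta> by (rule finite_\<eta>)
  obtain \<rho> where \<rho>: "\<rho> \<in> solutions" "\<And>\<rho>'. \<rho>' \<in> solutions \<Longrightarrow> surplus \<rho> \<le> surplus \<rho>'"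
    by (rule minimal_solution) (blast intro: that)
  have pos: "surplus \<rho> > 0" using \<rho>(1) surplus_pos by (simp add: solutions_iff)
  have P0_set: "{P0} \<in> sets borel" "{P0} \<subseteq> D" using P0_D by auto
  have at_P0: "reflector_measure X f \<rho>' {P0} = emeasure \<eta> {P0} + ennreal (surplus \<rho>')" if "\<rho>' \<in> solutions" for \<rho>'
    using reflector_measure_solution[OF that P0_set] by simp
  have "reflector_measure X f \<rho> {P0} = (INF \<rho>'\<in>solutions. reflector_measure X f \<rho>' {P0})"
    using \<rho> by (intro antisym INF_greatest INF_lower) (auto simp: at_P0 intro!: add_left_mono ennreal_leI)
  \<comment> \<open>Finiteness of \<eta> makes the addition of the positive surplus strict.\<close>
  moreover have "reflector_measure X f \<rho> G > emeasure \<eta> G" if G: "openin (top_of_set D) G" "P0 \<in> G" for G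
  proof -
    have "G \<in> sets borel" "G \<subseteq> D"
      using G(1) D_borel by (auto simp: openin_open)
    from reflector_measure_solution[OF \<rho>(1) this] show ?thesis
      using G(2) pos by (simp add: e.emeasure_eq_measure ennreal_plus[symmetric] ennreal_less_iff del: ennreal_plus)
  qed
  moreover have "reflector_measure X f \<rho> {P0} \<noteq> 0" using at_P0[OF \<rho>(1)] pos by simp
  ultimately show ?thesis using \<rho>(1) by blast
qed

end
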